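(* Let $k$ be a field and let $L$ be a simple Lie algebra over $k$. Assume that for some Galois extension $k'/k$ with $k'\neq\mathbb F_2$, the Lie algebra $L_{k'}:=L\otimes_k k'$ is simple, is generated by its pure extremal elements, and its extremal geometry contains lines. Let $x,y\in L$ be extremal elements of $L$ forming a hyperbolic pair, scaled so that $g(x,y)=1$, and let $L=L_{-2}\oplus L_{-1}\oplus L_0\oplus L_1\oplus L_2$ be the associated $5$-grading. Then $L$ is algebraic with respect to this grading, i.e. for every $l\in L_1$ there exists an $l$-exponential automorphism of $L$.
   Context: Let $M$ be a Lie algebra over a field $F$. A nonzero $x\in M$ is extremal if there is a map $g_x\colon M\to F$ such that for all $u,w\in M$: $[x,[x,u]]=2g_x(u)x$, $[[x,u],[x,w]]=g_x([u,w])x+g_x(w)[x,u]-g_x(u)[x,w]$ and $[x,[u,[x,w]]]=g_x([u,w])x-g_x(w)[x,u]-g_x(u)[x,w]$. An element $x$ is a sandwich if $[x,[x,u]]=0$ and $[x,[u,[x,w]]]=0$ for all $u,w$ (for sandwiches one takes $g_x=0$); an extremal element is pure if it is not a sandwich. If $M$ is generated by its pure extremal elements, there is a unique symmetric bilinear form $g$ on $M$ with $g(x,u)=g_x(u)$ for all extremal $x$ and all $u$; it satisfies $g([a,b],c)=g(a,[b,c])$. Two pure extremal elements $x,u$ with $Fx\neq Fu$ are collinear if $[x,u]=0$ and $\lambda x+\mu u$ is extremal or $0$ for all $\lambda,\mu\in F$; they are hyperbolic if $g(x,u)\neq 0$. The extremal geometry has as points the lines $Fx$ ($x$ extremal) and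 as lines the $2$-spaces spanned by collinear pairs; it "contains lines" if a collinear pair exists. Here $g$ denotes the form of $L_{k'}$; extremal elements of $L$ are extremal in $L_{k'}$, and $g$ takes values in $k$ on $L\times L$ for such elements. The $5$-grading associated with $x,y$ (with $g(x,y)=1$): put $N_L(x)=\{l\in L:[x,l]\in kx\}$, $U=\{u\in L: g(u,x)=g(u,y)=g(u,[x,y])=0\}$, and $L_{-2}=kx$, $L_{-1}=[x,U]$, $L_0=N_L(x)\cap N_L(y)$, $L_1=[y,U]$, $L_2=ky$; this is a $\mathbb Z$-grading $L=\bigoplus_{i=-2}^{2}L_i$, and we set $L_i=0$ for $|i|>2$. For $l\in L_1$, an automorphism $\alpha$ of $L$ is called $l$-exponential if there exist maps $q_\alpha,n_\alpha,v_\alpha\colon L\to L$ with $q_\alpha(L_i)\subseteq L_{i+2}$, $n_\alpha(L_i)\subseteq L_{i+3}$, $v_\alpha(L_i)\subseteq L_{i+4}$ for all $i\in[-2,2]$ such that $\alpha(m)=m+[l,m]+q_\alpha(m)+n_\alpha(m)+v_\alpha(m)$ for all $m\in L$. *)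

theory Defs
  imports Main "HOL-Computational_Algebra.Polynomial"
begin

definition lie_algebra :: "('f::field \<Rightarrow> 'm::ab_group_add \<Rightarrow> 'm) \<Rightarrow> ('m \<Rightarrow> 'm \<Rightarrow> 'm) \<Rightarrow> bool" where
  "lie_algebra sc br \<longleftrightarrow> vector_space sc
     \<and> (\<forall>x y z. br (x + y) z = br x z + br y z)
     \<and> (\<forall>x y z. br x (y + z) = br x y + br x z)
     \<and> (\<forall>a x y. br (sc a x) y = sc a (br x y))
     \<and> (\<forall>a x y. br x (sc a y) = sc a (br x y))
     \<and> (\<forall>x. br x x = 0)
     \<and> (\<forall>x y z. br x (br y z) + br y (br z x) + br z (br x y) = 0)"

definition lie_ideal :: "('f::field \<Rightarrow> 'm::ab_group_add \<Rightarrow> 'm) \<Rightarrow> ('m \<Rightarrow> 'm \<Rightarrow> 'm) \<Rightarrow> 'm set \<Rightarrow> bool" where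
  "lie_ideal sc br I \<longleftrightarrow> module.subspace sc I \<and> (\<forall>x. \<forall>i\<in>I. br x i \<in> I)"

definition lie_subalgebra :: "('f::field \<Rightarrow> 'm::ab_group_add \<Rightarrow> 'm) \<Rightarrow> ('m \<Rightarrow> 'm \<Rightarrow> 'm) \<Rightarrow> 'm set \<Rightarrow> bool" where
  "lie_subalgebra sc br S \<longleftrightarrow> module.subspace sc S \<and> (\<forall>x\<in>S. \<forall>y\<in>S. br x y \<in> S)"

definition simple_lie_algebra :: "('f::field \<Rightarrow> 'm::ab_group_add \<Rightarrow> 'm) \<Rightarrow> ('m \<Rightarrow> 'm \<Rightarrow> 'm) \<Rightarrow> bool" where
  "simple_lie_algebra sc br \<longleftrightarrow> lie_algebra sc br \<and> (\<exists>x y. br x y \<noteq> 0)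
     \<and> (\<forall>I. lie_ideal sc br I \<longrightarrow> I = {0} \<or> I = UNIV)"

definition lie_generated_by :: "('f::field \<Rightarrow> 'm::ab_group_add \<Rightarrow> 'm) \<Rightarrow> ('m \<Rightarrow> 'm \<Rightarrow> 'm) \<Rightarrow> 'm set \<Rightarrow> bool" where
  "lie_generated_by sc br E \<longleftrightarrow> (\<forall>S. lie_subalgebra sc br S \<and> E \<subseteq> S \<longrightarrow> S = UNIV)"

definition extremal_wrt :: "('f::field \<Rightarrow> 'm::ab_group_add \<Rightarrow> 'm) \<Rightarrow> ('m \<Rightarrow> 'm \<Rightarrow> 'm) \<Rightarrow> 'm \<Rightarrow> ('m \<Rightarrow> 'f) \<Rightarrow> bool" where
  "extremal_wrt sc br x gx \<longleftrightarrow>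
     (\<forall>u. br x (br x u) = sc (2 * gx u) x)
   \<and> (\<forall>u w. br (br x u) (br x w) = sc (gx (br u w)) x + sc (gx w) (br x u) - sc (gx u) (br x w))
   \<and> (\<forall>u w. br x (br u (br x w)) = sc (gx (br u w)) x - sc (gx w) (br x u) - sc (gx u) (br x w))"

definition extremal :: "('f::field \<Rightarrow> 'm::ab_group_add \<Rightarrow> 'm) \<Rightarrow> ('m \<Rightarrow> 'm \<Rightarrow> 'm) \<Rightarrow> 'm \<Rightarrow> bool" where
  "extremal sc br x \<longleftrightarrow> x \<noteq> 0 \<and> (\<exists>gx. extremal_wrt sc br x gx)"

definition sandwich :: "('m::ab_group_add \<Rightarrow> 'm \<Rightarrow> 'm) \<Rightarrow> 'm \<Rightarrow> bool" where
  "sandwich br x \<longleftrightarrow> (\<forall>u. br x (br x u) = 0) \<and> (\<forall>u w. br x (br u (br x w)) = 0)"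

definition pure_extremal :: "('f::field \<Rightarrow> 'm::ab_group_add \<Rightarrow> 'm) \<Rightarrow> ('m \<Rightarrow> 'm \<Rightarrow> 'm) \<Rightarrow> 'm \<Rightarrow> bool" where
  "pure_extremal sc br x \<longleftrightarrow> extremal sc br x \<and> \<not> sandwich br x"

definition extremal_form :: "('f::field \<Rightarrow> 'm::ab_group_add \<Rightarrow> 'm) \<Rightarrow> ('m \<Rightarrow> 'm \<Rightarrow> 'm) \<Rightarrow> ('m \<Rightarrow> 'm \<Rightarrow> 'f) \<Rightarrow> bool" where
  "extremal_form sc br g \<longleftrightarrow>
     (\<forall>x y. g x y = g y x)
   \<and> (\<forall>x y z. g (x + y) z = g x z + g y z)
   \<and> (\<forall>a x y. g (sc a x) y = a * g x y)
   \<and> (\<forall>x. extremal sc br x \<longrightarrow> extremal_wrt sc br x (g x))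
   \<and> (\<forall>x. extremal sc br x \<and> sandwich br x \<longrightarrow> (\<forall>u. g x u = 0))"

definition collinear_extremal :: "('f::field \<Rightarrow> 'm::ab_group_add \<Rightarrow> 'm) \<Rightarrow> ('m \<Rightarrow> 'm \<Rightarrow> 'm) \<Rightarrow> 'm \<Rightarrow> 'm \<Rightarrow> bool" where
  "collinear_extremal sc br x u \<longleftrightarrow> pure_extremal sc br x \<and> pure_extremal sc br u
     \<and> (\<forall>a. u \<noteq> sc a x) \<and> br x u = 0
     \<and> (\<forall>a b. extremal sc br (sc a x + sc b u) \<or> sc a x + sc b u = 0)"

definition geometry_contains_lines :: "('f::field \<Rightarrow> 'm::ab_group_add \<Rightarrow> 'm) \<Rightarrow> ('m \<Rightarrow> 'm \<Rightarrow> 'm) \<Rightarrow> bool" where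
  "geometry_contains_lines sc br \<longleftrightarrow> (\<exists>x u. collinear_extremal sc br x u)"

definition field_embedding :: "('k::field \<Rightarrow> 'K::field) \<Rightarrow> bool" where
  "field_embedding e \<longleftrightarrow> (\<forall>a b. e (a + b) = e a + e b) \<and> (\<forall>a b. e (a * b) = e a * e b) \<and> e 1 = 1"

text \<open>Galois (possibly infinite): every element of K is a root of a nonzero polynomial with
  coefficients in k that splits over K into pairwise distinct linear factors
  (i.e. K/k is algebraic, normal and separable).\<close>
definition galois_ext :: "('k::field \<Rightarrow> 'K::field) \<Rightarrow> bool" where
  "galois_ext e \<longleftrightarrow> field_embedding e \<and>
     (\<forall>z::'K. \<exists>p::'K poly. p \<noteq> 0 \<and> (\<forall>i. coeff p i \<in> range e) \<and> poly p z = 0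
        \<and> (\<exists>c rs. distinct rs \<and> p = smult c (\<Prod>r\<leftarrow>rs. [:- r, 1:])))"

text \<open>Scalar extension: (L', scK, brK) is L \<otimes>_k K via \<iota> (x \<mapsto> x \<otimes> 1): \<iota> is k-semilinear along e,
  a Lie homomorphism, and maps some k-basis of L bijectively onto a K-basis of L'.\<close>
definition scalar_extension ::
  "('k::field \<Rightarrow> 'K::field) \<Rightarrow> ('k \<Rightarrow> 'a::ab_group_add \<Rightarrow> 'a) \<Rightarrow> ('a \<Rightarrow> 'a \<Rightarrow> 'a)
   \<Rightarrow> ('K \<Rightarrow> 'b::ab_group_add \<Rightarrow> 'b) \<Rightarrow> ('b \<Rightarrow> 'b \<Rightarrow> 'b) \<Rightarrow> ('a \<Rightarrow> 'b) \<Rightarrow> bool" where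
  "scalar_extension e sc br scK brK \<iota> \<longleftrightarrow>
     field_embedding e \<and> lie_algebra sc br \<and> lie_algebra scK brK
   \<and> (\<forall>x y. \<iota> (x + y) = \<iota> x + \<iota> y)
   \<and> (\<forall>a x. \<iota> (sc a x) = scK (e a) (\<iota> x))
   \<and> (\<forall>x y. \<iota> (br x y) = brK (\<iota> x) (\<iota> y))
   \<and> (\<exists>B. \<not> module.dependent sc B \<and> module.span sc B = UNIV \<and> inj_on \<iota> B
         \<and> \<not> module.dependent scK (\<iota> ` B) \<and> module.span scK (\<iota> ` B) = UNIV)"

text \<open>Grading of L associated with x, y, where g is the form of L_{k'} pulled back via \<iota>.\<close>
definition grading ::
  "('k::field \<Rightarrow> 'a::ab_group_add \<Rightarrow> 'a) \<Rightarrow> ('a \<Rightarrow> 'a \<Rightarrow> 'a) \<Rightarrow> ('a \<Rightarrow> 'a \<Rightarrow> 'K::field)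
   \<Rightarrow> 'a \<Rightarrow> 'a \<Rightarrow> int \<Rightarrow> 'a set" where
  "grading sc br gL x y i =
    (let N = (\<lambda>z. {l. \<exists>a. br z l = sc a z});
         U = {u. gL u x = 0 \<and> gL u y = 0 \<and> gL u (br x y) = 0}
     in if i = -2 then range (\<lambda>a. sc a x)
        else if i = -1 then (\<lambda>u. br x u) ` U
        else if i = 0 then N x \<inter> N y
        else if i = 1 then (\<lambda>u. br y u) ` U
        else if i = 2 then range (\<lambda>a. sc a y)
        else {0})"

definition lie_automorphism :: "('f::field \<Rightarrow> 'm::ab_group_add \<Rightarrow> 'm) \<Rightarrow> ('m \<Rightarrow> 'm \<Rightarrow> 'm) \<Rightarrow> ('m \<Rightarrow> 'm) \<Rightarrow> bool" where
  "lie_automorphism sc br \<alpha> \<longleftrightarrow> bij \<alpha> \<and> (\<forall>x y. \<alpha> (x + y) = \<alpha> x + \<alpha> y)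
     \<and> (\<forall>a x. \<alpha> (sc a x) = sc a (\<alpha> x)) \<and> (\<forall>x y. \<alpha> (br x y) = br (\<alpha> x) (\<alpha> y))"

definition exponential_automorphism ::
  "('f::field \<Rightarrow> 'm::ab_group_add \<Rightarrow> 'm) \<Rightarrow> ('m \<Rightarrow> 'm \<Rightarrow> 'm) \<Rightarrow> (int \<Rightarrow> 'm set) \<Rightarrow> 'm \<Rightarrow> ('m \<Rightarrow> 'm) \<Rightarrow> bool" where
  "exponential_automorphism sc br Gr l \<alpha> \<longleftrightarrow> lie_automorphism sc br \<alpha> \<and>
     (\<exists>q n v. (\<forall>i\<in>{-2..2}. q ` Gr i \<subseteq> Gr (i + 2) \<and> n ` Gr i \<subseteq> Gr (i + 3) \<and> v ` Gr i \<subseteq> Gr (i + 4))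
        \<and> (\<forall>m. \<alpha> m = m + br l m + q m + n m + v m))"

end

(*
  Over the large field, every extremal c yields the automorphism Exp c m = m + [c,m] + g(c,m) c, and if c lies in
  L_1 this automorphism is c-exponential. Products of c- and d-exponential automorphisms are (c+d)-exponential, so
  over the large field it is enough that L_1 is spanned by the extremal elements in it. To see this, let S_1 and
  S_(-1) be the spans of the extremal elements in L_1 and L_(-1), and let N be the stabiliser of both in L_0. Then
  R = L_(-2) + S_(-1) + N + S_1 + L_2 is a subalgebra. All special neighbours of y lie in R, and this
  property spreads from y along special and hyperbolic neighbours to every extremal element. Hence R is everything.

  For the descent, write an l-exponential automorphism as a Hasse-Schmidt derivation 1 + ad l + q + n + v. The
  conditions on q, n, v are linear in the component of highest degree. A linear retraction of the large field
  onto k therefore produces, one degree after the other, a solution over k; it differs from the given one by a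
  derivation of degree 2, 3 or 4, which can be integrated to a Hasse-Schmidt derivation and composed with
  the given one. Only degree 2 in characteristic 2 needs an argument: there ad (D x)^2 is a scalar on L_1.
*)

theory Submission
  imports Defs
begin

section \<open>Lie algebras and gradings\<close>

text \<open>Characteristic 2 shapes the proof. There \<open>br c (br c u)\<close> vanishes for every
  extremal \<open>c\<close>, so neither the functional of \<open>c\<close> nor the quadratic part of
  its exponential can be read off from the square of \<open>br c\<close>; both are carried by the
  form. Likewise the eigenvalues of \<open>br x y\<close> no longer separate degrees of equal
  parity, so components are described by \<open>br x\<close> and \<open>br y\<close> separately. The
  hypothesis on lines enters at one point: it yields perpendicular extremal elements that do not
  commute, hence nonzero extremal elements in L_1, without which there would be nothing to spread
  along. The degree 0 part N is a full stabiliser rather than a span of brackets; closure of R then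
  needs no description of L_0 by generators, only that brackets of S_1 with S_(-1) preserve both
  spans.\<close>

locale lie_alg = vector_space sc
  for sc :: "'f::field \<Rightarrow> 'm::ab_group_add \<Rightarrow> 'm" (infixr "*s" 75) +
  fixes br :: "'m \<Rightarrow> 'm \<Rightarrow> 'm"
  assumes br_add_left: "br (a + b) c = br a c + br b c"
    and br_add_right: "br a (b + c) = br a b + br a c"
    and br_scale_left: "br (s *s a) b = s *s br a b"
    and br_scale_right: "br a (s *s b) = s *s br a b"
    and br_self: "br a a = 0"
    and jacobi_cyclic: "br a (br b c) + br b (br c a) + br c (br a b) = 0"
begin

lemma br_zero_left [simp]: "br 0 a = 0" and br_zero_right [simp]: "br a 0 = 0"
  using br_add_left[of 0 0 a] br_add_right[of a 0 0] by auto

lemma br_minus_left: "br (- a) b = - br a b"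
  by (metis add.right_inverse br_add_left br_zero_left minus_unique)

lemma br_minus_right: "br a (- b) = - br a b"
  by (metis add.right_inverse br_add_right br_zero_right minus_unique)

lemma br_diff_left: "br (a - b) c = br a c - br b c"
  by (metis br_add_left diff_add_cancel add_diff_cancel)

lemma br_diff_right: "br a (b - c) = br a b - br a c"
  by (metis br_add_right diff_add_cancel add_diff_cancel)

lemma br_sum_left: "br (sum f A) b = (\<Sum>i\<in>A. br (f i) b)"
  by (induction A rule: infinite_finite_induct) (auto simp: br_add_left)

lemma br_sum_right: "br a (sum f A) = (\<Sum>i\<in>A. br a (f i))"
  by (induction A rule: infinite_finite_induct) (auto simp: br_add_right)

lemma br_swap: "br a b = - br b a"
proof -
  have "br (a + b) (a + b) = br a b + br b a"
    unfolding br_add_left br_add_right by (simp add: br_self add.commute)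
  then have "br a b + br b a = 0" by (simp only: br_self)
  then show ?thesis by (simp add: eq_neg_iff_add_eq_0)
qed

lemma jacobi: "br a (br b c) = br (br a b) c + br b (br a c)"
proof -
  have "br a (br b c) = - br b (br c a) - br c (br a b)"
    using jacobi_cyclic[of a b c] by (simp add: algebra_simps eq_neg_iff_add_eq_0)
  then show ?thesis
    by (metis br_minus_right br_swap diff_conv_add_uminus minus_minus add.commute)
qed

lemmas br_linear = br_add_left br_add_right br_scale_left br_scale_right
  br_minus_left br_minus_right br_diff_left br_diff_right

lemma scale_2: "2 *s a = a + a" "(2 * s) *s a = s *s a + s *s a" "(s * 2) *s a = s *s a + s *s a"
  using scale_left_distrib[of 1 1 a] scale_left_distrib[of s s a]
  by (simp_all only: mult_2 mult_2_right one_add_one scale_one)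

definition linmap :: "('m \<Rightarrow> 'm) \<Rightarrow> bool" where
  "linmap T \<longleftrightarrow> (\<forall>a b. T (a + b) = T a + T b) \<and> (\<forall>c a. T (c *s a) = c *s T a)"

definition linfun :: "('m \<Rightarrow> 'f) \<Rightarrow> bool" where
  "linfun p \<longleftrightarrow> (\<forall>a b. p (a + b) = p a + p b) \<and> (\<forall>c a. p (c *s a) = c * p a)"

lemma linmapD:
  assumes "linmap T"
  shows "T (a + b) = T a + T b" "T (c *s a) = c *s T a" "T 0 = 0" "T (- a) = - T a" "T (a - b) = T a - T b"
proof -
  show add: "T (a + b) = T a + T b" for a b using assms by (auto simp: linmap_def)
  show sca: "T (c *s a) = c *s T a" for c a using assms by (auto simp: linmap_def)
  show "T 0 = 0" using sca[of 0 0] by simp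
  show mi: "T (- a) = - T a" for a using sca[of "-1" a] by simp
  show "T (a - b) = T a - T b" using add[of a "- b"] mi by simp
qed

lemma linmap_sum: "linmap T \<Longrightarrow> T (sum f A) = (\<Sum>i\<in>A. T (f i))"
  by (induction A rule: infinite_finite_induct) (auto simp: linmapD)

lemma linfunD:
  assumes "linfun p"
  shows "p (a + b) = p a + p b" "p (c *s a) = c * p a" "p 0 = 0" "p (- a) = - p a" "p (a - b) = p a - p b"
proof -
  show add: "p (a + b) = p a + p b" for a b using assms by (auto simp: linfun_def)
  show sca: "p (c *s a) = c * p a" for c a using assms by (auto simp: linfun_def)
  show "p 0 = 0" using sca[of 0 0] by simp
  show mi: "p (- a) = - p a" for a using sca[of "-1" a] by simp
  show "p (a - b) = p a - p b" using add[of a "- b"] mi by simp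
qed

lemma linmap_br: "linmap (br a)"
  by (simp add: linmap_def br_linear)

lemma linmap_comp: "linmap S \<Longrightarrow> linmap T \<Longrightarrow> linmap (\<lambda>m. S (T m))"
  by (simp add: linmap_def)

lemma linmap_add: "linmap S \<Longrightarrow> linmap T \<Longrightarrow> linmap (\<lambda>m. S m + T m)"
  by (simp add: linmap_def scale_right_distrib)

lemma linmap_diff: "linmap S \<Longrightarrow> linmap T \<Longrightarrow> linmap (\<lambda>m. S m - T m)"
  by (simp add: linmap_def scale_right_diff_distrib)

lemma linmap_minus: "linmap S \<Longrightarrow> linmap (\<lambda>m. - S m)"
  by (simp add: linmap_def)

lemma linmap_scale: "linmap S \<Longrightarrow> linmap (\<lambda>m. c *s S m)"
  by (simp add: linmap_def scale_right_distrib mult.commute)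

lemma linmap_if: "linmap S \<Longrightarrow> linmap T \<Longrightarrow> linmap (\<lambda>m. if P then S m else T m)"
  by (cases P) simp_all

lemma linmap_zero: "linmap (\<lambda>m. 0)" and linmap_id: "linmap (\<lambda>m. m)" by (simp_all add: linmap_def)

lemma linmap_linfun: "linfun f \<Longrightarrow> linmap (\<lambda>m. f m *s a)"
  by (simp add: linmap_def linfun_def scale_left_distrib)

lemma linfun_mult: "linfun f \<Longrightarrow> linfun (\<lambda>m. c * f m)"
  by (simp add: linfun_def distrib_left)

lemma linfun_br: "linfun f \<Longrightarrow> linfun (\<lambda>m. f (br a m))"
  by (simp add: linfun_def br_linear)

lemmas linmap_intros = linmap_add linmap_diff linmap_minus linmap_if linmap_zero linmap_id
  linmap_linfun linmap_br

lemma linmap_sum_fun: "(\<And>i. i \<in> A \<Longrightarrow> linmap (T i)) \<Longrightarrow> linmap (\<lambda>m. \<Sum>i\<in>A. T i m)"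
  by (induction A rule: infinite_finite_induct) (auto simp: linmap_add linmap_zero)

lemma extremal_wrt_automorphism:
  assumes "extremal_wrt sc br c p" and add: "\<And>a b. \<phi> (a + b) = \<phi> a + \<phi> b"
    and sca: "\<And>s a. \<phi> (s *s a) = s *s \<phi> a" and hom: "\<And>a b. \<phi> (br a b) = br (\<phi> a) (\<phi> b)"
    and inv: "\<And>a. \<phi> (\<psi> a) = a" "\<And>a b. \<psi> (br a b) = br (\<psi> a) (\<psi> b)"
  shows "extremal_wrt sc br (\<phi> c) (\<lambda>u. p (\<psi> u))"
proof -
  have mi: "\<phi> (- a) = - \<phi> a" for a using sca[of "-1" a] by simp
  have di: "\<phi> (a - b) = \<phi> a - \<phi> b" for a b using add[of a "- b"] mi by simp
  have e1: "br c (br c u) = (2 * p u) *s c" for u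
    using assms(1) by (simp add: extremal_wrt_def)
  have e2: "br (br c u) (br c w) = p (br u w) *s c + p w *s br c u - p u *s br c w" for u w
    using assms(1) by (simp add: extremal_wrt_def)
  have e3: "br c (br u (br c w)) = p (br u w) *s c - p w *s br c u - p u *s br c w" for u w
    using assms(1) by (simp add: extremal_wrt_def)
  show ?thesis unfolding extremal_wrt_def
  proof (intro conjI allI)
    fix u w
    show "br (\<phi> c) (br (\<phi> c) u) = (2 * p (\<psi> u)) *s \<phi> c"
      using arg_cong[OF e1[of "\<psi> u"], of \<phi>] by (simp add: hom sca inv)
    show "br (br (\<phi> c) u) (br (\<phi> c) w)
      = p (\<psi> (br u w)) *s \<phi> c + p (\<psi> w) *s br (\<phi> c) u - p (\<psi> u) *s br (\<phi> c) w"
      using arg_cong[OF e2[of "\<psi> u" "\<psi> w"], of \<phi>] by (simp add: hom sca inv add di)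
    show "br (\<phi> c) (br u (br (\<phi> c) w))
      = p (\<psi> (br u w)) *s \<phi> c - p (\<psi> w) *s br (\<phi> c) u - p (\<psi> u) *s br (\<phi> c) w"
      using arg_cong[OF e3[of "\<psi> u" "\<psi> w"], of \<phi>] by (simp add: hom sca inv di)
  qed
qed

end

lemma lie_alg_iff: "lie_algebra sc br \<longleftrightarrow> lie_alg sc br"
  unfolding lie_algebra_def lie_alg_def lie_alg_axioms_def by auto

text \<open>A grading is encoded by its projections rather than by its subspaces, so that
  decompositions are functions and homogeneity is an equation.\<close>

locale grad5 = lie_alg sc br
  for sc :: "'f::field \<Rightarrow> 'm::ab_group_add \<Rightarrow> 'm" (infixr "*s" 75) and br +
  fixes cmp :: "int \<Rightarrow> 'm \<Rightarrow> 'm"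
  assumes cmp_linmap: "linmap (cmp i)"
    and cmp_cmp: "cmp i (cmp j m) = (if i = j then cmp i m else 0)"
    and cmp_outside: "i < -2 \<or> i > 2 \<Longrightarrow> cmp i m = 0"
    and cmp_sum: "m = (\<Sum>i\<in>{-2..2}. cmp i m)"
    and cmp_br: "cmp (i + j) (br (cmp i a) (cmp j b)) = br (cmp i a) (cmp j b)"
begin

definition gr :: "int \<Rightarrow> 'm set" where "gr i = {m. cmp i m = m}"

lemmas cmp_lin = linmapD[OF cmp_linmap]

lemma cmp_gr: "cmp i m \<in> gr i" by (simp add: gr_def cmp_cmp)

lemma gr_cmp: "m \<in> gr i \<Longrightarrow> cmp j m = (if i = j then m else 0)"
  unfolding gr_def using cmp_cmp[of j i m] by auto

lemma gr_outside: "i < -2 \<or> i > 2 \<Longrightarrow> m \<in> gr i \<Longrightarrow> m = 0"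
  using cmp_outside by (auto simp: gr_def)

lemma gr_br: "a \<in> gr i \<Longrightarrow> b \<in> gr j \<Longrightarrow> br a b \<in> gr (i + j)"
  using cmp_br[of i j a b] by (simp add: gr_def)

lemma gr_0 [simp]: "0 \<in> gr i" and gr_add: "a \<in> gr i \<Longrightarrow> b \<in> gr i \<Longrightarrow> a + b \<in> gr i"
  and gr_scale: "a \<in> gr i \<Longrightarrow> s *s a \<in> gr i"
  and gr_diff: "a \<in> gr i \<Longrightarrow> b \<in> gr i \<Longrightarrow> a - b \<in> gr i"
  by (auto simp: gr_def cmp_lin)

lemma range5: "{-2..2::int} = {-2,-1,0,1,2}" by auto

lemma cmp_sum5: "m = cmp (-2) m + cmp (-1) m + cmp 0 m + cmp 1 m + cmp 2 m"
  using cmp_sum[of m] unfolding range5 by (simp add: add.assoc)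

lemma eqI_hom:
  assumes "linmap S" "linmap T" "\<And>i m. m \<in> gr i \<Longrightarrow> S m = T m"
  shows "S m = T m"
proof -
  have "S m = S (\<Sum>i\<in>{-2..2}. cmp i m)" using cmp_sum[of m] by simp
  also have "\<dots> = T (\<Sum>i\<in>{-2..2}. cmp i m)"
    unfolding linmap_sum[OF assms(1)] linmap_sum[OF assms(2)]
    by (rule sum.cong) (auto intro!: assms(3) cmp_gr)
  finally show ?thesis using cmp_sum[of m] by simp
qed

lemma bilinear_eqI:
  assumes "\<And>b. linmap (\<lambda>a. S a b)" "\<And>b. linmap (\<lambda>a. T a b)"
    "\<And>a. linmap (S a)" "\<And>a. linmap (T a)"
    "\<And>i j a b. a \<in> gr i \<Longrightarrow> b \<in> gr j \<Longrightarrow> S a b = T a b"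
  shows "S a b = T a b"
proof -
  have "S a b = T a b" if "a \<in> gr i" for a i
    by (rule eqI_hom[OF assms(3,4)]) (rule assms(5)[OF that])
  then show ?thesis
    by (rule eqI_hom[of "\<lambda>a. S a b" "\<lambda>a. T a b", OF assms(1,2)])
qed

definition hom :: "int \<Rightarrow> ('m \<Rightarrow> 'm) \<Rightarrow> bool" where
  "hom d T \<longleftrightarrow> linmap T \<and> (\<forall>i. \<forall>m\<in>gr i. T m \<in> gr (i + d))"

lemma homD: "hom d T \<Longrightarrow> linmap T" "hom d T \<Longrightarrow> m \<in> gr i \<Longrightarrow> T m \<in> gr (i + d)"
  by (auto simp: hom_def)

text \<open>The extreme degrees -2 and 2 are only 4 apart.\<close>

lemma hom_eq_0: "hom d T \<Longrightarrow> d > 4 \<Longrightarrow> T m = 0"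
proof -
  assume T: "hom d T" and d: "d > 4"
  show "T m = 0"
  proof (rule eqI_hom[of T "\<lambda>m. 0"])
    fix i m assume m: "m \<in> gr i"
    show "T m = 0"
      using gr_outside[of i m] gr_outside[of "i + d" "T m"] homD[OF T] m d linmapD(3)[of T]
      by (cases "i < -2") auto
  qed (use T in \<open>auto simp: hom_def linmap_zero\<close>)
qed

lemma hom_comp: "hom d S \<Longrightarrow> hom f T \<Longrightarrow> hom (d + f) (\<lambda>m. S (T m))"
  unfolding hom_def by (auto simp: linmap_comp) (metis add.assoc add.commute)

lemma hom_add: "hom d S \<Longrightarrow> hom d T \<Longrightarrow> hom d (\<lambda>m. S m + T m)"
  unfolding hom_def by (auto simp: linmap_add gr_add)

lemma hom_zero: "hom d (\<lambda>m. 0)" by (auto simp: hom_def linmap_zero)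

lemma hom_sum: "(\<And>i. i \<in> A \<Longrightarrow> hom d (T i)) \<Longrightarrow> hom d (\<lambda>m. \<Sum>i\<in>A. T i m)"
  by (induction A rule: infinite_finite_induct) (auto simp: hom_add hom_zero)

lemma hom_br: "l \<in> gr i \<Longrightarrow> hom i (br l)"
  by (auto simp: hom_def linmap_br) (metis add.commute gr_br)

lemma hom_cmp: "hom d T \<Longrightarrow> cmp (i + d) (T m) = T (cmp i m)"
proof (rule eqI_hom[of "\<lambda>m. cmp (i + d) (T m)" "\<lambda>m. T (cmp i m)"])
  assume T: "hom d T"
  fix j m assume m: "m \<in> gr j"
  show "cmp (i + d) (T m) = T (cmp i m)"
    using gr_cmp[OF m, of i] gr_cmp[OF homD(2)[OF T m], of "i + d"] linmapD(3)[OF homD(1)[OF T]] by auto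
qed (auto simp: hom_def linmap_comp cmp_linmap)

text \<open>The one-parameter torus of the grading. It distinguishes components in situations where
  integer eigenvalues may coincide modulo the characteristic.\<close>

definition torus :: "'f \<Rightarrow> 'm \<Rightarrow> 'm" where
  "torus t m = (\<Sum>i\<in>{-2..2}. (t powi i) *s cmp i m)"

lemma torus_linmap: "linmap (torus t)"
  unfolding torus_def linmap_def
  by (auto simp: cmp_lin scale_right_distrib sum.distrib scale_sum_right mult.commute)

lemma torus_gr: "m \<in> gr i \<Longrightarrow> torus t m = (t powi i) *s m"
proof -
  assume m: "m \<in> gr i"
  have "torus t m = (\<Sum>j\<in>{-2..2}. if j = i then (t powi i) *s m else 0)"
    unfolding torus_def by (rule sum.cong) (auto simp: gr_cmp[OF m])
  also have "\<dots> = (t powi i) *s m"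
    using gr_outside[OF _ m] by (cases "i \<in> {-2..2}") auto
  finally show ?thesis .
qed

lemma torus_br: "t \<noteq> 0 \<Longrightarrow> torus t (br a b) = br (torus t a) (torus t b)"
proof (rule bilinear_eqI[of "\<lambda>a b. torus t (br a b)" "\<lambda>a b. br (torus t a) (torus t b)"])
  fix i j a b assume "t \<noteq> 0" and a: "a \<in> gr i" and b: "b \<in> gr j"
  then show "torus t (br a b) = br (torus t a) (torus t b)"
    by (simp add: torus_gr[OF a] torus_gr[OF b] torus_gr[OF gr_br[OF a b]] br_linear power_int_add mult.commute)
qed (auto simp: linmap_def linmapD[OF torus_linmap] br_linear)

lemma torus_inverse: "t \<noteq> 0 \<Longrightarrow> torus t (torus (inverse t) m) = m"
proof (rule eqI_hom[of "\<lambda>m. torus t (torus (inverse t) m)" "\<lambda>m. m"])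
  fix i m assume "t \<noteq> 0" and m: "m \<in> gr i"
  then show "torus t (torus (inverse t) m) = m"
    by (simp add: torus_gr[OF m] linmapD[OF torus_linmap] power_int_inverse)
qed (auto simp: linmap_def linmapD[OF torus_linmap])

end

section \<open>The 5-grading of a hyperbolic pair\<close>

text \<open>Only the two functionals \<open>p\<close> and \<open>r\<close> occur, not a global form,
  so that the locale applies over the small field as well, where no form is given. The relation
  between \<open>p\<close> and \<open>r\<close> is what remains of associativity of the
  form.\<close>

locale hyp = lie_alg sc br
  for sc :: "'f::field \<Rightarrow> 'm::ab_group_add \<Rightarrow> 'm" (infixr "*s" 75) and br +
  fixes x y :: 'm and p r :: "'m \<Rightarrow> 'f"
  assumes p_lin: "linfun p" and r_lin: "linfun r"
    and ext_x: "extremal_wrt sc br x p" and ext_y: "extremal_wrt sc br y r"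
    and p_y: "p y = 1" and r_x: "r x = 1" and p_x: "p x = 0" and r_y: "r y = 0"
    and p_br_x: "p (br x m) = 0" and r_br_y: "r (br y m) = 0"
    and p_br_y: "p (br y m) = - r (br x m)" and e_neq_0: "br x y \<noteq> 0"
begin

lemma hyp_swap: "hyp sc br y x r p"
  unfolding hyp_def hyp_axioms_def
  using lie_alg_axioms p_lin r_lin ext_x ext_y p_y r_x p_x r_y p_br_x r_br_y p_br_y e_neq_0 br_swap[of y x]
  by auto

lemmas pl = linfunD[OF p_lin] and rl = linfunD[OF r_lin]

lemma x1: "br x (br x u) = (2 * p u) *s x"
  and x3: "br x (br u (br x w)) = p (br u w) *s x - p w *s br x u - p u *s br x w"
  using ext_x by (auto simp: extremal_wrt_def)

lemma y1: "br y (br y u) = (2 * r u) *s y"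
  and y2: "br (br y u) (br y w) = r (br u w) *s y + r w *s br y u - r u *s br y w"
  and y3: "br y (br u (br y w)) = r (br u w) *s y - r w *s br y u - r u *s br y w"
  using ext_y by (auto simp: extremal_wrt_def)

lemma r_br_x: "r (br x m) = - p (br y m)" by (simp add: p_br_y)

lemma x_neq_0: "x \<noteq> 0" and y_neq_0: "y \<noteq> 0" using e_neq_0 by auto

text \<open>The eigenvalue conditions in degrees \<open>1\<close> and \<open>-1\<close> describe the spaces \<open>[y, U]\<close> and \<open>[x, U]\<close>.\<close>

definition Gr :: "int \<Rightarrow> 'm set" where
  "Gr i = (if i = -2 then range (\<lambda>a. a *s x)
     else if i = -1 then {m. br x (br y m) = - m}
     else if i = 0 then {m. (\<exists>a. br x m = a *s x) \<and> (\<exists>a. br y m = a *s y)}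
     else if i = 1 then {m. br y (br x m) = - m}
     else if i = 2 then range (\<lambda>a. a *s y) else {0})"

text \<open>The leading terms in degrees -1 and 1 are the operators whose eigenvalue equations
  define these components; the correction terms cancel what they produce on \<open>x\<close>,
  \<open>y\<close> and L_0. Degree 0 is the remainder.\<close>

definition cp :: "int \<Rightarrow> 'm \<Rightarrow> 'm" where
  "cp i m = (if i = -2 then r m *s x
     else if i = -1 then - br x (br y m) - (2 * r m) *s x + p (br y m) *s br x y
     else if i = 0 then m - r m *s x - p m *s y + br x (br y m) + br y (br x m)
         + (2 * r m) *s x + (2 * p m) *s y - (2 * p (br y m)) *s br x y
     else if i = 1 then - br y (br x m) - (2 * p m) *s y + p (br y m) *s br x y
     else if i = 2 then p m *s y else 0)"

lemma Gr1_facts: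
  assumes "br y (br x m) = - m"
  shows "p m = 0" "r m = 0" "p (br y m) = 0" "br y m = 0"
proof -
  have m: "m = - br y (br x m)" using assms by simp
  show "r m = 0" by (subst m) (simp add: rl r_br_y)
  \<comment> \<open>The aim is \<open>p m = 2 * p m\<close>, which forces 0 in every characteristic;
    the same device settles \<open>p (br y m)\<close> below.\<close>
  have "p m = - p (br y (br x m))" by (metis m pl(4))
  also have "\<dots> = 2 * p m" by (simp add: p_br_y x1 rl r_x)
  finally have "p m = 2 * p m" .
  then show "p m = 0" by (metis mult_2 add_cancel_right_right)
  have "br y m = - br y (br y (br x m))" using m by (metis br_minus_right)
  then have b: "br y m = (2 * p (br y m)) *s y" by (simp add: y1 r_br_x)
  then have "p (br y m) = 2 * p (br y m)" by (metis pl(2) p_y mult.right_neutral)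
  then show "p (br y m) = 0" by (metis mult_2 add_cancel_right_right)
  then show "br y m = 0" using b by simp
qed

lemma Grm1_facts:
  assumes "br x (br y m) = - m"
  shows "p m = 0" "r m = 0" "p (br y m) = 0" "r (br x m) = 0" "br x m = 0"
  using hyp.Gr1_facts[OF hyp_swap assms] by (auto simp: p_br_y)

lemma yx: "br y x = - br x y" by (rule br_swap)

lemma br_xyx: "br x (br x y) = x + x" "br y (br x y) = - y - y"
  using x1[of y] y1[of x] by (auto simp: br_linear p_y r_x yx scale_2) (metis minus_minus minus_add_distrib diff_conv_add_uminus)

text \<open>The eigenvalue equations and the third extremal identity give two values for
  \<open>br x (br y (br x m))\<close>. They differ by a multiple of \<open>br x y\<close> with
  coefficient \<open>p m\<close>, and \<open>br x y\<close> is nonzero; \<open>r m\<close> is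
  treated in the same way.\<close>

lemma Gr0_facts:
  assumes "br x m = a *s x" "br y m = b *s y"
  shows "p m = 0" "r m = 0" "b = - a" "p (br y m) = b"
proof -
  show b: "p (br y m) = b" using assms by (simp add: pl p_y)
  show ba: "b = - a" using b p_br_y[of m] by (simp add: assms(1) rl r_x)
  have "p m *s br x y = 0"
  proof -
    have "br x (br y (br x m)) = a *s br x (br y x)" by (simp only: assms br_linear)
    also have "\<dots> = - a *s (x + x)" by (simp add: br_linear br_xyx yx algebra_simps)
    finally have "- a *s (x + x) = b *s x - p m *s br x y - a *s x"
      using x3[of y m] b by (simp add: assms(1) p_y)
    then show ?thesis using ba by (simp add: algebra_simps)
  qed
  then show "p m = 0" using e_neq_0 by simp
  have "r m *s br x y = 0"
  proof -
    have "br y (br x (br y m)) = b *s br y (br x y)" by (simp only: assms br_linear)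
    also have "\<dots> = - b *s (y + y)" by (simp add: br_xyx algebra_simps)
    finally have "- b *s (y + y) = a *s y + r m *s br x y - b *s y"
      using y3[of x m] by (simp add: assms r_x rl yx)
    then show ?thesis using ba by (simp add: algebra_simps)
  qed
  then show "r m = 0" using e_neq_0 by simp
qed

lemma xyx: "br x (br y (br x m)) = p (br y m) *s x - p m *s br x y - br x m"
  using x3[of y m] by (simp add: p_y)

lemma yxy: "br y (br x (br y m)) = - p (br y m) *s y + r m *s br x y - br y m"
  using y3[of x m] by (simp add: r_x r_br_x yx)

lemma Gr0_I: "br x m = a *s x \<Longrightarrow> br y m = b *s y \<Longrightarrow> m \<in> Gr 0"
  by (auto simp: Gr_def)

lemma cp_Gr: "cp i m \<in> Gr i"
proof -
  have "cp (-1) m \<in> Gr (-1)"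
  proof -
    have *: "br y (cp (-1) m) = br y m - p (br y m) *s y + r m *s br x y"
      using yxy[of m] by (simp add: cp_def br_linear yx br_xyx scale_2 algebra_simps)
    have "br x (br y (cp (-1) m)) = br x (br y m) - p (br y m) *s br x y + (2 * r m) *s x"
      unfolding * by (simp add: br_linear br_xyx scale_2 algebra_simps)
    then show ?thesis by (simp add: Gr_def cp_def)
  qed
  moreover have "cp 1 m \<in> Gr 1"
  proof -
    have *: "br x (cp 1 m) = br x m + p (br y m) *s x - p m *s br x y"
      using xyx[of m] by (simp add: cp_def br_linear yx br_xyx scale_2 algebra_simps)
    have "br y (br x (cp 1 m)) = br y (br x m) - p (br y m) *s br x y + (2 * p m) *s y"
      unfolding * by (simp add: br_linear br_xyx scale_2 yx algebra_simps)
    then show ?thesis by (simp add: Gr_def cp_def)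
  qed
  moreover have "cp 0 m \<in> Gr 0"
  proof -
    have "br x (br x (br y m)) = (2 * p (br y m)) *s x" by (simp add: x1)
    then have "br x (cp 0 m) = (- p (br y m)) *s x"
      using xyx[of m] by (simp add: cp_def br_linear br_self yx br_xyx scale_2 algebra_simps)
    moreover have "br y (br y (br x m)) = - (2 * p (br y m)) *s y" by (simp add: y1 r_br_x)
    then have "br y (cp 0 m) = p (br y m) *s y"
      using yxy[of m] by (simp add: cp_def br_linear br_self yx br_xyx scale_2 algebra_simps)
    ultimately show ?thesis by (rule Gr0_I)
  qed
  ultimately show ?thesis
    by (auto simp: cp_def Gr_def)
qed

lemma Gr_cp: "m \<in> Gr i \<Longrightarrow> cp j m = (if i = j then m else 0)"
proof -
  assume m: "m \<in> Gr i"
  consider a where "i = -2" "m = a *s x" | "i = -1" "br x (br y m) = - m"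
    | a b where "i = 0" "br x m = a *s x" "br y m = b *s y"
    | "i = 1" "br y (br x m) = - m" | a where "i = 2" "m = a *s y" | "m = 0"
    using m by (fastforce simp: Gr_def split: if_splits)
  then show ?thesis
  proof cases
    case 1
    then show ?thesis
      by (simp add: cp_def br_linear rl pl p_x r_x yx br_self br_xyx p_br_x scale_2 algebra_simps)
  next
    case 2
    then show ?thesis using Grm1_facts[OF 2(2)] by (simp add: cp_def)
  next
    case 3
    note z = Gr0_facts[OF 3(2,3)]
    show ?thesis using 3 z
      by (simp add: cp_def br_linear yx scale_2 algebra_simps)
  next
    case 4
    then show ?thesis using Gr1_facts[OF 4(2)] by (simp add: cp_def)
  next
    case 5
    then show ?thesis
      by (simp add: cp_def br_linear rl pl p_y r_y yx br_self br_xyx scale_2 algebra_simps)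
  qed (auto simp: cp_def pl rl)
qed

lemma cp_linmap: "linmap (cp i)"
  unfolding cp_def
  by (intro linmap_intros linfun_mult linfun_br p_lin r_lin
      linmap_comp[OF linmap_br, of _ x] linmap_comp[OF linmap_br, of _ y])

lemma cp_sum: "m = (\<Sum>i\<in>{-2..2}. cp i m)"
proof -
  have "{-2..2::int} = {-2,-1,0,1,2}" by auto
  moreover have "(2 * p (br y m)) *s br x y = p (br y m) *s br x y + p (br y m) *s br x y"
    by (simp add: scale_left_distrib[symmetric])
  ultimately show ?thesis by (simp add: cp_def)
qed

lemma Gr_scale: "m \<in> Gr i \<Longrightarrow> s *s m \<in> Gr i"
  by (metis Gr_cp cp_Gr linmapD(2)[OF cp_linmap])

lemma Gr_minus: "m \<in> Gr i \<Longrightarrow> - m \<in> Gr i"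
  by (metis Gr_cp cp_Gr linmapD(4)[OF cp_linmap])

lemma Gr_0 [simp]: "0 \<in> Gr i"
  using cp_Gr[of i 0] linmapD(3)[OF cp_linmap] by simp

lemma Gr1_D: "m \<in> Gr 1 \<Longrightarrow> br y (br x m) = - m" by (simp add: Gr_def)
lemma Grm1_D: "m \<in> Gr (-1) \<Longrightarrow> br x (br y m) = - m" by (simp add: Gr_def)

text \<open>An element \<open>a\<close> of degree 1 equals \<open>- br y (br x a)\<close>, so the
  second extremal identity for \<open>y\<close> computes the product; its last two terms
  vanish.\<close>

lemma Gr_1_1: "a \<in> Gr 1 \<Longrightarrow> b \<in> Gr 1 \<Longrightarrow> br a b \<in> Gr 2"
proof -
  assume a: "a \<in> Gr 1" and b: "b \<in> Gr 1"
  have "r (br x a) = 0" "r (br x b) = 0"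
    using Gr1_facts(3)[OF Gr1_D[OF a]] Gr1_facts(3)[OF Gr1_D[OF b]] by (auto simp: r_br_x)
  then have "br (br y (br x a)) (br y (br x b)) = r (br (br x a) (br x b)) *s y"
    by (simp add: y2)
  then have "br a b = r (br (br x a) (br x b)) *s y"
    using Gr1_D[OF a] Gr1_D[OF b] by (simp add: br_linear)
  then show "br a b \<in> Gr 2" unfolding Gr_def by auto
qed

lemma Gr_1_0: "m \<in> Gr 1 \<Longrightarrow> a \<in> Gr 0 \<Longrightarrow> br m a \<in> Gr 1"
proof -
  assume m: "m \<in> Gr 1" and "a \<in> Gr 0"
  then obtain \<alpha> \<beta> where xa: "br x a = \<alpha> *s x" and ya: "br y a = \<beta> *s y" by (auto simp: Gr_def)
  have \<beta>: "\<beta> = - \<alpha>" by (rule Gr0_facts(3)[OF xa ya])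
  note f = Gr1_facts[OF Gr1_D[OF m]]
  have "br x (br m a) = br (br x m) a + \<alpha> *s br m x" by (simp add: jacobi[of x m a] xa br_linear)
  moreover have "br y (br (br x m) a) = - br m a - \<beta> *s br y (br x m)"
    using jacobi[of y "br x m" a] Gr1_D[OF m] br_swap[of "br x m" y] by (simp add: ya br_linear)
  moreover have "br y (br m x) = m" using br_swap[of m x] Gr1_D[OF m] by (simp add: br_linear)
  ultimately have "br y (br x (br m a)) = - br m a"
    using Gr1_D[OF m] \<beta> by (simp add: br_linear)
  then show ?thesis by (simp add: Gr_def)
qed

lemma Gr_y_m1: "n \<in> Gr (-1) \<Longrightarrow> br y n \<in> Gr 1"
  using Grm1_D[of n] by (simp add: Gr_def br_minus_right)

lemma e_in_Gr0: "br x y \<in> Gr 0"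
  proof -
  have "br x (br x y) = 2 *s x" "br y (br x y) = (-2) *s y"
    by (simp_all add: br_xyx scale_2)
  then show ?thesis by (rule Gr0_I)
qed

lemma br_exy: "br (br x y) x = - x - x" "br (br x y) y = y + y"
  using br_swap[of "br x y"] by (simp_all add: br_xyx)

end

text \<open>Exchanging \<open>x\<close> and \<open>y\<close> reverses the grading, so every fact
  about degree \<open>i\<close> has a mirror image in degree \<open>- i\<close>.\<close>

sublocale hyp \<subseteq> sw: hyp sc br y x r p
  by (rule hyp_swap)

context hyp
begin

lemma sw_Gr: "sw.Gr i = Gr (- i)"
  unfolding Gr_def sw.Gr_def by auto

text \<open>These are the cases in which the degree of the first factor is nonnegative and dominates
  in absolute value; skew symmetry and the exchange of \<open>x\<close> and \<open>y\<close> supply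
  the rest.\<close>

lemma Gr_br_pos: "a \<in> Gr i \<Longrightarrow> b \<in> Gr j \<Longrightarrow> i \<ge> 0 \<Longrightarrow> j \<le> i \<Longrightarrow> - j \<le> i \<Longrightarrow> br a b \<in> Gr (i + j)"
proof -
  assume a: "a \<in> Gr i" and b: "b \<in> Gr j" and ij: "i \<ge> 0" "j \<le> i" "- j \<le> i"
  have out: "i > 2 \<Longrightarrow> a = 0" using a by (auto simp: Gr_def)
  consider "i > 2" | "i = 2" "j = 2" | "i = 2" "j = 1" | "i = 2" "j = 0" | "i = 2" "j = -1" | "i = 2" "j = -2"
    | "i = 1" "j = 1" | "i = 1" "j = 0" | "i = 1" "j = -1" | "i = 0" "j = 0"
    using ij by smt
  then show ?thesis
  proof cases
    case 2 then show ?thesis using a b by (auto simp: Gr_def br_linear br_self)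
  next
    case 3 then show ?thesis using a b Gr1_facts(4)[of b] by (auto simp: Gr_def br_linear)
  next
    case 4 then show ?thesis using a b by (auto simp: Gr_def br_linear)
  next
    case 5
    then have "br y b \<in> Gr 1" using b Gr_y_m1 by simp
    then show ?thesis using a 5 Gr_scale by (auto simp: Gr_def[of 2] br_linear)
  next
    case 6
    then obtain s t where "a = s *s y" "b = t *s x" using a b by (auto simp: Gr_def)
    then have "br a b = (- (s * t)) *s br x y" by (simp add: br_linear yx)
    then show ?thesis using Gr_scale[OF e_in_Gr0, of "- (s * t)"] 6 by simp
  next
    case 7 then show ?thesis using a b Gr_1_1 by simp
  next
    case 8 then show ?thesis using a b Gr_1_0 by simp
  next
    case 9
    then have a1: "a \<in> Gr 1" and b1: "b \<in> Gr (-1)" using a b by auto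
    have "br x a \<in> Gr (-1)" using sw.Gr_y_m1[of a] a1 by (simp add: sw_Gr)
    then have "br (br x a) b \<in> Gr (-2)" using sw.Gr_1_1[of "br x a" b] b1 by (simp add: sw_Gr)
    moreover have "br x (br a b) = br (br x a) b"
      using jacobi[of x a b] Grm1_facts(5)[OF Grm1_D[OF b1]] by simp
    moreover have "br a (br y b) \<in> Gr 2" using Gr_1_1[OF a1 Gr_y_m1[OF b1]] .
    moreover have "br y (br a b) = br a (br y b)"
      using jacobi[of y a b] Gr1_facts(4)[OF Gr1_D[OF a1]] by simp
    ultimately show ?thesis using 9 by (auto simp: Gr_def)
  next
    case 10
    then obtain s t s' t' where "br x a = s *s x" "br y a = s' *s y" "br x b = t *s x" "br y b = t' *s y"
      using a b by (auto simp: Gr_def)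
    then have "br x (br a b) = 0" "br y (br a b) = 0"
      using br_swap[of a x] br_swap[of a y] jacobi[of x a b] jacobi[of y a b]
      by (auto simp: br_linear mult.commute)
    then show ?thesis using 10 by (auto simp: Gr_def intro: exI[of _ 0])
  qed (use out in auto)
qed

end

context hyp
begin

lemma Gr_br: "a \<in> Gr i \<Longrightarrow> b \<in> Gr j \<Longrightarrow> br a b \<in> Gr (i + j)"
proof -
  assume a: "a \<in> Gr i" and b: "b \<in> Gr j"
  have sym: "br b a \<in> Gr (i + j) \<Longrightarrow> br a b \<in> Gr (i + j)" using br_swap[of a b] Gr_minus by metis
  consider "i \<ge> 0" "j \<le> i" "- j \<le> i" | "j \<ge> 0" "i \<le> j" "- i \<le> j"
    | "- i \<ge> 0" "- j \<le> - i" "j \<le> - i" | "- j \<ge> 0" "- i \<le> - j" "i \<le> - j" by linarith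
  then show ?thesis
  proof cases
    case 1 then show ?thesis using Gr_br_pos a b by simp
  next
    case 2
    then have "br b a \<in> Gr (j + i)" using Gr_br_pos[OF b a] by simp
    then show ?thesis using sym by (simp only: add.commute[of i j])
  next
    case 3
    then have "br a b \<in> sw.Gr (- i + - j)"
      by (intro sw.Gr_br_pos) (use a b in \<open>auto simp: sw_Gr\<close>)
    then show ?thesis by (simp add: sw_Gr algebra_simps)
  next
    case 4
    then have "br b a \<in> sw.Gr (- j + - i)"
      by (intro sw.Gr_br_pos) (use a b in \<open>auto simp: sw_Gr\<close>)
    then have "br b a \<in> Gr (j + i)" by (simp add: sw_Gr algebra_simps)
    then show ?thesis using sym by (simp only: add.commute[of i j])
  qed
qed

lemma e_Gr: "m \<in> Gr i \<Longrightarrow> br (br x y) m = of_int i *s m"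
proof -
  assume m: "m \<in> Gr i"
  have j: "br (br x y) m = br x (br y m) - br y (br x m)"
    using jacobi[of x y m] by simp
  consider a where "i = -2" "m = a *s x" | "i = -1" "br x (br y m) = - m"
    | a b where "i = 0" "br x m = a *s x" "br y m = b *s y"
    | "i = 1" "br y (br x m) = - m" | a where "i = 2" "m = a *s y" | "m = 0"
    using m by (fastforce simp: Gr_def split: if_splits)
  then show ?thesis
  proof cases
    case 1 then show ?thesis by (simp add: br_linear br_exy scale_2 algebra_simps)
  next
    case 2 then show ?thesis using Grm1_facts(5)[OF 2(2)] by (simp add: j)
  next
    case 3
    then show ?thesis using Gr0_facts(3)[OF 3(2,3)] by (simp add: j br_linear yx)
  next
    case 4 then show ?thesis using Gr1_facts(4)[OF 4(2)] by (simp add: j)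
  next
    case 5 then show ?thesis by (simp add: br_linear br_exy scale_2 algebra_simps)
  qed auto
qed

end

sublocale hyp \<subseteq> grad5 sc br cp
  rewrites "grad5.gr cp = Gr"
proof -
  show *: "grad5 sc br cp"
  proof
    fix i j m a b
    show "linmap (cp i)" by (rule cp_linmap)
    show "cp i (cp j m) = (if i = j then cp i m else 0)"
      using Gr_cp[OF cp_Gr[of j m], of i] by auto
    show "i < - 2 \<or> 2 < i \<Longrightarrow> cp i m = 0" by (auto simp: cp_def)
    show "m = (\<Sum>i = - 2..2. cp i m)" by (rule cp_sum)
    show "cp (i + j) (br (cp i a) (cp j b)) = br (cp i a) (cp j b)"
      using Gr_cp[OF Gr_br[OF cp_Gr cp_Gr]] by simp
  qed
  show "grad5.gr cp = Gr"
  proof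
    fix i show "grad5.gr cp i = Gr i"
      unfolding grad5.gr_def[OF *] using cp_Gr[of i] Gr_cp[of _ i i] by (auto, metis)
  qed
qed

section \<open>Extremal elements of simple Lie algebras\<close>

context lie_alg
begin

lemma linfunI:
  assumes "\<And>a b. p (a + b) = p a + p b" "\<And>c a. p (c *s a) = c * p a"
  shows "linfun p"
  using assms by (simp add: linfun_def)

text \<open>The inverse is carried along because functionals are transported by it.\<close>

definition autom :: "('m \<Rightarrow> 'm) \<Rightarrow> ('m \<Rightarrow> 'm) \<Rightarrow> bool" where
  "autom \<phi> \<psi> \<longleftrightarrow> linmap \<phi> \<and> linmap \<psi> \<and> (\<forall>a b. \<phi> (br a b) = br (\<phi> a) (\<phi> b))
     \<and> (\<forall>a b. \<psi> (br a b) = br (\<psi> a) (\<psi> b)) \<and> (\<forall>a. \<phi> (\<psi> a) = a) \<and> (\<forall>a. \<psi> (\<phi> a) = a)"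

lemma autom_swap: "autom \<phi> \<psi> \<Longrightarrow> autom \<psi> \<phi>" by (auto simp: autom_def)

lemma autom_comp: "autom \<phi> \<psi> \<Longrightarrow> autom \<phi>' \<psi>' \<Longrightarrow> autom (\<lambda>m. \<phi> (\<phi>' m)) (\<lambda>m. \<psi>' (\<psi> m))"
  by (auto simp: autom_def linmap_comp)

lemma autom_extremal_wrt:
  assumes "autom \<phi> \<psi>" "extremal_wrt sc br c p"
  shows "extremal_wrt sc br (\<phi> c) (\<lambda>u. p (\<psi> u))"
  by (rule extremal_wrt_automorphism[OF assms(2)]) (use assms(1) in \<open>auto simp: autom_def linmapD\<close>)

lemma autom_sandwich:
  assumes "autom \<phi> \<psi>" "sandwich br c"
  shows "sandwich br (\<phi> c)"
proof -
  have h: "\<And>a b. \<phi> (br a b) = br (\<phi> a) (\<phi> b)" "\<And>a. \<phi> (\<psi> a) = a" "\<phi> 0 = 0"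
    using assms(1) by (auto simp: autom_def linmapD(3))
  show ?thesis unfolding sandwich_def
  proof (intro conjI allI)
    fix u w
    have "br c (br c (\<psi> u)) = 0" "br c (br (\<psi> u) (br c (\<psi> w))) = 0"
      using assms(2) by (auto simp: sandwich_def)
    from this[THEN arg_cong[of _ _ \<phi>]]
    show "br (\<phi> c) (br (\<phi> c) u) = 0" "br (\<phi> c) (br u (br (\<phi> c) w)) = 0"
      by (simp_all add: h)
  qed
qed

end

section \<open>Functionals of extremal elements in a simple Lie algebra\<close>

locale simple_lie = lie_alg sc br
  for sc :: "'f::field \<Rightarrow> 'm::ab_group_add \<Rightarrow> 'm" (infixr "*s" 75) and br +
  assumes simple: "simple_lie_algebra sc br"
begin

lemma ideal_trivial: "subspace I \<Longrightarrow> (\<And>a i. i \<in> I \<Longrightarrow> br a i \<in> I) \<Longrightarrow> I = {0} \<or> I = UNIV"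
  using simple by (auto simp: simple_lie_algebra_def lie_ideal_def)

lemma nonabelian: "\<exists>a b. br a b \<noteq> 0"
  using simple by (auto simp: simple_lie_algebra_def)

lemma centre_trivial:
  assumes "\<And>u. br z u = 0"
  shows "z = 0"
proof -
  let ?I = "{z. \<forall>u. br z u = 0}"
  have "?I = {0} \<or> ?I = UNIV"
  proof (rule ideal_trivial)
    show "subspace ?I" by (auto simp: subspace_def br_linear)
    show "br a i \<in> ?I" if "i \<in> ?I" for a i
      using that br_swap[of a i] by auto
  qed
  with nonabelian assms show ?thesis by auto
qed

lemma ex_not_line:
  assumes "c \<noteq> 0"
  obtains u where "\<And>s. br c u \<noteq> s *s c"
proof -
  let ?I = "range (\<lambda>s. s *s c)"
  have "\<exists>u. \<forall>s. br c u \<noteq> s *s c"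
  proof (rule ccontr)
    assume "\<nexists>u. \<forall>s. br c u \<noteq> s *s c"
    then obtain f where f: "\<And>u. br c u = f u *s c" by metis
    have "?I = {0} \<or> ?I = UNIV"
    proof (rule ideal_trivial)
      show "subspace ?I" unfolding subspace_def
        by (auto simp: image_iff scale_left_distrib[symmetric] intro: exI[of _ 0])
      show "br a i \<in> ?I" if i: "i \<in> ?I" for a i
      proof -
        obtain s where "i = s *s c" using i by auto
        then have "br a i = (- (s * f a)) *s c" using br_swap[of a c] f[of a] by (simp add: br_linear)
        then show ?thesis by blast
      qed
    qed
    moreover have "c \<in> ?I" using scale_one by (metis rangeI)
    ultimately have U: "?I = UNIV" using assms by auto
    obtain a b where ab: "br a b \<noteq> 0" using nonabelian by blast
    obtain s t where "a = s *s c" "b = t *s c" using U by (metis UNIV_I imageE)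
    then show False using ab by (simp add: br_linear br_self)
  qed
  then show ?thesis using that by blast
qed

text \<open>Otherwise \<open>c\<close> would span an ideal. This permits comparison of coefficients
  of \<open>br c u\<close> modulo the line of \<open>c\<close>.\<close>

lemma line_zero:
  assumes "c \<noteq> 0" "\<And>u. \<exists>t. s *s br c u = t *s c"
  shows "s = 0"
proof (rule ccontr)
  assume s: "s \<noteq> 0"
  obtain u where u: "\<And>s. br c u \<noteq> s *s c" using ex_not_line[OF assms(1)] by blast
  obtain t where "s *s br c u = t *s c" using assms(2) by blast
  then have "inverse s *s s *s br c u = inverse s *s t *s c" by simp
  then have "br c u = (inverse s * t) *s c" using s by simp
  with u show False by blast
qed

text \<open>The left side of the third identity is linear in \<open>w\<close>, and modulo the line
  of \<open>c\<close> the coefficient of \<open>br c u\<close> on the right involves only the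
  functional at \<open>w\<close>. Linearity therefore does not have to be assumed.\<close>

lemma extremal_wrt_linfun:
  assumes "extremal_wrt sc br c p" "c \<noteq> 0"
  shows "linfun p"
proof -
  have e3: "br c (br u (br c w)) = p (br u w) *s c - p w *s br c u - p u *s br c w" for u w
    using assms(1) by (simp add: extremal_wrt_def)
  have "p (a + b) - p a - p b = 0" for a b
  proof (rule line_zero[OF assms(2)])
    fix u
    have "br c (br u (br c (a + b))) = br c (br u (br c a)) + br c (br u (br c b))" by (simp add: br_linear)
    then have "(p (a + b) - p a - p b) *s br c u = (p (br u (a + b)) - p (br u a) - p (br u b)) *s c"
      unfolding e3 by (simp add: br_linear algebra_simps)
    then show "\<exists>t. (p (a + b) - p a - p b) *s br c u = t *s c" by blast
  qed
  moreover have "p (s *s a) - s * p a = 0" for s a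
  proof (rule line_zero[OF assms(2)])
    fix u
    have "br c (br u (br c (s *s a))) = s *s br c (br u (br c a))" by (simp add: br_linear)
    then have "(p (s *s a) - s * p a) *s br c u = (p (br u (s *s a)) - s * p (br u a)) *s c"
      unfolding e3 by (simp add: br_linear algebra_simps)
    then show "\<exists>t. (p (s *s a) - s * p a) *s br c u = t *s c" by blast
  qed
  ultimately show ?thesis
    by (intro linfunI) (metis diff_diff_eq eq_iff_diff_eq_0, metis eq_iff_diff_eq_0)
qed

text \<open>For \<open>w = c\<close> the left side of the third identity vanishes.\<close>

lemma extremal_wrt_self:
  assumes "extremal_wrt sc br c p" "c \<noteq> 0"
  shows "p c = 0" "p (br c u) = 0"
proof -
  note pl = linfunD[OF extremal_wrt_linfun[OF assms]]
  have e3: "br c (br u (br c w)) = p (br u w) *s c - p w *s br c u - p u *s br c w" for u w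
    using assms(1) by (simp add: extremal_wrt_def)
  have eq: "p c *s br c u = p (br u c) *s c" for u
    using e3[of u c] by (simp add: br_self)
  then show "p c = 0" by (intro line_zero[OF assms(2)]) blast
  then have "p (br u c) = 0" using eq[of u] assms(2) by simp
  then show "p (br c u) = 0" using br_swap[of c u] by (simp add: pl)
qed

text \<open>Sandwiches have to be excluded: in characteristic 2 the functional of a sandwich need not be unique.\<close>

lemma extremal_wrt_unique:
  assumes p: "extremal_wrt sc br c p" and q: "extremal_wrt sc br c q" and "\<not> sandwich br c"
  shows "p = q"
proof (rule ccontr)
  assume "p \<noteq> q"
  have c0: "c \<noteq> 0" using assms(3) by (auto simp: sandwich_def)
  have P: "br c (br c u) = (2 * p u) *s c"
      "br (br c u) (br c w) = p (br u w) *s c + p w *s br c u - p u *s br c w"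
      "br c (br u (br c w)) = p (br u w) *s c - p w *s br c u - p u *s br c w" for u w
    using p by (simp_all add: extremal_wrt_def)
  have Q: "br c (br u (br c w)) = q (br u w) *s c - q w *s br c u - q u *s br c w" for u w
    using q by (simp_all add: extremal_wrt_def)
  note pl = linfunD[OF extremal_wrt_linfun[OF p c0]] and ql = linfunD[OF extremal_wrt_linfun[OF q c0]]
  define d where "d = (\<lambda>u. p u - q u)"
  obtain w' where "d w' \<noteq> 0" using \<open>p \<noteq> q\<close> by (auto simp: d_def)
  define w where "w = inverse (d w') *s w'"
  have dw: "d w = 1" using \<open>d w' \<noteq> 0\<close> by (simp add: w_def d_def pl ql right_diff_distrib[symmetric])
  have D: "d (br u v) *s c = d v *s br c u + d u *s br c v" for u v
    using P(3)[of u v] Q[of u v] by (simp add: d_def algebra_simps)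
  have br_c: "br c u = d (br u w) *s c - d u *s br c w" for u
    using D[of u w] dw by (simp add: algebra_simps)
  have "br c w \<noteq> 0"
  proof
    assume "br c w = 0"
    then have "br c u = d (br u w) *s c" for u using br_c[of u] by simp
    then show False using ex_not_line[OF c0] by metis
  qed
  moreover have "2 *s br c w = 0" using D[of w w] dw by (simp add: br_self scale_2 d_def pl ql)
  ultimately have two: "(2::'f) = 0" by simp
  have cc: "br c (br c u) = 0" for u using P(1)[of u] two by simp
  have "br (br c u) (br c v) = 0" for u v
    unfolding br_c[of u] br_c[of v] using cc[of w] br_swap[of "br c w" c] by (simp add: br_linear br_self)
  moreover have "a = - a" for a :: 'm using two scale_2(1)[of a] by (simp add: eq_neg_iff_add_eq_0)
  \<comment> \<open>Without signs the second and third identities have the same right side, and the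
    left side of the second has just been seen to vanish.\<close>
  ultimately have "br c (br u (br c v)) = 0" for u v
    using P(2)[of u v] P(3)[of u v] by (metis diff_conv_add_uminus)
  then show False using cc assms(3) by (auto simp: sandwich_def)
qed

end

section \<open>The extremal form and exponential automorphisms\<close>

locale ext_lie = simple_lie sc br
  for sc :: "'f::field \<Rightarrow> 'm::ab_group_add \<Rightarrow> 'm" (infixr "*s" 75) and br +
  fixes g :: "'m \<Rightarrow> 'm \<Rightarrow> 'f"
  assumes card_ne_2: "card (UNIV :: 'f set) \<noteq> 2"
    and gen: "lie_generated_by sc br {z. pure_extremal sc br z}"
    and form: "extremal_form sc br g"
begin

lemma g_sym: "g a b = g b a"
  and g_add_right: "g a (b + c) = g a b + g a c"
  and g_scale_left: "g (s *s a) b = s * g a b"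
  using form by (auto simp: extremal_form_def)

lemma g_scale_right: "g a (s *s b) = s * g a b"
  using g_scale_left g_sym by metis

lemma g_add_left: "g (a + b) c = g a c + g b c"
  using g_add_right g_sym by metis

lemma g_linfun: "linfun (g a)"
  by (simp add: linfun_def g_add_right g_scale_right)

lemmas gl = linfunD[OF g_linfun]

lemma gr_lin: "g 0 b = 0" "g (- a) b = - g a b" "g (a - b) c = g a c - g b c"
  using gl(3-5) g_sym by metis+

lemmas g_bilin = gl gr_lin g_add_left g_scale_left

text \<open>\<open>card\<close> is 0 on infinite types, so \<open>card_ne_2\<close> excludes exactly
  the field with two elements.\<close>

lemma ex_scalar: obtains t :: 'f where "t \<noteq> 0" "t \<noteq> 1"
proof -
  have "\<not> (\<forall>t::'f. t = 0 \<or> t = 1)"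
  proof
    assume "\<forall>t::'f. t = 0 \<or> t = 1"
    then have "(UNIV :: 'f set) = {0, 1}" by auto
    then have "card (UNIV :: 'f set) = card {0, 1 :: 'f}" by (simp only:)
    then show False using card_ne_2 by simp
  qed
  then show ?thesis using that by blast
qed

text \<open>The two scalars \<open>t\<close> outside \<open>{0, 1}\<close> and \<open>1\<close> separate linear from quadratic terms.\<close>

lemma quadratic_vanish:
  assumes "\<And>t. t *s a + (t * t) *s b = 0"
  shows "a = 0" "b = 0"
proof -
  obtain t :: 'f where t: "t \<noteq> 0" "t \<noteq> 1" using ex_scalar .
  have 1: "a = - b" using assms[of 1] by (simp add: eq_neg_iff_add_eq_0)
  have "(t * (t - 1)) *s b = 0" using assms[of t] unfolding 1 by (simp add: algebra_simps)
  then show b: "b = 0" using t by simp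
  show "a = 0" using 1 b by simp
qed

lemma quadratic_vanish_field:
  assumes "\<And>t. t * a + (t * t) * b = (0::'f)"
  shows "a = 0" "b = 0"
proof -
  obtain t :: 'f where t: "t \<noteq> 0" "t \<noteq> 1" using ex_scalar .
  have 1: "a = - b" using assms[of 1] by (simp add: eq_neg_iff_add_eq_0)
  have "(t * (t - 1)) * b = 0" using assms[of t] unfolding 1 by (simp add: algebra_simps)
  then show b: "b = 0" using t by simp
  show "a = 0" using 1 b by simp
qed

text \<open>\<open>X\<close> consists of the extremal elements and \<open>0\<close>.\<close>

definition X :: "'m set" where "X = {c. extremal_wrt sc br c (g c)}"

lemma X_extremal: "c \<noteq> 0 \<Longrightarrow> c \<in> X \<longleftrightarrow> extremal sc br c"
  using form by (auto simp: X_def extremal_def extremal_form_def)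

lemma X_0 [simp]: "0 \<in> X" by (simp add: X_def extremal_wrt_def g_bilin)

lemma X_D: "c \<in> X \<Longrightarrow> br c (br c u) = (2 * g c u) *s c"
  "c \<in> X \<Longrightarrow> br (br c u) (br c w) = g c (br u w) *s c + g c w *s br c u - g c u *s br c w"
  "c \<in> X \<Longrightarrow> br c (br u (br c w)) = g c (br u w) *s c - g c w *s br c u - g c u *s br c w"
  by (auto simp: X_def extremal_wrt_def)

lemma X_self: "c \<in> X \<Longrightarrow> g c c = 0" "c \<in> X \<Longrightarrow> g c (br c u) = 0" "c \<in> X \<Longrightarrow> g c (br u c) = 0"
proof -
  assume c: "c \<in> X"
  show 1: "g c c = 0" "g c (br c u) = 0" for u
    using extremal_wrt_self[of c "g c"] c by (cases "c = 0"; simp add: X_def g_bilin)+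
  show "g c (br u c) = 0" using 1(2)[of u] br_swap[of u c] by (simp add: g_bilin)
qed

lemma X_scale: "c \<in> X \<Longrightarrow> s *s c \<in> X"
proof -
  assume c: "c \<in> X"
  show "s *s c \<in> X"
    unfolding X_def extremal_wrt_def
    by (simp add: br_linear g_bilin X_D[OF c] scale_right_distrib scale_right_diff_distrib mult_ac)
qed

lemma X_minus: "c \<in> X \<Longrightarrow> - c \<in> X"
  using X_scale[of c "-1"] by simp

text \<open>The exponential of \<open>br c\<close>, with \<open>g c m *s c\<close> standing for half
  of \<open>br c (br c m)\<close>; this makes sense in characteristic 2 as well.\<close>

definition Exp :: "'m \<Rightarrow> 'm \<Rightarrow> 'm" where "Exp c m = m + br c m + g c m *s c"

lemma Exp_linmap: "linmap (Exp c)"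
  by (simp add: linmap_def Exp_def br_linear g_bilin algebra_simps)

lemma Exp_br: "c \<in> X \<Longrightarrow> Exp c (br a b) = br (Exp c a) (Exp c b)"
proof -
  assume c: "c \<in> X"
  have 1: "br (br c a) c = - (g c a *s c) - g c a *s c"
    using X_D(1)[OF c, of a] br_swap[of "br c a" c] by (simp add: scale_2)
  have 2: "br a c = - br c a" by (rule br_swap)
  show ?thesis
    unfolding Exp_def
    by (simp add: 1 2 br_linear X_D(1)[OF c] X_D(2)[OF c] br_self jacobi[of c a b] algebra_simps scale_2)
qed

lemma Exp_inverse: "c \<in> X \<Longrightarrow> Exp (- c) (Exp c m) = m"
  unfolding Exp_def
  by (simp add: br_linear X_D(1) br_self X_self g_bilin algebra_simps scale_2)

lemma Exp_autom: "c \<in> X \<Longrightarrow> autom (Exp c) (Exp (- c))"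
  using Exp_inverse[of c] Exp_inverse[of "- c"] X_minus[of c]
  by (auto simp: autom_def Exp_linmap Exp_br)

text \<open>The transported functional and \<open>g (\<phi> c)\<close> both belong to
  \<open>\<phi> c\<close>. They agree by uniqueness if \<open>c\<close> is not a sandwich, and for
  sandwiches the form vanishes by convention.\<close>

lemma autom_X:
  assumes a: "autom \<phi> \<psi>" and c: "c \<in> X"
  shows "\<phi> c \<in> X" "g (\<phi> c) u = g c (\<psi> u)"
proof -
  have "\<phi> c \<in> X \<and> g (\<phi> c) u = g c (\<psi> u)" for u
  proof (cases "c = 0")
    case True
    have "linmap \<phi>" using a by (simp add: autom_def)
    with True show ?thesis by (simp add: linmapD(3) g_bilin)
  next
    case False
    have nz: "\<phi> c \<noteq> 0" using a False by (metis autom_def linmapD(3))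
    have e: "extremal_wrt sc br (\<phi> c) (\<lambda>u. g c (\<psi> u))"
      using autom_extremal_wrt[OF a] c by (simp add: X_def)
    then have X: "\<phi> c \<in> X" using X_extremal[OF nz] nz by (auto simp: extremal_def)
    show ?thesis
    proof (cases "sandwich br c")
      case True
      have "sandwich br (\<phi> c)" by (rule autom_sandwich[OF a True])
      then have "g c v = 0" "g (\<phi> c) v = 0" for v
        using True form X_extremal[OF False] X_extremal[OF nz] X c by (auto simp: extremal_form_def)
      then show ?thesis using X by simp
    next
      case ns: False
      have "\<not> sandwich br (\<phi> c)"
        using autom_sandwich[OF autom_swap[OF a], of "\<phi> c"] ns a by (auto simp: autom_def)
      then have "g (\<phi> c) = (\<lambda>u. g c (\<psi> u))" using extremal_wrt_unique e X by (auto simp: X_def)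
      then show ?thesis using X by simp
    qed
  qed
  then show "\<phi> c \<in> X" "g (\<phi> c) u = g c (\<psi> u)" by auto
qed

lemma Exp_X: "a \<in> X \<Longrightarrow> b \<in> X \<Longrightarrow> Exp a b \<in> X"
  using autom_X(1)[OF Exp_autom] .

text \<open>Since \<open>br a b\<close> is a combination of the extremal elements
  \<open>Exp a b\<close>, \<open>b\<close> and \<open>a\<close>, the linear span of \<open>X\<close>
  is already a subalgebra.\<close>

lemma span_X: "span X = UNIV"
proof -
  have "lie_subalgebra sc br (span X)"
    unfolding lie_subalgebra_def
  proof (intro conjI ballI)
    show "subspace (span X)" by (rule subspace_span)
    have 1: "br a b \<in> span X" if a: "a \<in> X" and b: "b \<in> X" for a b
    proof -
      have "br a b = Exp a b - b - g a b *s a" by (simp add: Exp_def)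
      also have "\<dots> \<in> span X" by (intro span_diff span_scale span_base a b Exp_X)
      finally show ?thesis .
    qed
    have 2: "br a b \<in> span X" if "a \<in> X" "b \<in> span X" for a b
      using that(2) by (induction rule: span_induct_alt) (auto simp: br_linear span_zero intro!: span_add span_scale 1 that)
    fix a b assume "a \<in> span X" "b \<in> span X"
    then show "br a b \<in> span X"
      by (induction rule: span_induct_alt) (auto simp: br_linear span_zero intro!: span_add span_scale 2)
  qed
  moreover have "{z. pure_extremal sc br z} \<subseteq> span X"
    using X_extremal by (auto simp: pure_extremal_def extremal_def intro: span_base)
  ultimately show ?thesis using gen by (auto simp: lie_generated_by_def)
qed

lemma X_induct [case_names scaled_add zero]:
  assumes "\<And>c s m. c \<in> X \<Longrightarrow> P m \<Longrightarrow> P (s *s c + m)" "P 0"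
  shows "P m"
proof -
  have "m \<in> span X" by (simp add: span_X)
  then show ?thesis by (induction rule: span_induct_alt) (use assms in auto)
qed

lemma autom_g:
  assumes a: "autom \<phi> \<psi>"
  shows "g (\<phi> u) (\<phi> w) = g u w"
proof (induction u rule: X_induct)
  have l: "linmap \<phi>" "\<psi> (\<phi> w) = w" using a by (auto simp: autom_def)
  case (scaled_add c s m)
  then show ?case by (simp add: linmapD[OF l(1)] g_bilin autom_X(2)[OF a] l)
next
  case zero
  have "linmap \<phi>" using a by (auto simp: autom_def)
  then show ?case by (simp add: linmapD(3) g_bilin)
qed

text \<open>The form is invariant under the automorphisms \<open>Exp (t *s c)\<close>; the coefficient of \<open>t\<close> is associativity.\<close>

lemma g_assoc_X:
  assumes c: "c \<in> X"
  shows "g (br c u) w = - g u (br c w)"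
proof -
  have "t * (g (br c u) w + g u (br c w))
    + (t * t) * (g (br c u) (br c w) + g c w * g u c + g c u * g c w) = 0" for t
  proof -
    have "g (Exp (t *s c) u) (Exp (t *s c) w) = g u w"
      by (rule autom_g[OF Exp_autom[OF X_scale[OF c]]])
    then show ?thesis
      by (simp add: Exp_def g_bilin br_linear X_self[OF c] g_sym[of "br c u" c] algebra_simps)
  qed
  from quadratic_vanish_field(1)[OF this] show ?thesis by (simp add: eq_neg_iff_add_eq_0)
qed

lemma g_skew: "g (br c u) w = - g u (br c w)"
  by (induction c rule: X_induct) (auto simp: g_bilin br_linear g_assoc_X algebra_simps)

lemma g_assoc: "g (br a b) c = g a (br b c)"
  using g_skew[of b a c] br_swap[of a b] by (simp add: g_bilin)

text \<open>If the form were zero, every extremal element would be a sandwich and the generating set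
  would be empty.\<close>

lemma ex_g: "\<exists>a b. g a b \<noteq> 0"
proof (rule ccontr)
  assume z: "\<nexists>a b. g a b \<noteq> 0"
  have "sandwich br c" if "extremal sc br c" for c
    using that z X_D[of c] X_extremal[of c] by (auto simp: sandwich_def extremal_def)
  then have "{z. pure_extremal sc br z} = {}" by (auto simp: pure_extremal_def)
  moreover have "lie_subalgebra sc br {0}" by (auto simp: lie_subalgebra_def subspace_def)
  ultimately have "{0} = (UNIV :: 'm set)" using gen by (auto simp: lie_generated_by_def)
  then show False using nonabelian by (metis UNIV_I br_zero_left singletonD)
qed

text \<open>By associativity the radical of the form is an ideal.\<close>

lemma g_nondeg:
  assumes "m \<noteq> 0"
  shows "\<exists>c\<in>X. g c m \<noteq> 0"
proof (rule ccontr)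
  assume z: "\<not> (\<exists>c\<in>X. g c m \<noteq> 0)"
  have gm: "g a m = 0" for a
    by (induction a rule: X_induct) (use z in \<open>auto simp: g_bilin\<close>)
  let ?I = "{m. \<forall>a. g a m = 0}"
  have "?I = {0} \<or> ?I = UNIV"
  proof (rule ideal_trivial)
    show "subspace ?I" by (auto simp: subspace_def g_bilin)
    show "br a i \<in> ?I" if "i \<in> ?I" for a i using that by (auto simp: g_assoc[symmetric])
  qed
  then show False using gm assms ex_g by auto
qed

section \<open>Polarised extremal identities and lines of extremal elements\<close>

definition E1 where "E1 c u = br c (br c u) - g c u *s c - g c u *s c"
definition E2 where
  "E2 c u w = br (br c u) (br c w) - (g c (br u w) *s c + g c w *s br c u - g c u *s br c w)"
definition E3 where
  "E3 c u w = br c (br u (br c w)) - (g c (br u w) *s c - g c w *s br c u - g c u *s br c w)"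
text \<open>\<open>B1\<close>, \<open>B2\<close> and \<open>B3\<close> are the coefficients of
  \<open>t\<close> in the defects \<open>E1\<close>, \<open>E2\<close> and \<open>E3\<close> of the
  extremal identities at \<open>b + t *s c\<close>.\<close>

definition B1 where "B1 b c u = br b (br c u) + br c (br b u) - g b u *s c - g b u *s c - g c u *s b - g c u *s b"
definition B2 where
  "B2 b c u w = br (br b u) (br c w) + br (br c u) (br b w)
     - (g b (br u w) *s c + g c (br u w) *s b + g b w *s br c u + g c w *s br b u
        - g b u *s br c w - g c u *s br b w)"
definition B3 where
  "B3 b c u w = br b (br u (br c w)) + br c (br u (br b w))
     - (g b (br u w) *s c + g c (br u w) *s b - g b w *s br c u - g c w *s br b u
        - g b u *s br c w - g c u *s br b w)"

lemma X_iff: "c \<in> X \<longleftrightarrow> (\<forall>u w. E1 c u = 0 \<and> E2 c u w = 0 \<and> E3 c u w = 0)"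
  by (auto simp: X_def extremal_wrt_def E1_def E2_def E3_def scale_2 diff_diff_eq)

lemma E_quadratic:
  "E1 (b + t *s c) u = E1 b u + t *s B1 b c u + (t * t) *s E1 c u"
  "E2 (b + t *s c) u w = E2 b u w + t *s B2 b c u w + (t * t) *s E2 c u w"
  "E3 (b + t *s c) u w = E3 b u w + t *s B3 b c u w + (t * t) *s E3 c u w"
  by (simp_all add: E1_def E2_def E3_def B1_def B2_def B3_def br_linear g_bilin algebra_simps)

text \<open>The defects along the line are quadratic polynomials in \<open>t\<close> with constant
  term 0, so their linear and quadratic coefficients vanish separately.\<close>

lemma X_line:
  assumes "\<And>t. b + t *s c \<in> X"
  shows "c \<in> X" "s *s b + t *s c \<in> X" "B1 b c u = 0" "B2 b c u w = 0" "B3 b c u w = 0"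
proof -
  have b: "b \<in> X" using assms[of 0] by simp
  have v: "t *s B1 b c u + (t * t) *s E1 c u = 0" "t *s B2 b c u w + (t * t) *s E2 c u w = 0"
    "t *s B3 b c u w + (t * t) *s E3 c u w = 0" for t u w
    using assms[of t] b E_quadratic[of b t c] by (auto simp: X_iff)
  note V = quadratic_vanish[OF v(1)] quadratic_vanish[OF v(2)] quadratic_vanish[OF v(3)]
  show c: "c \<in> X" by (simp add: X_iff V)
  show "B1 b c u = 0" "B2 b c u w = 0" "B3 b c u w = 0" by (simp_all add: V)
  show "s *s b + t *s c \<in> X"
  proof (cases "s = 0")
    case True then show ?thesis using X_scale[OF c] by simp
  next
    case False
    have "s *s b + t *s c = s *s (b + (inverse s * t) *s c)" using False by (simp add: scale_right_distrib mult.assoc[symmetric])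
    then show ?thesis using X_scale[OF assms] by metis
  qed
qed

text \<open>If \<open>g a b = 0\<close>, then \<open>Exp (t *s a)\<close> moves \<open>b\<close> along the line through \<open>b\<close> and \<open>br a b\<close>.\<close>

lemma X_special:
  assumes "a \<in> X" "b \<in> X" "g a b = 0"
  shows "b + t *s br a b \<in> X" "s *s b + t *s br a b \<in> X" "br a b \<in> X"
    "a + t *s br a b \<in> X" "s *s a + t *s br a b \<in> X"
proof -
  have 1: "b + t *s br a b \<in> X" if "a \<in> X" "b \<in> X" "g a b = 0" for a b t
    using Exp_X[OF X_scale[OF that(1), of t] that(2)] that(3) by (simp add: Exp_def br_linear g_bilin)
  show "b + t *s br a b \<in> X" by (rule 1[OF assms])
  show "br a b \<in> X" "s *s b + t *s br a b \<in> X" using X_line[OF 1[OF assms]] by auto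
  have 2: "a + t *s br a b \<in> X" for t
    using 1[of b a "- t"] assms g_sym br_swap[of b a] by simp
  then show "a + t *s br a b \<in> X" "s *s a + t *s br a b \<in> X" using X_line[OF 2] by auto
qed

lemma hyp_pair:
  assumes "x \<in> X" "y \<in> X" "g x y = 1"
  shows "hyp sc br x y (g x) (g y)"
proof -
  have x0: "x \<noteq> 0" using assms(3) by (auto simp: g_bilin)
  \<comment> \<open>If \<open>x\<close> and \<open>y\<close> commuted,
    \<open>br x (br y (br x u))\<close> would vanish, and the third identity would put every
    \<open>br x u\<close> on the line of \<open>x\<close>, which is then an ideal.\<close>
  have "br x y \<noteq> 0"
  proof
    assume e: "br x y = 0"
    obtain u where u: "\<And>s. br x u \<noteq> s *s x" using ex_not_line[OF x0] by blast
    have "br x (br y (br x u)) = br y (br x (br x u))" using jacobi[of x y "br x u"] e by simp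
    also have "\<dots> = 0" using e br_swap[of y x] by (simp add: X_D(1) assms br_linear)
    finally have "br x u = g x (br y u) *s x"
      using X_D(3)[OF assms(1), of y u] e assms(3) by simp
    with u show False by blast
  qed
  moreover have "g x (br y m) = - g y (br x m)" for m
    using g_skew[of x y m] g_assoc[of x y m] by (simp add: g_sym)
  ultimately show ?thesis
    unfolding hyp_def hyp_axioms_def using assms X_self g_linfun lie_alg_axioms g_sym[of y x]
    by (auto simp: X_def)
qed

end

section \<open>Hyperbolic pairs and special neighbours\<close>

context ext_lie
begin

definition hp :: "'m \<Rightarrow> 'm \<Rightarrow> bool" where
  "hp x y \<longleftrightarrow> x \<in> X \<and> y \<in> X \<and> g x y = 1"

lemma hp_sym: "hp x y \<Longrightarrow> hp y x" by (auto simp: hp_def g_sym)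

lemma hp_hyp: "hp x y \<Longrightarrow> hyp sc br x y (g x) (g y)" by (auto simp: hp_def hyp_pair)

lemma hp_exists:
  assumes "y \<in> X" "y \<noteq> 0"
  obtains x where "hp x y"
proof -
  obtain c where c: "c \<in> X" "g c y \<noteq> 0" using g_nondeg[OF assms(2)] by blast
  then have "hp (inverse (g c y) *s c) y" using assms X_scale by (simp add: hp_def g_bilin)
  then show ?thesis by (rule that)
qed

text \<open>\<open>V x y\<close> and \<open>V y x\<close> are the parts of \<open>X\<close> in \<open>L\<^sub>1\<close> and \<open>L\<^sub>-\<^sub>1\<close> for the pair \<open>(x, y)\<close>. Up to a multiple of \<open>y\<close>, every special
  neighbour of \<open>y\<close> (an element of \<open>P0 y\<close>) lies in \<open>V x y\<close>.\<close>

definition V :: "'m \<Rightarrow> 'm \<Rightarrow> 'm set" where "V x y = {l \<in> X. br y (br x l) = - l}"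

definition P0 :: "'m \<Rightarrow> 'm set" where "P0 y = {br y u | u. u \<in> X \<and> g y u = 0}"

lemma P0_I: "u \<in> X \<Longrightarrow> g y u = 0 \<Longrightarrow> br y u \<in> P0 y"
  by (auto simp: P0_def)

lemma P0_scale: "l \<in> P0 y \<Longrightarrow> s *s l \<in> P0 y"
proof -
  assume "l \<in> P0 y"
  then obtain u where u: "l = br y u" "u \<in> X" "g y u = 0" by (auto simp: P0_def)
  then have "br y (s *s u) \<in> P0 y" by (intro P0_I X_scale) (auto simp: g_bilin)
  then show ?thesis using u by (simp add: br_linear)
qed

lemma P0_scale_point: "s \<noteq> 0 \<Longrightarrow> P0 (s *s y) = P0 y"
proof -
  have 1: "P0 (s *s y) \<subseteq> P0 y" if "s \<noteq> 0" for s y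
  proof
    fix l assume "l \<in> P0 (s *s y)"
    then obtain u where u: "l = br (s *s y) u" "u \<in> X" "g (s *s y) u = 0" by (auto simp: P0_def)
    then have "br y u \<in> P0 y" using that by (intro P0_I) (auto simp: g_bilin)
    then show "l \<in> P0 y" using u P0_scale by (simp add: br_linear)
  qed
  assume s: "s \<noteq> 0"
  have "P0 (inverse s *s s *s y) \<subseteq> P0 (s *s y)" using 1[of "inverse s" "s *s y"] s by simp
  then show ?thesis using 1[OF s, of y] s by simp
qed

lemma P0_X: "y \<in> X \<Longrightarrow> l \<in> P0 y \<Longrightarrow> l \<in> X"
  using X_special(3)[of y] by (auto simp: P0_def)

lemma P0_autom:
  assumes a: "autom \<phi> \<psi>" and l: "l \<in> P0 y"
  shows "\<phi> l \<in> P0 (\<phi> y)"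
proof -
  obtain u where u: "l = br y u" "u \<in> X" "g y u = 0" using l by (auto simp: P0_def)
  have "br (\<phi> y) (\<phi> u) \<in> P0 (\<phi> y)"
    using u by (intro P0_I) (auto simp: autom_g[OF a] autom_X[OF a])
  then show ?thesis using a u by (simp add: autom_def)
qed

lemma V_D:
  assumes "hp x y" "l \<in> V x y"
  shows "l \<in> X" "br y (br x l) = - l" "g x l = 0" "g y l = 0" "br y l = 0" "br l y = 0" "g x (br y l) = 0"
    "l \<in> hyp.Gr sc br x y 1"
proof -
  interpret H: hyp sc br x y "g x" "g y" using hp_hyp[OF assms(1)] .
  show l: "l \<in> X" "br y (br x l) = - l" using assms(2) by (auto simp: V_def)
  show "g x l = 0" "g y l = 0" "br y l = 0" "g x (br y l) = 0" using H.Gr1_facts[OF l(2)] by auto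
  then show "br l y = 0" using br_swap[of l y] by simp
  show "l \<in> H.Gr 1" using l by (simp add: H.Gr_def)
qed

lemma V_scale: "l \<in> V x y \<Longrightarrow> s *s l \<in> V x y"
  by (auto simp: V_def br_linear X_scale)

lemma V_swap:
  assumes "hp x y" "l \<in> V x y"
  shows "br x l \<in> V y x"
  using X_special(3)[of x l] V_D[OF assms] assms(1) by (auto simp: V_def br_linear hp_def)

text \<open>Up to sign, \<open>l\<close> is the bracket of \<open>y\<close> with the perpendicular
  extremal element \<open>br x l\<close>, so \<open>X_special\<close> applies.\<close>

lemma V_line:
  assumes "hp x y" "l \<in> V x y"
  shows "s *s y + t *s l \<in> X"
proof -
  have w: "br x l \<in> X" "g y (br x l) = 0"
    using V_D(1,4)[OF hp_sym[OF assms(1)] V_swap[OF assms]] V_D(3)[OF hp_sym[OF assms(1)] V_swap[OF assms]] by auto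
  have "s *s y + (- t) *s br y (br x l) \<in> X"
    by (rule X_special(5)[OF _ w]) (use assms(1) in \<open>simp add: hp_def\<close>)
  then show ?thesis using V_D(2)[OF assms] by simp
qed

lemma V_P0:
  assumes "hp x y" "l \<in> V x y"
  shows "l \<in> P0 y"
proof -
  have w: "br x l \<in> X" "g y (br x l) = 0"
    using V_D(1,3)[OF hp_sym[OF assms(1)] V_swap[OF assms]] by auto
  have "(-1) *s br y (br x l) \<in> P0 y" by (rule P0_scale[OF P0_I[OF w]])
  then show ?thesis using V_D(2)[OF assms] by simp
qed

text \<open>In \<open>l = br y u\<close> the component of \<open>u\<close> in degree -2 vanishes by
  perpendicularity, those in degrees 1 and 2 are killed by \<open>br y\<close>, the one in degree 0
  gives the multiple of \<open>y\<close>, and the one in degree -1 gives \<open>l1\<close>.\<close>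

lemma P0_decomp:
  assumes h: "hp x y" and l: "l \<in> P0 y"
  obtains l1 \<mu> where "l1 \<in> V x y" "l = l1 + \<mu> *s y" "l \<noteq> 0 \<Longrightarrow> l1 \<noteq> 0"
proof -
  interpret H: hyp sc br x y "g x" "g y" using hp_hyp[OF h] .
  have y: "y \<in> X" using h by (simp add: hp_def)
  obtain u where u: "l = br y u" "u \<in> X" "g y u = 0" using l by (auto simp: P0_def)
  obtain \<mu> where \<mu>: "br y (H.cp 0 u) = \<mu> *s y" using H.cp_Gr[of 0 u] by (auto simp: H.Gr_def)
  let ?l = "br y (H.cp (-1) u)"
  have l1: "?l \<in> H.Gr 1" using H.Gr_y_m1[OF H.cp_Gr] .
  have "br y (H.cp (-2) u) = 0" using u by (simp add: H.cp_def)
  moreover have "br y (H.cp 1 u) = 0" using H.Gr1_facts(4) H.cp_Gr[of 1 u] by (simp add: H.Gr_def)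
  moreover have "br y (H.cp 2 u) = 0" by (simp add: H.cp_def br_linear br_self)
  ultimately have eq: "l = ?l + \<mu> *s y"
    using arg_cong[OF H.cmp_sum5[of u], of "br y"] u \<mu> by (simp add: br_linear)
  have "(- \<mu>) *s y + 1 *s l \<in> X" unfolding u(1) by (rule X_special(5)[OF y u(2,3)])
  then have V: "?l \<in> V x y" using eq l1 by (simp add: V_def H.Gr_def)
  have "?l \<noteq> 0" if "l \<noteq> 0"
  proof
    assume "?l = 0"
    then have yu: "br y u = \<mu> *s y" using eq u by simp
    have "br u (br u y) = (\<mu> * \<mu>) *s y" using br_swap[of u y] yu by (simp add: br_linear)
    then have "(\<mu> * \<mu>) *s y = 0" using X_D(1)[OF u(2), of y] u(3) g_sym[of u y] by simp
    then show False using that yu u(1) H.y_neq_0 by simp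
  qed
  with V eq show ?thesis using that by blast
qed

lemma V_br_V:
  assumes "hp x y" "l \<in> V x y" "l' \<in> V x y"
  shows "br l l' = g x (br l l') *s y"
proof -
  interpret H: hyp sc br x y "g x" "g y" using hp_hyp[OF assms(1)] .
  have "br l l' \<in> H.Gr (1 + 1)" by (intro H.Gr_br V_D(8) assms)
  then show ?thesis by (auto simp: H.Gr_def H.pl H.p_y)
qed

lemma g_L1:
  assumes "br y (br x l) = - l" "br y l' = 0"
  shows "g l l' = 0"
proof -
  have "g l l' = - g (br y (br x l)) l'" using assms(1) by (simp add: g_bilin)
  also have "\<dots> = 0" using assms(2) by (simp add: g_skew g_bilin)
  finally show ?thesis .
qed

text \<open>\<open>Exp (s *s br x l)\<close> fixes \<open>l\<close> and moves \<open>y\<close> to \<open>y + s *s l\<close>. Choosing \<open>s\<close> suitably, it carries an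
  extremal element not perpendicular to \<open>l\<close> to one which is in addition perpendicular to \<open>y\<close>.\<close>

lemma V_nondegenerate:
  assumes h: "hp x y" and l: "l \<in> V x y" "l \<noteq> 0"
  obtains l' where "l' \<in> V x y" "br l l' \<noteq> 0"
proof -
  have y: "y \<in> X" using h by (simp add: hp_def)
  note L = V_D[OF h l(1)]
  obtain c where c: "c \<in> X" "g c l \<noteq> 0" using g_nondeg[OF l(2)] by blast
  define v where "v = br x l"
  have v: "v \<in> X" using V_D(1)[OF hp_sym[OF h] V_swap[OF h l(1)]] by (simp add: v_def)
  have vy: "br v y = l" using br_swap[of v y] L(2) by (simp add: v_def)
  have gvy: "g v y = 0" using V_D(3)[OF hp_sym[OF h] V_swap[OF h l(1)]] g_sym by (simp add: v_def)
  have gvl: "g v l = 0" using X_self(3)[OF L(1)] g_sym by (simp add: v_def)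
  have vl: "br v l = 0"
    using X_D(1)[OF L(1), of x] br_swap[of v l] br_swap[of x l] g_sym[of l x] L(3) by (simp add: v_def br_linear)
  define s where "s = - g c y / g c l"
  have cs: "s *s v \<in> X" by (rule X_scale[OF v])
  have E: "Exp (s *s v) y = y + s *s l" "Exp (s *s v) l = l"
    by (simp_all add: Exp_def br_linear g_bilin vy gvy vl gvl)
  define c' where "c' = Exp (- (s *s v)) c"
  have c': "c' \<in> X" unfolding c'_def by (rule Exp_X[OF X_minus[OF cs] c(1)])
  have inv: "g c' (Exp (- (s *s v)) m) = g c m" for m
    unfolding c'_def by (rule autom_g[OF autom_swap[OF Exp_autom[OF cs]]])
  have "g c' y = g c (y + s *s l)" using inv[of "y + s *s l"] Exp_inverse[OF cs, of y] E by simp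
  then have cy: "g y c' = 0" using c by (simp add: g_bilin s_def g_sym[of y])
  have cl: "g c' l = g c l" using inv[of l] Exp_inverse[OF cs, of l] E by simp
  obtain l1 \<mu> where l1: "l1 \<in> V x y" "br y c' = l1 + \<mu> *s y" using P0_decomp[OF h P0_I[OF c' cy]] by metis
  have "br l l1 = br l (br y c')" using l1(2) L(6) by (simp add: br_linear)
  then have "g x (br l l1) = g (br x l) (br y c')" by (simp add: g_assoc)
  also have "\<dots> = g l c'" using vy v_def by (simp add: g_assoc[symmetric])
  finally have "g x (br l l1) \<noteq> 0" using cl c g_sym by simp
  then have "br l l1 \<noteq> 0" by (auto simp: g_bilin)
  with l1(1) show ?thesis by (rule that)
qed

text \<open>A set of extremal elements closed under hyperbolic and special neighbours spans an ideal.\<close>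

lemma X_connected:
  assumes C: "C \<subseteq> X - {0}" "C \<noteq> {}"
    and hyp: "\<And>c d. c \<in> C \<Longrightarrow> d \<in> X \<Longrightarrow> g c d \<noteq> 0 \<Longrightarrow> d \<in> C"
    and spec: "\<And>c l. c \<in> C \<Longrightarrow> l \<in> P0 c \<Longrightarrow> l \<noteq> 0 \<Longrightarrow> l \<in> C"
  shows "X - {0} \<subseteq> C"
proof -
  let ?I = "span C"
  have 1: "br z c \<in> ?I" if z: "z \<in> X" and c: "c \<in> C" for z c
  proof (cases "g c z = 0")
    case False
    then have zC: "z \<in> C" using hyp c z by blast
    \<comment> \<open>\<open>Exp z c\<close> is again not perpendicular to \<open>z\<close>, so it
      too lies in \<open>C\<close>, and \<open>br z c\<close> becomes a combination of three
      elements of \<open>C\<close>.\<close>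
    have "g z (Exp z c) = g z c" using X_self[OF z] by (simp add: Exp_def g_bilin)
    then have "Exp z c \<in> C" using hyp[OF zC] Exp_X[OF z, of c] False g_sym C c by (metis DiffD1 subsetD)
    moreover have "br z c = Exp z c - c - g z c *s z" by (simp add: Exp_def)
    ultimately show ?thesis using zC c by (metis span_diff span_scale span_base)
  next
    case True
    have "br c z \<in> ?I"
      using spec[OF c P0_I[OF z True]] by (cases "br c z = 0") (auto intro: span_base span_zero)
    then show ?thesis using br_swap[of z c] span_neg by metis
  qed
  have 2: "br z i \<in> ?I" if z: "z \<in> X" and i: "i \<in> ?I" for z i
    using i by (induction rule: span_induct_alt) (auto simp: br_linear span_zero intro!: span_add span_scale 1 z)
  have 3: "br a i \<in> ?I" if i: "i \<in> ?I" for a i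
    by (induction a rule: X_induct) (auto simp: br_linear span_zero intro!: span_add span_scale 2 i)
  have "?I = {0} \<or> ?I = UNIV" by (rule ideal_trivial) (auto intro: 3)
  then have I: "?I = UNIV" using C span_base[of _ C] by blast
  show ?thesis
  proof
    fix d assume d: "d \<in> X - {0}"
    show "d \<in> C"
    proof (rule ccontr)
      assume "d \<notin> C"
      then have z: "g c d = 0" if "c \<in> C" for c using hyp that d by blast
      have "g m d = 0" if "m \<in> ?I" for m
        using that by (induction rule: span_induct_alt) (auto simp: g_bilin z)
      then show False using g_nondeg[of d] d I by auto
    qed
  qed
qed

text \<open>If perpendicular extremal elements always commuted, the polarised extremal identities on a line
  \<open>\<langle>y, p\<rangle>\<close> would force characteristic 2, and then \<open>br y u\<close> would be a nonzero central element.\<close>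

context
  assumes no_special: "\<And>a b. a \<in> X \<Longrightarrow> b \<in> X \<Longrightarrow> g a b = 0 \<Longrightarrow> br a b = 0"
begin

text \<open>The extremal elements \<open>u\<close> and \<open>c\<close> are dual to the basis
  \<open>y\<close>, \<open>p\<close> of the line with respect to \<open>g\<close>, which makes most
  terms of the polarised identities disappear.\<close>

lemma no_special_config:
  assumes line: "\<And>s t. s *s y + t *s p \<in> X" and yp: "br y p = 0"
    and u: "u \<in> X" "g u y = 1" "g u p = 0" and c: "c \<in> X" "g c p = 1" "g c y = 0"
  shows "(2::'f) = 0" "br (br y u) c = 0" "br y u = br p c" "br y u \<noteq> 0"
proof -
  have y: "y \<in> X" and p: "p \<in> X" using line[of 1 0] line[of 0 1] by simp_all
  have gs: "g y u = 1" "g p u = 0" "g p c = 1" "g y c = 0" using u c g_sym by simp_all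
  have up: "br p u = 0" "br u p = 0" using no_special u p g_sym by auto
  have cy: "br y c = 0" "br c y = 0" using no_special c y g_sym by auto
  have py: "br p y = 0" using yp br_swap[of p y] by simp
  have guc: "g p (br u c) = 0" "g y (br u c) = 0"
    using up g_assoc[of p u c] g_skew[of c y u] br_swap[of u c] cy by (simp_all add: g_bilin)
  define e k where "e = br y u" and "k = br p c"
  have XL: "y + t *s p \<in> X" for t using line[of 1 t] by simp
  have ek: "br e k = e - k"
    using X_line(4)[OF XL, of u c] by (simp add: B2_def e_def k_def gs guc up cy)
  have yuk: "br y (br u k) = - e - k"
    using X_line(5)[OF XL, of u c] by (simp add: B3_def e_def k_def gs guc up cy)
  have "br y k = 0" using jacobi[of y p c] yp cy by (simp add: k_def)
  then have "br y (br u k) = br e k" using jacobi[of y u k] by (simp add: e_def)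
  \<comment> \<open>The polarised second and third identities evaluate the same element, because
    \<open>y\<close> commutes with \<open>k\<close>.\<close>
  then have "e - k = - e - k" using ek yuk by simp
  then have "e = - e" by (metis diff_add_cancel)
  then have "e + e = 0" by (simp only: eq_neg_iff_add_eq_0)
  moreover have e0: "e \<noteq> 0"
    using hyp.e_neq_0[OF hyp_pair[OF y u(1) gs(1)]] by (simp add: e_def)
  ultimately show two: "(2::'f) = 0" using scale_2(1)[of e] by simp
  show "br y u \<noteq> 0" using e0 by (simp add: e_def)
  have dbl: "a + a = 0" for a :: 'm using two scale_2(1)[of a] by simp
  obtain t :: 'f where t: "t \<noteq> 0" "t \<noteq> 1" using ex_scalar .
  define A where "A = br y (br u c)"
  define W where "W = br p (br u c)"
  define \<gamma> where "\<gamma> = g u c"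
  have eq: "A + s *s (\<gamma> *s (e - k)) - (s * s) *s (\<gamma> *s W) = 0" if s: "s \<noteq> 0" for s
  proof -
    define z where "z = Exp (s *s u) c"
    have z: "z \<in> X" unfolding z_def by (rule Exp_X[OF X_scale[OF u(1)] c(1)])
    have zz: "z = c + s *s br u c + (s * s * \<gamma>) *s u" by (simp add: z_def Exp_def \<gamma>_def br_linear g_bilin)
    have pz: "g p z = 1" "g y z = s * s * \<gamma>" by (simp_all add: zz g_bilin gs guc)
    \<comment> \<open>\<open>q\<close> is the point of the line perpendicular to \<open>z\<close>,
      so it commutes with \<open>z\<close>; expanding the bracket and dividing by \<open>s\<close>
      gives the quadratic relation.\<close>
    define q where "q = (- 1) *s y + (s * s * \<gamma>) *s p"
    have "q \<in> X" unfolding q_def by (rule line)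
    moreover have "g q z = 0" by (simp add: q_def g_bilin pz)
    ultimately have "br q z = 0" using no_special z by blast
    moreover have "br q z = - (s *s (A + s *s (\<gamma> *s (e - k)) - (s * s) *s (\<gamma> *s W)))"
      by (simp add: q_def zz br_linear up cy A_def W_def e_def k_def algebra_simps)
    ultimately show ?thesis using s by (metis neg_equal_0_iff_equal scale_eq_0_iff)
  qed
  have t1: "t + 1 \<noteq> 0" using t two by (metis add_right_cancel one_add_one)
  define B C where "B = \<gamma> *s (e - k)" and "C = \<gamma> *s W"
  have eq': "A + s *s B - (s * s) *s C = 0" if "s \<noteq> 0" for s
    using eq[OF that] by (simp add: B_def C_def)
  \<comment> \<open>In characteristic 2 the scalars 1, \<open>t\<close> and \<open>t + 1\<close> sum
    to 0, and so do their squares. Adding the three relations leaves \<open>3 A = A\<close>.\<close>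
  have "A + (A + A) + (B + B) + (t *s B + t *s B) - (C + C) - (t *s C + t *s C)
     - ((t * t) *s C + (t * t) *s C)
     = (A + 1 *s B - (1 * 1) *s C) + (A + t *s B - (t * t) *s C)
       + (A + (t + 1) *s B - ((t + 1) * (t + 1)) *s C)"
    by (simp add: algebra_simps scale_2)
  also have "\<dots> = 0" using eq'[of 1] eq'[of t] eq'[of "t + 1"] t t1 by simp
  finally have "A + (A + A) + (B + B) + (t *s B + t *s B) - (C + C) - (t *s C + t *s C)
     - ((t * t) *s C + (t * t) *s C) = 0" .
  then have A: "A = 0" by (simp add: dbl)
  then have ec: "br e c = 0" using jacobi[of y u c] cy by (simp add: A_def e_def)
  then show "br (br y u) c = 0" by (simp add: e_def)
  have "br e p = 0" using jacobi[of y u p] up py yp by (simp add: e_def)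
  then have "br e k = 0" using jacobi[of e p c] ec by (simp add: k_def)
  then show "br y u = br p c" using ek by (simp add: e_def k_def)
qed

text \<open>After scaling \<open>d\<close>, the point \<open>y\<close> is shifted along the line so
  that \<open>d\<close> takes the place of \<open>c\<close> in the dual configuration;
  \<open>br y u\<close> does not change because \<open>p\<close> commutes with
  \<open>u\<close>.\<close>

lemma no_special_central:
  assumes line: "\<And>s t. s *s y + t *s p \<in> X" and yp: "br y p = 0"
    and u: "u \<in> X" "g u y = 1" "g u p = 0" and c: "c \<in> X" "g c p = 1" "g c y = 0"
    and d: "d \<in> X" "g d p \<noteq> 0"
  shows "br (br y u) d = 0"
proof -
  have p: "p \<in> X" using line[of 0 1] by simp
  have up: "br p u = 0" using no_special[OF p u(1)] u g_sym by simp
  define d' where "d' = inverse (g d p) *s d"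
  have d': "d' \<in> X" "g d' p = 1" using d by (simp_all add: d'_def X_scale g_bilin)
  have gp: "g p p = 0" using X_self(1)[OF p] .
  have "br (br (y - g d' y *s p) u) d' = 0"
  proof (rule no_special_config(2)[where p = p])
    show "s *s (y - g d' y *s p) + t *s p \<in> X" for s t
      using line[of s "t - s * g d' y"] by (simp add: algebra_simps)
  qed (use u yp d' in \<open>auto simp: g_bilin br_linear br_self\<close>)
  then have "br (br y u) d' = 0" by (simp add: br_linear up)
  then show ?thesis using d by (simp add: d'_def br_linear)
qed

lemma no_special_no_line:
  assumes line: "\<And>s t. s *s y + t *s p \<in> X" and yp: "br y p = 0"
    and u: "u \<in> X" "g u y = 1" "g u p = 0" and c: "c \<in> X" "g c p = 1" "g c y = 0"
  shows False
proof -
  have y: "y \<in> X" and p: "p \<in> X" using line[of 1 0] line[of 0 1] by simp_all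
  note nc = no_special_config[OF assms]
  define e where "e = br y u"
  have line': "s *s p + t *s y \<in> X" for s t using line[of t s] by (simp add: add.commute)
  have py: "br p y = 0" using yp br_swap[of p y] by simp
  have ek: "e = br p c" using nc(3) by (simp add: e_def)
  have ec: "br e c = 0" using nc(2) by (simp add: e_def)
  have 1: "br e d = 0" if "d \<in> X" "g d p \<noteq> 0" for d
    unfolding e_def by (rule no_special_central[OF assms that])
  have 2: "br e d = 0" if "d \<in> X" "g d y \<noteq> 0" for d
    unfolding ek by (rule no_special_central[OF line' py c u that])
  have 3: "br e d = 0" if d: "d \<in> X" for d
  proof (cases "g d p = 0 \<and> g d y = 0")
    case True
    then have pd: "br p d = 0" using no_special[OF p d] g_sym by simp
    show ?thesis
    proof (cases "g c d = 0")
      case True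
      then have "br c d = 0" using no_special[OF c(1) d] by simp
      then show ?thesis using jacobi[of p c d] pd by (simp add: ek)
    next
      case False
      have gp: "g p (br c d) = 0"
        using g_skew[of d p c] br_swap[of c d] br_swap[of d p] pd by (simp add: g_bilin)
      \<comment> \<open>\<open>d\<close> is moved by \<open>Exp (s *s c)\<close> off the hyperplane
        perpendicular to \<open>p\<close>, where the previous case applies. Two nonzero values of
        \<open>s\<close> then separate the two terms.\<close>
      have *: "br e d + s *s br c (br e d) = 0" if s: "s \<noteq> 0" for s
      proof -
        define z where "z = Exp (s *s c) d"
        have z: "z = d + s *s br c d + (s * s * g c d) *s c" by (simp add: z_def Exp_def br_linear g_bilin)
        have "z \<in> X" unfolding z_def by (rule Exp_X[OF X_scale[OF c(1)] d])
        moreover have "g z p \<noteq> 0"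
          using True False s gp c(2) g_sym[of "br c d" p] by (simp add: z g_bilin)
        ultimately have "br e z = 0" by (rule 1)
        then show ?thesis using jacobi[of e c d] ec by (simp add: z br_linear)
      qed
      obtain t :: 'f where t: "t \<noteq> 0" "t \<noteq> 1" using ex_scalar .
      have "t *s br c (br e d) = 1 *s br c (br e d)" using *[of 1] *[OF t(1)] by (metis add_left_cancel one_neq_zero)
      then have "(t - 1) *s br c (br e d) = 0" by (simp only: scale_left_diff_distrib diff_self)
      then have "br c (br e d) = 0" using t by simp
      then show ?thesis using *[of 1] by simp
    qed
  qed (use 1 2 d in auto)
  have "br e m = 0" for m
    by (induction m rule: X_induct) (auto simp: br_linear 3)
  then have "e = 0" by (rule centre_trivial)
  then show False using nc(4) by (simp add: e_def)
qed

end

end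

section \<open>Existence of special pairs\<close>

locale line_lie = ext_lie sc br g
  for sc :: "'f::field \<Rightarrow> 'm::ab_group_add \<Rightarrow> 'm" (infixr "*s" 75) and br g +
  assumes lines: "geometry_contains_lines sc br"
begin

text \<open>A collinear pair is adjusted, as in Gram-Schmidt, to a basis of the same line that has a
  dual pair of extremal elements; this is the configuration excluded above.\<close>

lemma ex_special: "\<exists>a b. a \<in> X \<and> b \<in> X \<and> g a b = 0 \<and> br a b \<noteq> 0"
proof (rule ccontr)
  assume "\<not> ?thesis"
  then have ns: "br a b = 0" if "a \<in> X" "b \<in> X" "g a b = 0" for a b using that by blast
  obtain y p where yp: "pure_extremal sc br y" "\<And>a. p \<noteq> a *s y" "br y p = 0"
    "\<And>a b. extremal sc br (a *s y + b *s p) \<or> a *s y + b *s p = 0"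
    using lines by (auto simp: geometry_contains_lines_def collinear_extremal_def)
  have line: "s *s y + t *s p \<in> X" for s t using yp(4)[of s t] X_extremal X_0 by metis
  have y: "y \<in> X" using line[of 1 0] by simp
  have "y \<noteq> 0" using yp(1) by (auto simp: pure_extremal_def extremal_def)
  then obtain u where u: "hp u y" using hp_exists[OF y] by blast
  define p' where "p' = p - g u p *s y"
  have "p' \<noteq> 0" using yp(2)[of "g u p"] by (auto simp: p'_def)
  moreover have "p' \<in> X" using line[of "- g u p" 1] by (simp add: p'_def)
  ultimately obtain c where c: "hp c p'" using hp_exists by blast
  define y' where "y' = y - g c y *s p'"
  have up: "g u p' = 0" using u by (simp add: p'_def g_bilin hp_def)
  show False
  proof (rule no_special_no_line[OF ns])
    show "s *s y' + t *s p' \<in> X" for s t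
      using line[of "s + s * g c y * g u p - t * g u p" "t - s * g c y"]
      by (simp add: y'_def p'_def algebra_simps)
    show "br y' p' = 0" by (simp add: y'_def p'_def br_linear br_self yp(3) br_swap[of p y])
    show "u \<in> X" "g u y' = 1" "g u p' = 0" using u up by (auto simp: hp_def y'_def g_bilin)
    show "c \<in> X" "g c p' = 1" "g c y' = 0" using c by (auto simp: hp_def y'_def g_bilin)
  qed
qed

text \<open>Having a nonzero special neighbour passes to hyperbolic neighbours through
  \<open>br d'\<close>, and to special neighbours through nondegeneracy of the bracket on
  \<open>V\<close>; \<open>X_connected\<close> then reaches every point.\<close>

lemma P0_nonzero: "c \<in> X \<Longrightarrow> c \<noteq> 0 \<Longrightarrow> \<exists>l\<in>P0 c. l \<noteq> 0"
proof -
  let ?C = "{c \<in> X - {0}. \<exists>l\<in>P0 c. l \<noteq> 0}"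
  have "X - {0} \<subseteq> ?C"
  proof (rule X_connected)
    show "?C \<noteq> {}"
    proof -
      obtain a b where "a \<in> X" "b \<in> X" "g a b = 0" "br a b \<noteq> 0" using ex_special by blast
      then have "a \<in> ?C" using P0_I[of b a] by auto
      then show ?thesis by blast
    qed
    show "d \<in> ?C" if c: "c \<in> ?C" and d: "d \<in> X" "g c d \<noteq> 0" for c d
    proof -
      define d' where "d' = inverse (g c d) *s d"
      have h: "hp d' c" using c d by (simp add: hp_def d'_def X_scale g_bilin g_sym[of d c])
      obtain l where l: "l \<in> P0 c" "l \<noteq> 0" using c by blast
      obtain l1 where l1: "l1 \<in> V d' c" "l1 \<noteq> 0" using P0_decomp[OF h l(1)] l(2) by metis
      have "br d' l1 \<noteq> 0" using V_D(2)[OF h l1(1)] l1(2) by auto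
      moreover have "br d' l1 \<in> P0 d'" using V_P0[OF hp_sym[OF h] V_swap[OF h l1(1)]] .
      moreover have "P0 d' = P0 d" unfolding d'_def using d by (intro P0_scale_point) simp
      moreover have "d \<noteq> 0" using d by (auto simp: g_bilin)
      ultimately show ?thesis using d by auto
    qed
    show "l \<in> ?C" if c: "c \<in> ?C" and l: "l \<in> P0 c" "l \<noteq> 0" for c l
    proof -
      obtain d where h: "hp d c" using hp_exists[of c] c by blast
      obtain l1 \<mu> where l1: "l1 \<in> V d c" "l = l1 + \<mu> *s c" "l1 \<noteq> 0" using P0_decomp[OF h l(1)] l(2) by metis
      obtain l' where l': "l' \<in> V d c" "br l1 l' \<noteq> 0" using V_nondegenerate[OF h l1(1,3)] by blast
      note L' = V_D[OF h l'(1)]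
      have "br l l' = br l1 l'" using l1(2) L' by (simp add: br_linear)
      moreover have "g l l' = 0"
        using g_L1[OF V_D(2)[OF h l1(1)] L'(5)] L' l1(2) by (simp add: g_bilin)
      ultimately show ?thesis using P0_I[OF L'(1), of l] l'(2) P0_X[OF _ l(1)] c l(2) by auto
    qed
  qed auto
  then show "c \<in> X \<Longrightarrow> c \<noteq> 0 \<Longrightarrow> \<exists>l\<in>P0 c. l \<noteq> 0" by blast
qed

lemma V_nonzero:
  assumes "hp x y"
  obtains l where "l \<in> V x y" "l \<noteq> 0"
proof -
  have "y \<in> X" "y \<noteq> 0" using assms by (auto simp: hp_def g_bilin)
  then obtain l where "l \<in> P0 y" "l \<noteq> 0" using P0_nonzero by blast
  then show ?thesis using P0_decomp[OF assms] that by metis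
qed

end

section \<open>Brackets of degree 0 acting on the span of extremal elements in degree 1\<close>

context ext_lie
begin

text \<open>Read in the grading of the hyperbolic pair \<open>(w, l)\<close>, this places
  \<open>y\<close> in degree 1; by symmetry \<open>x\<close> has degree -1 there.\<close>

lemma V_hyp_br:
  assumes h: "hp x y" and l: "l \<in> V x y" and w: "w \<in> V y x" and "g l w = 1"
  shows "br l (br w y) = - y"
proof -
  have yw: "br y w \<in> V x y" by (rule V_swap[OF hp_sym[OF h] w])
  have "g x (br l (br y w)) = g (br (br x l) y) w" by (simp add: g_assoc)
  also have "br (br x l) y = l" using br_swap[of "br x l" y] V_D(2)[OF h l] by simp
  finally have "br l (br y w) = y" using V_br_V[OF h l yw] assms(4) by simp
  then show ?thesis using br_swap[of w y] by (simp add: br_linear)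
qed

text \<open>Here \<open>br l w\<close> is itself extremal of degree 0. It commutes with
  \<open>y\<close>, because its square kills \<open>y\<close> while \<open>y\<close> is an
  eigenvector; hence its exponential maps \<open>l2\<close> to \<open>l2 + br (br l w) l2\<close>,
  again extremal of degree 1.\<close>

lemma V_span_perp:
  assumes h: "hp x y" and l: "l \<in> V x y" and w: "w \<in> V y x" and l2: "l2 \<in> V x y" and z: "g l w = 0"
  shows "br (br l w) l2 \<in> span (V x y)"
proof -
  interpret H: hyp sc br x y "g x" "g y" using hp_hyp[OF h] .
  define a where "a = br l w"
  have w': "w \<in> H.Gr (-1)" using V_D(2)[OF hp_sym[OF h] w] by (simp add: H.Gr_def)
  have aG: "a \<in> H.Gr 0" using H.Gr_br[OF V_D(8)[OF h l] w'] by (simp add: a_def)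
  have aX: "a \<in> X" unfolding a_def
    by (rule X_special(3)[OF V_D(1)[OF h l] V_D(1)[OF hp_sym[OF h] w] z])
  obtain \<nu> \<mu> where xa: "br x a = \<nu> *s x" and ya: "br y a = \<mu> *s y" using aG by (auto simp: H.Gr_def)
  note f = H.Gr0_facts[OF xa ya]
  have "br a (br a y) = (\<mu> * \<mu>) *s y" using br_swap[of a y] ya by (simp add: br_linear)
  moreover have "br a (br a y) = 0" using X_D(1)[OF aX, of y] f(2) g_sym[of a y] by simp
  ultimately have "\<mu> = 0" using H.y_neq_0 by simp
  then have "br y a = 0" using ya by simp
  then have "g l2 a = 0" by (rule g_L1[OF V_D(2)[OF h l2]])
  then have E: "Exp a l2 = l2 + br a l2" using g_sym by (simp add: Exp_def)
  have "Exp a l2 \<in> H.Gr 1"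
    unfolding E using H.gr_add[OF V_D(8)[OF h l2]] H.Gr_br[OF aG V_D(8)[OF h l2]] by simp
  then have "Exp a l2 \<in> V x y" using Exp_X[OF aX V_D(1)[OF h l2]] by (simp add: V_def H.Gr_def)
  moreover have "br a l2 = Exp a l2 - l2" by (simp add: E)
  ultimately show ?thesis unfolding a_def[symmetric] using l2 by (metis span_base span_diff)
qed

text \<open>The torus of the hyperbolic pair \<open>(w, l)\<close> scales \<open>x\<close> and \<open>y\<close>, so it preserves \<open>span (V x y)\<close>;
  one torus element outside the identity suffices to separate the components of \<open>l2\<close>.\<close>

lemma V_span_hyp:
  assumes h: "hp x y" and l: "l \<in> V x y" and w: "w \<in> V y x" and l2: "l2 \<in> V x y" and o: "g l w = 1"
  shows "br (br l w) l2 \<in> span (V x y)"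
proof -
  let ?S = "span (V x y)"
  have h': "hp w l" using V_D(1)[OF h l] V_D(1)[OF hp_sym[OF h] w] o g_sym by (simp add: hp_def)
  interpret H: hyp sc br w l "g w" "g l" using hp_hyp[OF h'] .
  have y: "y \<in> H.Gr 1" using V_hyp_br[OF h l w o] by (simp add: H.Gr_def)
  have x: "x \<in> H.Gr (-1)" using V_hyp_br[OF hp_sym[OF h] w l] o g_sym by (simp add: H.Gr_def)
  define a where "a i = H.cp i l2" for i
  have am2: "a (-2) = 0"
    using g_L1[OF V_D(2)[OF h l] V_D(5)[OF h l2]] by (simp add: a_def H.cp_def)
  have a2: "a 2 \<in> ?S" using l by (simp add: a_def H.cp_def span_base span_scale)
  have "l \<in> H.Gr 2" by (auto simp: H.Gr_def intro!: image_eqI[of _ _ 1])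
  \<comment> \<open>\<open>br l l2\<close> is a multiple of \<open>y\<close>, and applying
    \<open>br w\<close> recovers \<open>a (-1)\<close> up to sign.\<close>
  then have "br l (a (-1)) = H.cp 1 (br l l2)"
    using H.hom_cmp[OF H.hom_br, of l 2 "-1" l2] by (simp add: a_def)
  also have "\<dots> = g x (br l l2) *s y"
    using V_br_V[OF h l l2] H.Gr_cp[OF y, of 1] by (metis H.cmp_lin(2))
  finally have "br w (br l (a (-1))) = g x (br l l2) *s br w y" by (simp add: br_linear)
  then have "a (-1) = g x (br l l2) *s br y w"
    using H.cp_Gr[of "-1" l2] br_swap[of w y] by (simp add: H.Gr_def a_def)
  then have am1: "a (-1) \<in> ?S" using V_swap[OF hp_sym[OF h] w] by (simp add: span_base span_scale)
  have l2_sum: "l2 = a (-1) + a 0 + a 1 + a 2" using H.cmp_sum5[of l2] am2 by (simp add: a_def)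
  obtain t :: 'f where t: "t \<noteq> 0" "t \<noteq> 1" using ex_scalar .
  define \<phi> where "\<phi> = H.torus t"
  have A: "autom \<phi> (H.torus (inverse t))"
    using t H.torus_inverse[of t] H.torus_inverse[of "inverse t"]
    by (simp add: autom_def \<phi>_def H.torus_linmap H.torus_br)
  have \<phi>: "\<phi> (br b c) = br (\<phi> b) (\<phi> c)" "\<phi> (- b) = - \<phi> b" for b c
    using A by (simp_all add: autom_def linmapD(4))
  have "\<phi> y = t *s y" "\<phi> x = inverse t *s x"
    using H.torus_gr[OF y, of t] H.torus_gr[OF x, of t] by (simp_all add: \<phi>_def power_int_minus)
  then have "br y (br x (\<phi> l2)) = \<phi> (br y (br x l2))"
    using t by (simp add: \<phi> br_linear)
  also have "\<dots> = - \<phi> l2" using V_D(2)[OF h l2] by (simp add: \<phi>)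
  finally have "\<phi> l2 \<in> V x y" using autom_X(1)[OF A V_D(1)[OF h l2]] by (simp add: V_def)
  then have \<phi>S: "\<phi> l2 \<in> ?S" by (rule span_base)
  have \<phi>_sum: "\<phi> l2 = inverse t *s a (-1) + a 0 + t *s a 1 + (t * t) *s a 2"
    using am2 unfolding \<phi>_def H.torus_def H.range5
    by (simp add: a_def power_int_minus power2_eq_square)
  \<comment> \<open>In the difference of \<open>\<phi> l2\<close> and \<open>l2\<close> the
    component \<open>a 0\<close>, about which nothing is known, cancels.\<close>
  have "(t - 1) *s a 1 = (\<phi> l2 - inverse t *s a (-1) - (t * t) *s a 2) - (l2 - a (-1) - a 2)"
    unfolding \<phi>_sum by (subst l2_sum) (simp add: algebra_simps)
  also have "\<dots> \<in> ?S" by (intro span_diff span_scale \<phi>S am1 a2 span_base l2)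
  finally have "inverse (t - 1) *s (t - 1) *s a 1 \<in> ?S" by (rule span_scale)
  then have a1: "a 1 \<in> ?S" using t by simp
  have "br (br w l) l2 = 2 *s a 2 + a 1 - a (-1)"
    using H.e_Gr[OF H.cp_Gr, of "-1" l2] H.e_Gr[OF H.cp_Gr, of 0 l2] H.e_Gr[OF H.cp_Gr, of 1 l2]
      H.e_Gr[OF H.cp_Gr, of 2 l2]
    by (subst l2_sum) (simp add: br_linear a_def)
  also have "\<dots> \<in> ?S" by (intro span_diff span_add span_scale a1 a2 am1)
  finally have "- br (br w l) l2 \<in> ?S" by (rule span_neg)
  then show ?thesis using br_swap[of l w] by (simp add: br_linear)
qed

lemma V_span_br:
  assumes h: "hp x y" and l: "l \<in> V x y" and w: "w \<in> V y x" and m: "m \<in> span (V x y)"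
  shows "br (br l w) m \<in> span (V x y)"
proof -
  have "br (br l w) l2 \<in> span (V x y)" if l2: "l2 \<in> V x y" for l2
  proof (cases "g l w = 0")
    case True
    then show ?thesis using V_span_perp[OF h l w l2] by simp
  next
    case False
    then have "br (br l (inverse (g l w) *s w)) l2 \<in> span (V x y)"
      by (intro V_span_hyp[OF h l V_scale[OF w] l2]) (simp add: g_bilin)
    then have "g l w *s br (br l (inverse (g l w) *s w)) l2 \<in> span (V x y)" by (rule span_scale)
    then show ?thesis using False by (simp add: br_linear)
  qed
  with m show ?thesis
    by (induction rule: span_induct_alt) (auto simp: br_linear span_zero intro!: span_add span_scale)
qed

section \<open>The graded subalgebra built from extremal elements\<close>

definition RR :: "'m \<Rightarrow> 'm \<Rightarrow> int \<Rightarrow> 'm set" where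
  "RR x y i = (if i = 1 then span (V x y) else if i = -1 then span (V y x)
     else if i = 0 then {a \<in> hyp.Gr sc br x y 0. (\<forall>m\<in>span (V x y). br a m \<in> span (V x y))
       \<and> (\<forall>m\<in>span (V y x). br a m \<in> span (V y x))}
     else hyp.Gr sc br x y i)"

lemma RR_swap: "hp x y \<Longrightarrow> RR y x i = RR x y (- i)"
proof -
  assume h: "hp x y"
  interpret H: hyp sc br x y "g x" "g y" using hp_hyp[OF h] .
  show ?thesis by (auto simp: RR_def H.sw_Gr)
qed

lemma span_V_Gr: "hp x y \<Longrightarrow> span (V x y) \<subseteq> hyp.Gr sc br x y 1"
proof -
  assume h: "hp x y"
  interpret H: hyp sc br x y "g x" "g y" using hp_hyp[OF h] .
  show ?thesis
    by (rule span_minimal) (auto simp: subspace_def H.gr_add H.gr_scale intro: V_D(8)[OF h])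
qed

lemma RR_Gr: "hp x y \<Longrightarrow> RR x y i \<subseteq> hyp.Gr sc br x y i"
proof -
  assume h: "hp x y"
  interpret H: hyp sc br x y "g x" "g y" using hp_hyp[OF h] .
  show ?thesis using span_V_Gr[OF h] span_V_Gr[OF hp_sym[OF h]] by (auto simp: RR_def H.sw_Gr)
qed

lemma RR_subspace: "hp x y \<Longrightarrow> subspace (RR x y i)"
proof -
  assume h: "hp x y"
  interpret H: hyp sc br x y "g x" "g y" using hp_hyp[OF h] .
  have "subspace (H.Gr i)" by (auto simp: subspace_def H.gr_add H.gr_scale)
  then show ?thesis
    unfolding RR_def
    by (auto simp: subspace_def span_zero span_add span_scale br_linear)
qed

text \<open>Besides the stabiliser property, the point is that \<open>br y\<close> maps the span in
  degree -1 into the span in degree 1.\<close>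

lemma RR_br_1:
  assumes h: "hp x y" and a: "a \<in> RR x y i" and b: "b \<in> RR x y (1 - i)"
  shows "br a b \<in> RR x y 1"
proof -
  interpret H: hyp sc br x y "g x" "g y" using hp_hyp[OF h] .
  have S: "RR x y 1 = span (V x y)" by (simp add: RR_def)
  have y2: "br c w \<in> span (V x y)" if c: "c \<in> RR x y 2" and w: "w \<in> RR x y (-1)" for c w
  proof -
    obtain s where s: "c = s *s y" using c by (auto simp: RR_def H.Gr_def)
    have "w \<in> span (V y x)" using w by (simp add: RR_def)
    moreover have "br y v \<in> span (V x y)" if "v \<in> V y x" for v
      using V_swap[OF hp_sym[OF h] that] by (rule span_base)
    ultimately have "br y w \<in> span (V x y)"
      by (induction rule: span_induct_alt) (auto simp: br_linear span_zero intro!: span_add span_scale)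
    then show ?thesis by (simp add: s br_linear span_scale)
  qed
  have n: "br c m \<in> span (V x y)" if "c \<in> RR x y 0" "m \<in> RR x y 1" for c m
    using that by (simp add: RR_def)
  have sw: "br b a \<in> span (V x y) \<Longrightarrow> br a b \<in> span (V x y)" using br_swap[of a b] span_neg by metis
  have out: "a = 0" if "i > 2 \<or> i < -2" using H.gr_outside[of i a] that RR_Gr[OF h, of i] a by auto
  have out': "b = 0" if "1 - i > 2 \<or> 1 - i < -2" using H.gr_outside[of "1 - i" b] that RR_Gr[OF h, of "1 - i"] b by auto
  consider "i = 2" | "i = 1" | "i = 0" | "i = -1" | "i > 2 \<or> i < -2" | "1 - i > 2 \<or> 1 - i < -2" by linarith
  then show ?thesis
  proof cases
    case 1 then show ?thesis using y2 a b S by simp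
  next
    case 2 then show ?thesis using sw n a b S by simp
  next
    case 3 then show ?thesis using n a b S by simp
  next
    case 4 then show ?thesis using sw y2 a b S by simp
  qed (use out out' S in \<open>auto simp: span_zero\<close>)
qed

lemma RR_br_0:
  assumes h: "hp x y" and a: "a \<in> RR x y i" and b: "b \<in> RR x y (- i)"
  shows "br a b \<in> RR x y 0"
proof -
  interpret H: hyp sc br x y "g x" "g y" using hp_hyp[OF h] .
  note sub = RR_subspace[OF h, of 0]
  have e: "br x y \<in> RR x y 0"
  proof -
    have "br (br x y) m = m" if "m \<in> span (V x y)" for m
      using H.e_Gr[of m 1] span_V_Gr[OF h] that by auto
    moreover have "br (br x y) m = - m" if "m \<in> span (V y x)" for m
      using H.e_Gr[of m "-1"] span_V_Gr[OF hp_sym[OF h]] that by (auto simp: H.sw_Gr)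
    ultimately show ?thesis using H.e_in_Gr0 by (auto simp: RR_def span_neg)
  qed
  have VV: "br l w \<in> RR x y 0" if l: "l \<in> V x y" and w: "w \<in> V y x" for l w
  proof -
    have "w \<in> H.Gr (-1)" using V_D(8)[OF hp_sym[OF h] w] by (simp add: H.sw_Gr)
    then have "br l w \<in> H.Gr 0" using H.Gr_br[OF V_D(8)[OF h l]] by fastforce
    moreover have "br (br l w) m \<in> span (V y x)" if "m \<in> span (V y x)" for m
      using V_span_br[OF hp_sym[OF h] w l that] br_swap[of l w] by (simp add: br_linear span_neg)
    ultimately show ?thesis using V_span_br[OF h l w] by (auto simp: RR_def)
  qed
  have lw: "br l w \<in> RR x y 0" if l: "l \<in> RR x y 1" and w: "w \<in> RR x y (-1)" for l w
  proof -
    have VS: "br l w \<in> RR x y 0" if l: "l \<in> V x y" and w: "w \<in> span (V y x)" for l w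
      using w by (induction rule: span_induct_alt)
        (auto simp: br_linear intro!: subspace_add[OF sub] subspace_scale[OF sub] subspace_0[OF sub] VV l)
    have "l \<in> span (V x y)" "w \<in> span (V y x)" using l w by (auto simp: RR_def)
    then show ?thesis
      by (induction rule: span_induct_alt)
        (auto simp: br_linear intro!: subspace_add[OF sub] subspace_scale[OF sub] subspace_0[OF sub] VS)
  qed
  have sw: "br b a \<in> RR x y 0 \<Longrightarrow> br a b \<in> RR x y 0" using br_swap[of a b] subspace_neg[OF sub] by metis
  have yx: "br c d \<in> RR x y 0" if c: "c \<in> RR x y 2" and d: "d \<in> RR x y (-2)" for c d
  proof -
    obtain s t where "c = s *s y" "d = t *s x" using c d by (auto simp: RR_def H.Gr_def)
    then have "br c d = (- (s * t)) *s br x y" using H.yx by (simp add: br_linear)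
    then show ?thesis using subspace_scale[OF sub e] by metis
  qed
  have nn: "br a b \<in> RR x y 0" if a: "a \<in> RR x y 0" and b: "b \<in> RR x y 0"
  proof -
    have j: "br (br a b) m = br a (br b m) - br b (br a m)" for m using jacobi[of a b m] by simp
    have "br a b \<in> H.Gr 0" using H.Gr_br[of a 0 b 0] a b by (simp add: RR_def)
    then show ?thesis using a b by (auto simp: RR_def j intro!: span_diff)
  qed
  have out: "a = 0" if "i > 2 \<or> i < -2" using H.gr_outside[of i a] that RR_Gr[OF h, of i] a by auto
  consider "i = 2" | "i = 1" | "i = 0" | "i = -1" | "i = -2" | "i > 2 \<or> i < -2" by linarith
  then show ?thesis
  proof cases
    case 1 then show ?thesis using yx a b by simp
  next
    case 2 then show ?thesis using lw a b by simp
  next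
    case 3 then show ?thesis using nn a b by simp
  next
    case 4 then show ?thesis using sw lw a b by simp
  next
    case 5 then show ?thesis using sw yx a b by simp
  qed (use out subspace_0[OF sub] in auto)
qed

text \<open>Only total degrees -1, 0 and 1 need proof, since elsewhere \<open>RR\<close> is the
  whole component; degree -1 is the mirror image of degree 1.\<close>

lemma RR_br:
  assumes h: "hp x y" and a: "a \<in> RR x y i" and b: "b \<in> RR x y j"
  shows "br a b \<in> RR x y (i + j)"
proof -
  interpret H: hyp sc br x y "g x" "g y" using hp_hyp[OF h] .
  consider "i + j = 1" | "i + j = -1" | "i + j = 0" | "i + j \<noteq> 1" "i + j \<noteq> -1" "i + j \<noteq> 0" by linarith
  then show ?thesis
  proof cases
    case 1
    then have "j = 1 - i" by simp
    then show ?thesis using RR_br_1[OF h a] b by simp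
  next
    case 2
    then have "j = - (1 - (- i))" by simp
    then have "b \<in> RR x y (- (1 - (- i)))" using b by (simp only:)
    then show ?thesis
      using RR_br_1[OF hp_sym[OF h], of a "- i" b] a 2 by (simp add: RR_swap[OF h])
  next
    case 3
    then have "j = - i" by simp
    then show ?thesis using RR_br_0[OF h a] b by simp
  next
    case 4
    then have "RR x y (i + j) = H.Gr (i + j)" by (simp add: RR_def)
    then show ?thesis using H.Gr_br[of a i b j] a b RR_Gr[OF h] by auto
  qed
qed

definition R :: "'m \<Rightarrow> 'm \<Rightarrow> 'm set" where
  "R x y = {m. \<forall>i. hyp.cp sc br x y (g x) (g y) i m \<in> RR x y i}"

lemma R_subspace: "hp x y \<Longrightarrow> subspace (R x y)"
proof -
  assume h: "hp x y"
  interpret H: hyp sc br x y "g x" "g y" using hp_hyp[OF h] .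
  note s = RR_subspace[OF h]
  show ?thesis unfolding R_def
    by (auto simp: subspace_def H.cmp_lin intro: subspace_0[OF s] subspace_add[OF s] subspace_scale[OF s])
qed

lemma RR_R: "hp x y \<Longrightarrow> a \<in> RR x y i \<Longrightarrow> a \<in> R x y"
proof -
  assume h: "hp x y" and a: "a \<in> RR x y i"
  interpret H: hyp sc br x y "g x" "g y" using hp_hyp[OF h] .
  have "a \<in> H.Gr i" using RR_Gr[OF h] a by auto
  then show ?thesis using a subspace_0[OF RR_subspace[OF h]] by (auto simp: R_def H.Gr_cp)
qed

lemma R_br:
  assumes h: "hp x y" and a: "a \<in> R x y" and b: "b \<in> R x y"
  shows "br a b \<in> R x y"
proof -
  interpret H: hyp sc br x y "g x" "g y" using hp_hyp[OF h] .
  have "br a b = (\<Sum>i\<in>{-2..2}. \<Sum>j\<in>{-2..2}. br (H.cp i a) (H.cp j b))"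
    using arg_cong2[OF H.cmp_sum[of a] H.cmp_sum[of b], of br]
    by (simp only: br_sum_left) (simp only: br_sum_right)
  moreover have "br (H.cp i a) (H.cp j b) \<in> R x y" for i j
    by (rule RR_R[OF h], rule RR_br[OF h]) (use a b in \<open>auto simp: R_def\<close>)
  ultimately show ?thesis using R_subspace[OF h] by (simp add: subspace_sum)
qed

section \<open>Spreading from \<open>y\<close> to all extremal elements\<close>

lemma R_Exp: "hp x y \<Longrightarrow> c \<in> R x y \<Longrightarrow> m \<in> R x y \<Longrightarrow> Exp c m \<in> R x y"
  unfolding Exp_def
  by (intro subspace_add[OF R_subspace] subspace_scale[OF R_subspace] R_br) auto

text \<open>\<open>Exp h c\<close> is \<open>c + br h c + h\<close>. Under \<open>Exp c\<close> the
  brackets cancel and so do the multiples of \<open>c\<close>, the double bracket contributing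
  \<open>-2 c\<close>.\<close>

lemma Exp_Exp_hyp: "c \<in> X \<Longrightarrow> g c h = 1 \<Longrightarrow> Exp c (Exp h c) = h"
proof -
  assume c: "c \<in> X" and o: "g c h = 1"
  have hc: "br h c = - br c h" by (rule br_swap)
  have "br c (br c h) = c + c" using X_D(1)[OF c, of h] o by (simp add: scale_2)
  then show ?thesis
    using o g_sym[of h c] by (simp add: Exp_def hc br_linear br_self g_bilin X_self[OF c] algebra_simps)
qed

text \<open>The automorphism that carries \<open>c\<close> to the normalised \<open>d\<close> is a
  product of exponentials of elements of the subalgebra, so it preserves
  \<open>R x y\<close>.\<close>

lemma R_P0_hyp:
  assumes h: "hp x y" and c: "c \<in> X" "c \<in> R x y" "P0 c \<subseteq> R x y"
    and d: "d \<in> X" "d \<in> R x y" "g c d \<noteq> 0"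
  shows "P0 d \<subseteq> R x y"
proof -
  define d' where "d' = inverse (g c d) *s d"
  have d': "d' \<in> X" "d' \<in> R x y" "g c d' = 1"
    using d subspace_scale[OF R_subspace[OF h]] by (auto simp: d'_def X_scale g_bilin)
  let ?\<psi> = "\<lambda>m. Exp (- d') (Exp (- c) m)"
  have A: "autom (\<lambda>m. Exp c (Exp d' m)) ?\<psi>" by (rule autom_comp[OF Exp_autom[OF c(1)] Exp_autom[OF d'(1)]])
  have "Exp c (Exp d' c) = d'" by (rule Exp_Exp_hyp[OF c(1) d'(3)])
  then have \<psi>: "?\<psi> d' = c" using A by (metis (no_types, lifting) autom_def)
  have "P0 d' \<subseteq> R x y"
  proof
    fix l assume "l \<in> P0 d'"
    then have "?\<psi> l \<in> P0 (?\<psi> d')" by (rule P0_autom[OF autom_swap[OF A]])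
    then have "?\<psi> l \<in> R x y" using c(3) \<psi> by auto
    then have "Exp c (Exp d' (?\<psi> l)) \<in> R x y" by (rule R_Exp[OF h c(2) R_Exp[OF h d'(2)]])
    then show "l \<in> R x y" using A by (simp add: autom_def)
  qed
  then show ?thesis using P0_scale_point[of "inverse (g c d)" d] d(3) by (simp add: d'_def)
qed

text \<open>The points whose special neighbours all lie in \<open>R x y\<close>. This property is passed on to hyperbolic
  neighbours in \<open>R x y\<close>, because \<open>Exp_Exp_hyp\<close> moves one to the other inside \<open>R x y\<close>.\<close>

definition CR :: "'m \<Rightarrow> 'm \<Rightarrow> 'm set" where
  "CR x y = {c \<in> X. c \<in> R x y \<and> P0 c \<subseteq> R x y \<and> (\<exists>d\<in>X. d \<in> R x y \<and> g c d \<noteq> 0)}"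

lemma CR_hp:
  assumes "hp x y" "c \<in> CR x y"
  obtains d where "hp d c" "d \<in> R x y"
proof -
  obtain d where d: "d \<in> X" "d \<in> R x y" "g c d \<noteq> 0" using assms by (auto simp: CR_def)
  show ?thesis
  proof (rule that[of "inverse (g c d) *s d"])
    show "hp (inverse (g c d) *s d) c"
      using d assms(2) by (auto simp: hp_def X_scale g_bilin CR_def g_sym[of d c])
    show "inverse (g c d) *s d \<in> R x y" by (rule subspace_scale[OF R_subspace[OF assms(1)] d(2)])
  qed
qed

text \<open>\<open>l\<close> is perpendicular to \<open>c\<close>, so \<open>R_P0_hyp\<close> cannot
  pass directly from \<open>c\<close> to \<open>l\<close>. It passes through an extremal
  \<open>b\<close> in \<open>R x y\<close> that is perpendicular to neither.\<close>

lemma CR_special: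
  assumes h: "hp x y" and c: "c \<in> CR x y" and l: "l \<in> P0 c" "l \<noteq> 0"
  shows "l \<in> CR x y"
proof -
  note sub = R_subspace[OF h]
  have cX: "c \<in> X" and cR: "c \<in> R x y" and P: "P0 c \<subseteq> R x y" using c by (auto simp: CR_def)
  obtain d where d: "hp d c" "d \<in> R x y" using CR_hp[OF h c] .
  obtain l1 \<mu> where l1: "l1 \<in> V d c" "l = l1 + \<mu> *s c" "l1 \<noteq> 0" using P0_decomp[OF d(1) l(1)] l(2) by metis
  obtain l' where l': "l' \<in> V d c" "br l1 l' \<noteq> 0" using V_nondegenerate[OF d(1) l1(1,3)] by blast
  define a where "a = br d l'"
  have aV: "a \<in> V c d" unfolding a_def by (rule V_swap[OF d(1) l'(1)])
  have "l' \<in> R x y" using V_P0[OF d(1) l'(1)] P by auto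
  then have aR: "a \<in> R x y" unfolding a_def by (rule R_br[OF h d(2)])
  have "g d (br l1 l') \<noteq> 0" using V_br_V[OF d(1) l1(1) l'(1)] l'(2) by auto
  then have gal: "g a l1 \<noteq> 0"
    using br_swap[of l1 l'] by (simp add: a_def g_assoc g_bilin)
  have gac: "g a c = 0" using V_D(3)[OF hp_sym[OF d(1)] aV] g_sym by simp
  have gdl: "g d l1 = 0" using V_D(3)[OF d(1) l1(1)] .
  \<comment> \<open>\<open>g b l\<close> equals \<open>\<mu> + s * g a l1\<close>, so
    \<open>d\<close> itself serves unless \<open>\<mu> = 0\<close>, in which case \<open>a\<close>
    is added.\<close>
  define s where "s = (if \<mu> = 0 then 1 else 0 :: 'f)"
  define b where "b = 1 *s d + s *s a"
  have bX: "b \<in> X" unfolding b_def by (rule V_line[OF hp_sym[OF d(1)] aV])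
  have bR: "b \<in> R x y" unfolding b_def by (intro subspace_add[OF sub] subspace_scale[OF sub] d aR)
  have gbc: "g c b \<noteq> 0" using d(1) gac by (simp add: b_def g_bilin hp_def g_sym[of c])
  have gbl: "g b l \<noteq> 0" using d(1) gac gal gdl by (simp add: b_def s_def l1(2) g_bilin hp_def)
  have lX: "l \<in> X" by (rule P0_X[OF cX l(1)])
  have lR: "l \<in> R x y" using l(1) P by auto
  have "P0 b \<subseteq> R x y" by (rule R_P0_hyp[OF h cX cR P bX bR gbc])
  then have "P0 l \<subseteq> R x y" using R_P0_hyp[OF h bX bR _ lX lR gbl] by blast
  then show ?thesis using lX lR bX bR gbl g_sym[of l b] by (auto simp: CR_def)
qed

end

context line_lie
begin

lemma CR_hyp:
  assumes h: "hp x y" and c: "c \<in> CR x y" and d: "d \<in> X" "g c d \<noteq> 0"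
  shows "d \<in> CR x y"
proof -
  define d' where "d' = inverse (g c d) *s d"
  have hd: "hp d' c" using c d by (auto simp: hp_def d'_def X_scale g_bilin g_sym[of d c] CR_def)
  obtain l where l: "l \<in> V d' c" "l \<noteq> 0" using V_nonzero[OF hd] .
  have lC: "l \<in> CR x y" by (rule CR_special[OF h c V_P0[OF hd l(1)] l(2)])
  define w where "w = br d' l"
  have wV: "w \<in> V c d'" unfolding w_def by (rule V_swap[OF hd l(1)])
  have w0: "w \<noteq> 0" using V_D(2)[OF hd l(1)] l(2) by (auto simp: w_def)
  have "br l (- d') \<in> P0 l"
    by (rule P0_I) (use hd V_D(3)[OF hd l(1)] g_sym in \<open>auto simp: X_minus hp_def g_bilin\<close>)
  then have "w \<in> P0 l" using br_swap[of d' l] by (simp add: w_def br_linear)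
  then have wC: "w \<in> CR x y" using CR_special[OF h lC _ w0] by simp
  obtain w' where w': "w' \<in> V c d'" "br w w' \<noteq> 0" using V_nondegenerate[OF hp_sym[OF hd] wV w0] .
  have "br w w' \<in> P0 w"
    by (rule P0_I[OF V_D(1)[OF hp_sym[OF hd] w'(1)]])
      (rule g_L1[OF V_D(2)[OF hp_sym[OF hd] wV] V_D(5)[OF hp_sym[OF hd] w'(1)]])
  then have "inverse (g c (br w w')) *s br w w' \<in> P0 w" by (rule P0_scale)
  then have P: "inverse (g c (br w w')) *s g c (br w w') *s d' \<in> P0 w"
    using V_br_V[OF hp_sym[OF hd] wV w'(1)] by simp
  have "g c (br w w') \<noteq> 0" using V_br_V[OF hp_sym[OF hd] wV w'(1)] w'(2) by auto
  then have "d' \<in> P0 w" using P by simp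
  then have "g c d *s d' \<in> P0 w" by (rule P0_scale)
  then have "d \<in> P0 w" using d by (simp add: d'_def)
  moreover have "d \<noteq> 0" using d by (auto simp: g_bilin)
  ultimately show ?thesis by (rule CR_special[OF h wC])
qed

lemma R_UNIV:
  assumes h: "hp x y"
  shows "R x y = UNIV"
proof -
  interpret H: hyp sc br x y "g x" "g y" using hp_hyp[OF h] .
  note sub = R_subspace[OF h]
  have xR: "x \<in> R x y" by (rule RR_R[OF h, of _ "-2"]) (auto simp: RR_def H.Gr_def intro!: image_eqI[of _ _ 1])
  have yR: "y \<in> R x y" by (rule RR_R[OF h, of _ 2]) (auto simp: RR_def H.Gr_def intro!: image_eqI[of _ _ 1])
  have "P0 y \<subseteq> R x y"
  proof
    fix l assume "l \<in> P0 y"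
    then obtain l1 \<mu> where l1: "l1 \<in> V x y" "l = l1 + \<mu> *s y" using P0_decomp[OF h] by metis
    have "l1 \<in> R x y" by (rule RR_R[OF h, of _ 1]) (simp add: RR_def span_base l1)
    then show "l \<in> R x y" unfolding l1(2) by (intro subspace_add[OF sub] subspace_scale[OF sub] yR)
  qed
  then have y: "y \<in> CR x y" using h xR yR g_sym[of y x] by (auto simp: CR_def hp_def)
  have "X - {0} \<subseteq> CR x y - {0}"
  proof (rule X_connected)
    show "CR x y - {0} \<noteq> {}" using y H.y_neq_0 by blast
    show "d \<in> CR x y - {0}" if "c \<in> CR x y - {0}" "d \<in> X" "g c d \<noteq> 0" for c d
      using CR_hyp[OF h _ that(2,3)] that by (auto simp: g_bilin)
    show "l \<in> CR x y - {0}" if "c \<in> CR x y - {0}" "l \<in> P0 c" "l \<noteq> 0" for c l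
      using CR_special[OF h _ that(2,3)] that by auto
  qed (auto simp: CR_def)
  then have "X \<subseteq> R x y" using subspace_0[OF sub] by (auto simp: CR_def)
  then have "span X \<subseteq> R x y" using sub by (rule span_minimal)
  then show ?thesis using span_X by auto
qed

theorem L1_spanned:
  assumes h: "hp x y" and m: "br y (br x m) = - m"
  shows "m \<in> span (V x y)"
proof -
  interpret H: hyp sc br x y "g x" "g y" using hp_hyp[OF h] .
  have "m \<in> H.Gr 1" using m by (simp add: H.Gr_def)
  moreover have "H.cp 1 m \<in> RR x y 1" using R_UNIV[OF h] by (auto simp: R_def)
  ultimately show ?thesis by (simp add: RR_def H.Gr_cp)
qed

end

section \<open>Graded Hasse-Schmidt derivations\<close>

context grad5
begin

text \<open>The components of an automorphism \<open>1 + T 1 + T 2 + ...\<close>, with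
  multiplicativity recorded degree by degree.\<close>

definition HS :: "(nat \<Rightarrow> 'm \<Rightarrow> 'm) \<Rightarrow> bool" where
  "HS T \<longleftrightarrow> (\<forall>d. hom (int d) (T d)) \<and> (\<forall>m. T 0 m = m)
     \<and> (\<forall>d a b. T d (br a b) = (\<Sum>i\<le>d. br (T i a) (T (d - i) b)))"

lemma HS_D:
  assumes "HS T"
  shows "hom (int d) (T d)" "T 0 m = m" "T d (br a b) = (\<Sum>i\<le>d. br (T i a) (T (d - i) b))" "linmap (T d)"
  using assms homD(1)[of "int d" "T d"] by (auto simp: HS_def)

lemma HS_zero: "HS T \<Longrightarrow> d > 4 \<Longrightarrow> T d m = 0"
  using hom_eq_0[of "int d" "T d"] HS_D(1) by simp

lemma HS_comp:
  assumes S: "HS S" and T: "HS T"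
  shows "HS (\<lambda>d m. \<Sum>i\<le>d. S i (T (d - i) m))"
  unfolding HS_def
proof (intro conjI allI)
  fix d m a b
  show "hom (int d) (\<lambda>m. \<Sum>i\<le>d. S i (T (d - i) m))"
  proof (rule hom_sum)
    fix i assume "i \<in> {..d}"
    then have "int i + int (d - i) = int d" by simp
    then show "hom (int d) (\<lambda>m. S i (T (d - i) m))"
      using hom_comp[OF HS_D(1)[OF S, of i] HS_D(1)[OF T, of "d - i"]] by simp
  qed
  show "(\<Sum>i\<le>0. S i (T (0 - i) m)) = m" using HS_D(2)[OF S] HS_D(2)[OF T] by simp
  let ?f = "\<lambda>k j r s. br (S k (T j a)) (S r (T s b))"
  have "(\<Sum>i\<le>d. S i (T (d - i) (br a b))) = (\<Sum>i\<le>d. \<Sum>j\<le>d - i. \<Sum>k\<le>i. ?f k j (i - k) (d - i - j))"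
    by (simp add: HS_D(3)[OF T] linmap_sum[OF HS_D(4)[OF S]] HS_D(3)[OF S])
  also have "\<dots> = (\<Sum>(i, j, k)\<in>Sigma {..d} (\<lambda>i. {..d - i} \<times> {..i}). ?f k j (i - k) (d - i - j))"
    by (simp add: sum.Sigma sum.cartesian_product case_prod_unfold)
  \<comment> \<open>The new index \<open>n\<close> is the total degree falling on \<open>a\<close>,
    of which \<open>k\<close> comes from \<open>S\<close> and \<open>n - k\<close> from
    \<open>T\<close>; \<open>r\<close> is the part of \<open>S\<close> falling on
    \<open>b\<close>.\<close>
  also have "\<dots> = (\<Sum>(n, k, r)\<in>Sigma {..d} (\<lambda>n. {..n} \<times> {..d - n}). ?f k (n - k) r (d - n - r))"
    by (rule sum.reindex_bij_witness[where j = "\<lambda>(i, j, k). (k + j, k, i - k)" and i = "\<lambda>(n, k, r). (k + r, n - k, k)"])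
      (auto simp: algebra_simps)
  also have "\<dots> = (\<Sum>n\<le>d. \<Sum>k\<le>n. \<Sum>r\<le>d - n. ?f k (n - k) r (d - n - r))"
    by (simp add: sum.Sigma sum.cartesian_product case_prod_unfold)
  also have "\<dots> = (\<Sum>n\<le>d. br (\<Sum>k\<le>n. S k (T (n - k) a)) (\<Sum>r\<le>d - n. S r (T (d - n - r) b)))"
    by (simp only: br_sum_left) (simp only: br_sum_right)
  finally show "(\<Sum>i\<le>d. S i (T (d - i) (br a b)))
    = (\<Sum>n\<le>d. br (\<Sum>k\<le>n. S k (T (n - k) a)) (\<Sum>r\<le>d - n. S r (T (d - n - r) b)))" .
qed

lemma HS_id: "HS (\<lambda>d m. if d = 0 then m else 0)"
  unfolding HS_def
proof (intro conjI allI)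
  fix d a b
  show "hom (int d) (\<lambda>m. if d = 0 then m else 0)"
    by (cases "d = 0") (auto simp: hom_def linmap_id linmap_zero)
  have "(\<Sum>i\<le>d. br (if i = 0 then a else 0) (if d - i = 0 then b else 0)) = (\<Sum>i\<le>d. if i = 0 then br a (if d = 0 then b else 0) else 0)"
    by (rule sum.cong) auto
  then show "(if d = 0 then br a b else 0) = (\<Sum>i\<le>d. br (if i = 0 then a else 0) (if d - i = 0 then b else 0))"
    by simp
qed simp

lemma HS_autom:
  assumes T: "HS T"
  defines "\<alpha> \<equiv> \<lambda>m. \<Sum>d\<le>4. T d m"
  shows "linmap \<alpha>" "\<alpha> (br a b) = br (\<alpha> a) (\<alpha> b)" "bij \<alpha>"
proof -
  note T_lin = HS_D(4)[OF T]
  show lin: "linmap \<alpha>" unfolding \<alpha>_def by (intro linmap_sum_fun T_lin)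
  let ?f = "\<lambda>i j. br (T i a) (T j b)"
  \<comment> \<open>Products of components of degree at most 4 reach degree 8; the additional
    components vanish, but they complete the convolution.\<close>
  have "\<alpha> (br a b) = (\<Sum>d\<le>8. T d (br a b))"
    unfolding \<alpha>_def by (rule sum.mono_neutral_left) (auto simp: HS_zero[OF T])
  also have "\<dots> = (\<Sum>d\<le>8. \<Sum>i\<le>d. ?f i (d - i))" by (simp add: HS_D(3)[OF T])
  also have "\<dots> = (\<Sum>(d, i)\<in>Sigma {..8} (\<lambda>d. {..d}). ?f i (d - i))"
    by (simp add: sum.Sigma)
  also have "\<dots> = (\<Sum>(i, j)\<in>{(i, j). i + j \<le> 8}. ?f i j)"
    by (rule sum.reindex_bij_witness[where j = "\<lambda>(d, i). (i, d - i)" and i = "\<lambda>(i, j). (i + j, i)"]) auto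
  also have "\<dots> = (\<Sum>(i, j)\<in>{..4} \<times> {..4}. ?f i j)"
  proof (rule sum.mono_neutral_right)
    have "{(i, j). i + j \<le> (8::nat)} \<subseteq> {..8} \<times> {..8}" by auto
    then show "finite {(i, j). i + j \<le> (8::nat)}" by (rule finite_subset) simp
    have z: "?f i j = 0" if "\<not> (i \<le> 4 \<and> j \<le> 4)" for i j
      using that by (auto simp: not_le HS_zero[OF T])
    show "\<forall>ij\<in>{(i, j). i + j \<le> 8} - {..4} \<times> {..4}. (case ij of (i, j) \<Rightarrow> ?f i j) = 0"
      using z by auto
  qed auto
  also have "\<dots> = br (\<alpha> a) (\<alpha> b)"
    unfolding \<alpha>_def sum.cartesian_product[symmetric] by (simp only: br_sum_left) (simp only: br_sum_right)
  finally show "\<alpha> (br a b) = br (\<alpha> a) (\<alpha> b)" .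
  define N where "N m = (\<Sum>d\<in>{1..4}. T d m)" for m
  have N_lin: "linmap N" unfolding N_def by (intro linmap_sum_fun T_lin)
  note Nl = linmapD[OF N_lin]
  have \<alpha>N: "\<alpha> m = m + N m" for m
  proof -
    have "{..4::nat} = insert 0 {1..4}" by auto
    then show ?thesis by (simp add: \<alpha>_def N_def HS_D(2)[OF T])
  qed
  \<comment> \<open>The filtration by lowest degree: \<open>F (-2)\<close> is everything,
    \<open>F 3\<close> is zero, and \<open>N\<close> raises the index by one. So the fifth power of
    \<open>N\<close> vanishes and the geometric series \<open>M\<close> inverts
    \<open>\<alpha>\<close>.\<close>
  define F where "F j = {m. \<forall>i<j. cmp i m = 0}" for j :: int
  have NF: "N m \<in> F (j + 1)" if m: "m \<in> F j" for m j
    unfolding F_def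
  proof (intro CollectI allI impI)
    fix i assume i: "i < j + 1"
    have "cmp i (T d m) = 0" if "d \<in> {1..4}" for d
    proof -
      have "cmp (i - int d + int d) (T d m) = T d (cmp (i - int d) m)" by (rule hom_cmp[OF HS_D(1)[OF T]])
      then show ?thesis using i that m linmapD(3)[OF T_lin] by (simp add: F_def)
    qed
    then show "cmp i (N m) = 0" by (simp add: N_def linmap_sum[OF cmp_linmap])
  qed
  have N5: "N (N (N (N (N m)))) = 0" for m
  proof -
    have "m \<in> F (- 2)" by (auto simp: F_def cmp_outside)
    then have "N (N (N (N (N m)))) \<in> F (- 2 + 1 + 1 + 1 + 1 + 1)" by (intro NF)
    then have "cmp i (N (N (N (N (N m))))) = 0" for i
      using cmp_outside[of i] by (cases "i < 3") (auto simp: F_def)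
    then show ?thesis using cmp_sum[of "N (N (N (N (N m))))"] by simp
  qed
  define M where "M m = m - N m + N (N m) - N (N (N m)) + N (N (N (N m)))" for m
  have "\<alpha> (M m) = m" "M (\<alpha> m) = m" for m
    using N5 by (simp_all add: \<alpha>N M_def Nl)
  then show "bij \<alpha>" by (metis bijI')
qed

text \<open>\<open>D4\<close> plays the role of half the square of \<open>D\<close>. The remaining
  conditions are in degrees 6 and 8: the first is the assumption \<open>v\<close>, the second holds
  because the product leaves the grading.\<close>

lemma HS_gap2:
  assumes D: "hom 2 D" "\<And>a b. D (br a b) = br (D a) b + br a (D b)"
    and D4: "hom 4 D4" "\<And>a b. D4 (br a b) = br (D4 a) b + br (D a) (D b) + br a (D4 b)"
    and v: "\<And>a b. br (D a) (D4 b) + br (D4 a) (D b) = 0"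
  shows "HS (\<lambda>d m. if d = 0 then m else if d = 2 then D m else if d = 4 then D4 m else 0)"
    (is "HS ?T")
  unfolding HS_def
proof (intro conjI allI)
  fix d a b
  show "hom (int d) (?T d)"
    by (cases "d = 0"; cases "d = 2"; cases "d = 4")
      (use D(1) D4(1) in \<open>auto simp: hom_zero, auto simp: hom_def linmap_id\<close>)
  have D44: "br (D4 a) (D4 b) = 0" for a b
  proof -
    have "br (D4 a) (D4 b) = 0"
    proof (rule bilinear_eqI[of "\<lambda>a b. br (D4 a) (D4 b)" "\<lambda>a b. 0"])
      fix i j a b assume a: "a \<in> gr i" and b: "b \<in> gr j"
      have *: "br (D4 a) (D4 b) \<in> gr (i + 4 + (j + 4))" by (intro gr_br homD(2)[OF D4(1)] a b)
      show "br (D4 a) (D4 b) = 0"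
        using gr_outside[OF _ a] gr_outside[OF _ b] gr_outside[OF _ *] linmapD(3)[OF homD(1)[OF D4(1)]]
        by (cases "i < -2"; cases "j < -2") auto
    qed (auto simp: linmap_def linmapD[OF homD(1)[OF D4(1)]] br_linear)
    then show ?thesis .
  qed
  show "?T d (br a b) = (\<Sum>i\<le>d. br (?T i a) (?T (d - i) b))"
  proof (cases "d \<in> {0, 2, 4, 6, 8}")
    case True
    then show ?thesis
      using D(2) D4(2) v[of a b] D44 by (auto simp: numeral_eq_Suc add.assoc)
  next
    case False
    have "br (?T i a) (?T (d - i) b) = 0" if "i \<le> d" for i
      using False that by auto
    then show ?thesis using False by simp
  qed
qed simp

text \<open>If all products \<open>br (D a) (D b)\<close> vanish, the series \<open>1 + D\<close>
  needs no further terms.\<close>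

lemma HS_gap:
  assumes j: "j \<ge> 1" and D: "hom (int j) D" "\<And>a b. D (br a b) = br (D a) b + br a (D b)"
    and v: "\<And>a b. br (D a) (D b) = 0"
  shows "HS (\<lambda>d m. if d = 0 then m else if d = j then D m else 0)"
    (is "HS ?T")
  unfolding HS_def
proof (intro conjI allI)
  fix d a b
  show "hom (int d) (?T d)"
    by (cases "d = 0"; cases "d = j") (use D(1) j in \<open>auto simp: hom_zero, auto simp: hom_def linmap_id\<close>)
  consider "d = 0" | "d = j" | "d \<noteq> 0" "d \<noteq> j" by blast
  then show "?T d (br a b) = (\<Sum>i\<le>d. br (?T i a) (?T (d - i) b))"
  proof cases
    case 2
    have "(\<Sum>i\<le>d. br (?T i a) (?T (d - i) b)) = (\<Sum>i\<in>{0, j}. br (?T i a) (?T (d - i) b))"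
      using 2 by (intro sum.mono_neutral_right) auto
    then show ?thesis using 2 j D(2) by (auto simp: add.commute)
  next
    case 3
    have "br (?T i a) (?T (d - i) b) = 0" if "i \<le> d" for i
      using 3 that v by auto
    then show ?thesis using 3 by simp
  qed simp
qed simp

text \<open>This is the correction device: composing with an \<open>S\<close> that starts in degree
  \<open>j\<close> leaves lower components alone and adds \<open>S j\<close> to the component of
  degree \<open>j\<close>.\<close>

lemma HS_adjust:
  assumes S: "HS S" and T: "HS T" and gap: "\<And>i m. 0 < i \<Longrightarrow> i < j \<Longrightarrow> S i m = 0" and j: "j \<ge> 1"
  shows "HS (\<lambda>d m. \<Sum>i\<le>d. S i (T (d - i) m))"
    and "d < j \<Longrightarrow> (\<Sum>i\<le>d. S i (T (d - i) m)) = T d m"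
    and "(\<Sum>i\<le>j. S i (T (j - i) m)) = T j m + S j m"
proof -
  show "HS (\<lambda>d m. \<Sum>i\<le>d. S i (T (d - i) m))" by (rule HS_comp[OF S T])
  show "(\<Sum>i\<le>d. S i (T (d - i) m)) = T d m" if "d < j"
  proof -
    have "(\<Sum>i\<le>d. S i (T (d - i) m)) = (\<Sum>i\<in>{0}. S i (T (d - i) m))"
      using gap that by (intro sum.mono_neutral_right) auto
    then show ?thesis by (simp add: HS_D(2)[OF S])
  qed
  have "(\<Sum>i\<le>j. S i (T (j - i) m)) = (\<Sum>i\<in>{0, j}. S i (T (j - i) m))"
    using gap by (intro sum.mono_neutral_right) auto
  then show "(\<Sum>i\<le>j. S i (T (j - i) m)) = T j m + S j m"
    using j by (simp add: HS_D(2)[OF S] HS_D(2)[OF T])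
qed

definition der :: "nat \<Rightarrow> ('m \<Rightarrow> 'm) \<Rightarrow> bool" where
  "der j D \<longleftrightarrow> hom (int j) D \<and> (\<forall>a b. D (br a b) = br (D a) b + br a (D b))"

definition integrable :: "nat \<Rightarrow> ('m \<Rightarrow> 'm) \<Rightarrow> bool" where
  "integrable j D \<longleftrightarrow> (\<exists>S. HS S \<and> (\<forall>i m. 0 < i \<longrightarrow> i < j \<longrightarrow> S i m = 0) \<and> S j = D)"

end

context hyp
begin

lemma Grm2_line: "m \<in> Gr (-2) \<Longrightarrow> m = r m *s x"
  by (auto simp: Gr_def rl r_x)

text \<open>A product of total degree at least 6 only sees the line spanned by \<open>x\<close>.\<close>

lemma hom_br_vanish:
  assumes S: "hom i S" and T: "hom j T" and S': "hom i' S'" and T': "hom j' T'"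
    and ij: "i + j \<ge> 6" "i' + j' \<ge> 6" and x: "br (S x) (T x) + br (S' x) (T' x) = 0"
  shows "br (S a) (T b) + br (S' a) (T' b) = 0"
proof (rule bilinear_eqI[of "\<lambda>a b. br (S a) (T b) + br (S' a) (T' b)" "\<lambda>a b. 0"])
  note L = homD(1)[OF S] homD(1)[OF T] homD(1)[OF S'] homD(1)[OF T']
  note l = linmapD[OF L(1)] linmapD[OF L(2)] linmapD[OF L(3)] linmapD[OF L(4)]
  fix k k' a b assume a: "a \<in> Gr k" and b: "b \<in> Gr k'"
  have 1: "br (S a) (T b) \<in> Gr (k + i + (k' + j))" "br (S' a) (T' b) \<in> Gr (k + i' + (k' + j'))"
    by (intro Gr_br homD(2)[OF S] homD(2)[OF T] homD(2)[OF S'] homD(2)[OF T'] a b)+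
  consider "k < -2" | "k' < -2" | "k = -2" "k' = -2" | "k + k' > -4" by linarith
  then show "br (S a) (T b) + br (S' a) (T' b) = 0"
  proof cases
    case 1 then show ?thesis using gr_outside[OF _ a] l by simp
  next
    case 2 then show ?thesis using gr_outside[OF _ b] l by simp
  next
    case 3
    then have "a = r a *s x" "b = r b *s x" using Grm2_line a b by auto
    then have "br (S a) (T b) + br (S' a) (T' b) = (r a * r b) *s (br (S x) (T x) + br (S' x) (T' x))"
      using l by (metis br_scale_left br_scale_right scale_scale scale_right_distrib)
    then show ?thesis using x by simp
  next
    case 4 then show ?thesis using gr_outside[OF _ 1(1)] gr_outside[OF _ 1(2)] ij by simp
  qed
qed (auto simp: linmap_def linmapD[OF homD(1)[OF S]] linmapD[OF homD(1)[OF T]]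
    linmapD[OF homD(1)[OF S']] linmapD[OF homD(1)[OF T']] br_linear algebra_simps)

text \<open>\<open>br (D a) (D b)\<close> has degree at least 6, so it is decided at
  \<open>a = b = x\<close>, where it is 0.\<close>

lemma der_integrable_ge3:
  assumes D: "der j D" and j: "j \<ge> 3"
  shows "integrable j D"
proof -
  \<comment> \<open>The second product in \<open>hom_br_vanish\<close> is filled with zero maps of
    degree 6.\<close>
  have "br (D a) (D b) + br 0 0 = 0" for a b
    by (rule hom_br_vanish[of "int j" D "int j" D 6 _ 6]) (use D j in \<open>auto simp: der_def hom_zero br_self\<close>)
  then have "HS (\<lambda>d m. if d = 0 then m else if d = j then D m else 0)"
    using D j by (intro HS_gap) (auto simp: der_def)
  then show ?thesis using j unfolding integrable_def
    by (intro exI[of _ "\<lambda>d m. if d = 0 then m else if d = j then D m else 0"]) auto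
qed

text \<open>The condition in degree 6 reduces to \<open>br (D x) (D4 x) + br (D4 x) (D x)\<close>,
  which is 0 by skew symmetry.\<close>

lemma der_integrable_2I:
  assumes D: "der 2 D" and D4: "hom 4 D4" "\<And>a b. D4 (br a b) = br (D4 a) b + br (D a) (D b) + br a (D4 b)"
  shows "integrable 2 D"
proof -
  have D': "hom 2 D" "\<And>a b. D (br a b) = br (D a) b + br a (D b)" using D by (auto simp: der_def)
  have "br (D a) (D4 b) + br (D4 a) (D b) = 0" for a b
    by (rule hom_br_vanish[OF D'(1) D4(1) D4(1) D'(1)]) (use br_swap[of "D x"] in auto)
  then have "HS (\<lambda>d m. if d = 0 then m else if d = 2 then D m else if d = 4 then D4 m else 0)"
    using D' D4 by (intro HS_gap2) auto
  then show ?thesis unfolding integrable_def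
    by (intro exI[of _ "\<lambda>d m. if d = 0 then m else if d = 2 then D m else if d = 4 then D4 m else 0"]) auto
qed

lemma der_integrable_2_odd:
  assumes D: "der 2 D" and two: "(2::'f) \<noteq> 0"
  shows "integrable 2 D"
proof (rule der_integrable_2I[OF D])
  have D': "hom 2 D" "\<And>a b. D (br a b) = br (D a) b + br a (D b)" using D by (auto simp: der_def)
  note l = linmapD[OF homD(1)[OF D'(1)]]
  have h: "hom 4 (\<lambda>m. D (D m))" using hom_comp[OF D'(1) D'(1)] by simp
  then show "hom 4 (\<lambda>m. inverse 2 *s D (D m))"
    by (auto simp: hom_def linmap_scale intro: gr_scale)
  fix a b
  have "D (D (br a b)) = br (D (D a)) b + 2 *s br (D a) (D b) + br a (D (D b))"
    by (simp add: D'(2) l scale_2 add_ac)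
  then show "inverse 2 *s D (D (br a b))
    = br (inverse 2 *s D (D a)) b + br (D a) (D b) + br a (inverse 2 *s D (D b))"
    using two by (simp add: scale_right_distrib br_linear)
qed

end

section \<open>Derivations of degree 2 in characteristic 2\<close>

context line_lie
begin

lemma two_rules:
  assumes "(2::'f) = 0"
  shows "- a = (a::'m)" "a - b = a + (b::'m)" "a + a = (0::'m)" "a + (a + b) = (b::'m)"
proof -
  show 1: "a + a = 0" for a :: 'm using scale_2(1)[of a] assms by simp
  then show 2: "- a = a" for a :: 'm by (simp add: minus_unique)
  show "a - b = a + b" using 2[of b] by (metis diff_conv_add_uminus)
  show "a + (a + b) = b" using 1 by (simp add: add.assoc[symmetric])
qed

text \<open>In characteristic 2 a derivation \<open>D\<close> of degree 2 need not be a multiple of \<open>br y\<close>, but the square of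
  \<open>br (D x)\<close> is a scalar on \<open>L\<^sub>1\<close>; this is what makes \<open>D\<close> integrable.\<close>

lemma der2_square:
  assumes h: "hp x y" and two: "(2::'f) = 0" and D: "grad5.der sc br (hyp.cp sc br x y (g x) (g y)) 2 D"
  obtains \<tau> where "br (D x) x = 0" "br y (D x) = 0" "\<And>w. br y (br x w) = - w \<Longrightarrow> br (D x) (br (D x) w) = \<tau> *s w"
proof -
  interpret H: hyp sc br x y "g x" "g y" using hp_hyp[OF h] .
  note c2 = two_rules[OF two]
  have Dh: "H.hom 2 D" and Db: "D (br a b) = br (D a) b + br a (D b)" for a b
    using D by (auto simp: H.der_def)
  note Dl = linmapD[OF H.homD(1)[OF Dh]]
  have X2: "br c (br c u) = 0" if "c \<in> X" for c u using X_D(1)[OF that, of u] two by simp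
  have xX: "x \<in> X" using h by (simp add: hp_def)
  have L1: "w \<in> H.Gr 1" if "br y (br x w) = - w" for w using that by (simp add: H.Gr_def)
  have D1: "D w = 0" if "w \<in> H.Gr 1" for w
    using H.gr_outside[OF _ H.homD(2)[OF Dh that]] by simp
  define z where "z = D x"
  have xG: "x \<in> H.Gr (-2)" by (auto simp: H.Gr_def intro!: image_eqI[of _ _ 1])
  have zG: "z \<in> H.Gr 0" using H.homD(2)[OF Dh xG] by (simp add: z_def)
  \<comment> \<open>Applying \<open>D\<close> to \<open>br x (br x m) = 0\<close> gives a relation
    which, in characteristic 2, says that \<open>br z x\<close> is central.\<close>
  have "br (br z x) m = 0" for m
  proof -
    have "D (br x (br x m)) = 0" using X2[OF xX] by (simp add: Dl)
    then have "br z (br x m) + br x (br z m) = 0"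
      using X2[OF xX, of "D m"] by (simp add: Db br_linear z_def add.assoc)
    then show ?thesis using jacobi[of z x m] by (simp add: c2 add_ac)
  qed
  then have zx: "br z x = 0" by (rule centre_trivial)
  then have xz: "br x z = 0" using br_swap[of x z] by simp
  obtain \<beta> where \<beta>: "br y z = \<beta> *s y" using zG by (auto simp: H.Gr_def)
  have "\<beta> = - 0" using H.Gr0_facts(3)[of z 0, OF _ \<beta>] xz by simp
  then have yz: "br y z = 0" using \<beta> by simp
  then have zy: "br z y = 0" using br_swap[of z y] by simp
  \<comment> \<open>The alternating form on degree 1 given by the bracket with values in the line of
    \<open>y\<close>. As \<open>br z\<close> kills \<open>y\<close>, it is self-adjoint for
    \<open>f\<close>, signs being irrelevant.\<close>
  define f where "f u w = g x (br u w)" for u w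
  have f: "br u w = f u w *s y" if "u \<in> H.Gr 1" "w \<in> H.Gr 1" for u w
  proof -
    have "br u w \<in> H.Gr (1 + 1)" using H.Gr_br[OF that] .
    then show ?thesis by (auto simp: H.Gr_def H.pl H.p_y f_def)
  qed
  have f_self: "f u u = 0" for u by (simp add: f_def br_self g_bilin)
  have zG1: "br z w \<in> H.Gr 1" if "w \<in> H.Gr 1" for w using H.Gr_br[OF zG that] by simp
  have fz: "f (br z u) w = f u (br z w)" if "u \<in> H.Gr 1" "w \<in> H.Gr 1" for u w
  proof -
    have "br (br z u) w + br u (br z w) = 0"
      using jacobi[of z u w] f[OF that] zy by (simp add: br_linear)
    then have "(f (br z u) w + f u (br z w)) *s y = 0"
      using f[OF zG1[OF that(1)] that(2)] f[OF that(1) zG1[OF that(2)]] by (simp add: scale_left_distrib)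
    then have "f (br z u) w + f u (br z w) = 0" using H.y_neq_0 by simp
    then have "f (br z u) w = - f u (br z w)" by (simp only: eq_neg_iff_add_eq_0)
    moreover have "f u (br z w) + f u (br z w) = 0" using two mult_2[of "f u (br z w)"] by simp
    ultimately show ?thesis by (metis minus_unique)
  qed
  have xw: "br y (br x w) = w" if "w \<in> H.Gr 1" for w using H.Gr1_D[OF that] by (simp add: c2)
  \<comment> \<open>This comes from applying \<open>D\<close> to the third extremal identity for
    \<open>x\<close>, in which only the term \<open>f u w *s x\<close> survives.\<close>
  have zO: "br z (br u (br x w)) = f u w *s z + f u (br z w) *s br x y"
    if u: "u \<in> H.Gr 1" and w: "w \<in> H.Gr 1" for u w
  proof -
    have p: "g x u = 0" "g x w = 0"
      using H.Gr1_facts(1)[OF H.Gr1_D[OF u]] H.Gr1_facts(1)[OF H.Gr1_D[OF w]] by auto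
    have "br x (br u (br x w)) = f u w *s x" using X_D(3)[OF xX, of u w] p by (simp add: f_def)
    from arg_cong[OF this, of D]
    have "br z (br u (br x w)) + br x (br u (br z w)) = f u w *s z"
      by (simp add: Db Dl D1[OF u] D1[OF w] z_def)
    moreover have "br x (br u (br z w)) = f u (br z w) *s br x y" using f[OF u zG1[OF w]] by (simp add: br_linear)
    ultimately show ?thesis by (metis c2(2) eq_diff_eq)
  qed
  have e1: "br (br x y) w = w" if "w \<in> H.Gr 1" for w using H.e_Gr[OF that] by simp
  have A: "br (br u (br x w)) (br z p) = br z (br (br u (br x w)) p) + f u w *s br z p + f u (br z w) *s p"
    if u: "u \<in> H.Gr 1" and w: "w \<in> H.Gr 1" and p: "p \<in> H.Gr 1" for u w p
    using jacobi[of z "br u (br x w)" p]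
    by (simp add: zO[OF u w] br_linear e1[OF p]) (simp add: c2 add_ac)
  define T where "T w = br z (br z w)" for w
  have TG: "T w \<in> H.Gr 1" if "w \<in> H.Gr 1" for w using zG1 that by (simp add: T_def)
  \<comment> \<open>Under a second application of \<open>A\<close> every correction term occurs
    twice and cancels, so the square of \<open>br z\<close> commutes with these operators.\<close>
  have TO: "br (br u (br x w)) (T p) = T (br (br u (br x w)) p)"
    if u: "u \<in> H.Gr 1" and w: "w \<in> H.Gr 1" and p: "p \<in> H.Gr 1" for u w p
    using A[OF u w zG1[OF p]] A[OF u w p] unfolding T_def by (simp add: br_linear c2 add_ac)
  have fT: "f (T u) w = f u (T w)" if "u \<in> H.Gr 1" "w \<in> H.Gr 1" for u w
    using fz[OF zG1[OF that(1)] that(2)] fz[OF that(1) zG1[OF that(2)]] by (simp add: T_def)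
  \<comment> \<open>For extremal \<open>u\<close> the square of \<open>br u\<close> vanishes in
    characteristic 2. Squaring a sum adds only \<open>br (br u s)\<close>, a multiple of
    \<open>br y\<close>, and extremal elements span degree 1.\<close>
  have sq: "\<exists>\<mu>. \<forall>m. br s (br s m) = \<mu> *s br y m" if s: "s \<in> H.Gr 1" for s
  proof -
    have "s \<in> span (V x y)" by (rule L1_spanned[OF h H.Gr1_D[OF s]])
    then have "s \<in> H.Gr 1 \<and> (\<exists>\<mu>. \<forall>m. br s (br s m) = \<mu> *s br y m)"
    proof (induction rule: span_induct_alt)
      case base
      then show ?case by (auto intro: exI[of _ 0])
    next
      case (step k v s)
      then obtain \<mu> where \<mu>: "br s (br s m) = \<mu> *s br y m" for m by blast
      define u where "u = k *s v"
      have u: "u \<in> X" "u \<in> H.Gr 1" using V_D(1,8)[OF h V_scale[OF step(1), of k]] by (auto simp: u_def)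
      have "br (u + s) (br (u + s) m) = (\<mu> + f u s) *s br y m" for m
      proof -
        have "br (u + s) (br (u + s) m)
          = br u (br u m) + \<mu> *s br y m + (br u (br s m) + br s (br u m))"
          unfolding br_add_left br_add_right \<mu> by (simp add: add_ac)
        also have "br u (br s m) + br s (br u m) = br (br u s) m"
          using jacobi[of u s m] by (simp add: c2 add_ac)
        also have "\<dots> = f u s *s br y m"
          using f[OF u(2), of s] step(2) by (simp add: br_linear)
        finally show ?thesis
          using X2[OF u(1)] by (simp add: scale_left_distrib)
      qed
      then have "(\<exists>\<mu>. \<forall>m. br (u + s) (br (u + s) m) = \<mu> *s br y m)" by blast
      then show ?case using u step(2) unfolding u_def by (auto intro: H.gr_add)
    qed
    then show ?thesis by blast
  qed
  \<comment> \<open>The square of \<open>br (br z l)\<close> on \<open>br x w\<close> is computed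
    twice, by \<open>sq\<close> and by \<open>A\<close>. The case \<open>w = l\<close> shows that
    the scalar from \<open>sq\<close> is 0, and \<open>w = p\<close> then makes \<open>l\<close> an
    eigenvector.\<close>
  have eig: "\<exists>\<tau>. T l = \<tau> *s l" if l: "l \<in> V x y" and p: "p \<in> H.Gr 1" "f l p \<noteq> 0" for l p
  proof -
    note lX = V_D(1)[OF h l] and lG = V_D(8)[OF h l]
    have Ol: "br (br l (br x w)) l = 0" for w
      using X2[OF lX, of "br x w"] br_swap[of "br l (br x w)" l] by simp
    have key: "br (br (br z l) (br x w)) (br z l) = f l w *s T l + f l (T w) *s l" if w: "w \<in> H.Gr 1" for w
    proof -
      have "br z (br x w) = br x (br z w)" using jacobi[of z x w] zx by simp
      then have "br z (br l (br x w)) = br (br z l) (br x w) + br l (br x (br z w))"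
        using jacobi[of z l "br x w"] by simp
      then have "br (br z l) (br x w) = f l w *s z + f l (br z w) *s br x y + br l (br x (br z w))"
        using zO[OF lG w] by (metis c2(2) eq_diff_eq)
      then have "br (br (br z l) (br x w)) (br z l)
        = f l w *s T l + f l (br z w) *s br z l + br (br l (br x (br z w))) (br z l)"
        using e1[OF zG1[OF lG]] by (simp add: br_linear T_def)
      also have "br (br l (br x (br z w))) (br z l) = f l (br z w) *s br z l + f l (T w) *s l"
        using A[OF lG zG1[OF w] lG] Ol by (simp add: T_def)
      finally show ?thesis by (simp add: c2 add_ac)
    qed
    obtain \<mu> where \<mu>: "br (br z l) (br (br z l) m) = \<mu> *s br y m" for m using sq[OF zG1[OF lG]] by blast
    have eq: "\<mu> *s w = f l w *s T l + f l (T w) *s l" if w: "w \<in> H.Gr 1" for w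
      using key[OF w] \<mu>[of "br x w"] xw[OF w] br_swap[of "br (br z l) (br x w)" "br z l"] by (simp add: c2)
    have "f l (T l) = 0" using fz[OF lG zG1[OF lG]] f_self by (simp add: T_def)
    then have "\<mu> *s l = 0" using eq[OF lG] f_self by simp
    moreover have "l \<noteq> 0" using p(2) by (auto simp: f_def g_bilin)
    ultimately have "f l p *s T l + f l (T p) *s l = 0" using eq[OF p(1)] by simp
    then have "f l p *s T l = f l (T p) *s l" by (metis c2(2) right_minus_eq)
    then have "inverse (f l p) *s f l p *s T l = inverse (f l p) *s f l (T p) *s l" by simp
    then show ?thesis using p(2) by auto
  qed
  obtain l where l: "l \<in> V x y" "l \<noteq> 0" using V_nonzero[OF h] .
  obtain p where p: "p \<in> V x y" "br l p \<noteq> 0" using V_nondegenerate[OF h l] .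
  note lG = V_D(8)[OF h l(1)] and pG = V_D(8)[OF h p(1)]
  have flp: "f l p \<noteq> 0" using p(2) f[OF lG pG] by auto
  then have "f p l \<noteq> 0" using br_swap[of p l] by (simp add: f_def g_bilin)
  then obtain \<tau> \<tau>' where \<tau>: "T l = \<tau> *s l" and \<tau>': "T p = \<tau>' *s p"
    using eig[OF l(1) pG flp] eig[OF p(1) lG] by blast
  \<comment> \<open>Self-adjointness of \<open>T\<close> forces equal eigenvalues on two
    eigenvectors that are not \<open>f\<close>-orthogonal.\<close>
  have "\<tau> * f l p = \<tau>' * f l p" using fT[OF lG pG] \<tau> \<tau>' by (simp add: f_def br_linear g_bilin)
  then have \<tau>p: "T p = \<tau> *s p" using \<tau>' flp by simp
  \<comment> \<open>By the Jacobi identity \<open>f l p *s w\<close> is a combination of images of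
    \<open>l\<close> and \<open>p\<close> under operators that commute with
    \<open>T\<close>.\<close>
  have Tw: "T w = \<tau> *s w" if w: "w \<in> H.Gr 1" for w
  proof -
    have "br y (br x w) = w" by (rule xw[OF w])
    then have "br (br p (br x w)) l = br (br l (br x w)) p + f l p *s w"
      using jacobi[of l "br x w" p] br_swap[of p "br x w"] br_swap[of "br (br x w) p" l]
        br_swap[of "br x w" y] f[OF lG pG]
      by (simp add: br_linear c2)
    moreover have "T (br (br p (br x w)) l) = \<tau> *s br (br p (br x w)) l"
      using TO[OF pG w lG] \<tau> by (simp add: br_linear)
    moreover have "T (br (br l (br x w)) p) = \<tau> *s br (br l (br x w)) p"
      using TO[OF lG w pG] \<tau>p by (simp add: br_linear)
    ultimately have "T (f l p *s w) = \<tau> *s f l p *s w"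
      by (simp add: T_def br_linear scale_right_distrib)
    then have "f l p *s T w = f l p *s \<tau> *s w" by (simp add: T_def br_linear mult.commute)
    then show ?thesis using flp by (metis scale_left_imp_eq)
  qed
  show ?thesis
    by (rule that[of \<tau>]) (use zx yz Tw L1 in \<open>auto simp: z_def T_def\<close>)
qed

lemma der_integrable_2_even:
  assumes h: "hp x y" and two: "(2::'f) = 0" and D: "grad5.der sc br (hyp.cp sc br x y (g x) (g y)) 2 D"
  shows "grad5.integrable sc br (hyp.cp sc br x y (g x) (g y)) 2 D"
proof -
  interpret H: hyp sc br x y "g x" "g y" using hp_hyp[OF h] .
  note c2 = two_rules[OF two]
  have Dh: "H.hom 2 D" and Db: "D (br a b) = br (D a) b + br a (D b)" for a b
    using D by (auto simp: H.der_def)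
  note Dl = linmapD[OF H.homD(1)[OF Dh]]
  obtain \<tau> where \<tau>: "br (D x) x = 0" "br y (D x) = 0"
    "\<And>w. br y (br x w) = - w \<Longrightarrow> br (D x) (br (D x) w) = \<tau> *s w" using der2_square[OF h two D] by blast
  define z where "z = D x"
  have zz: "br z (br z w) = \<tau> *s w" if "w \<in> H.Gr 1" for w
    using \<tau>(3)[OF H.Gr1_D[OF that]] by (simp add: z_def)
  have zy: "br z y = 0" using \<tau>(2) br_swap[of z y] by (simp add: z_def)
  have D1: "D w = 0" if "w \<in> H.Gr 1" for w
    using H.gr_outside[OF _ H.homD(2)[OF Dh that]] by simp
  have Dm1: "\<exists>l\<in>H.Gr 1. a = br x l \<and> l = br y a \<and> D a = br z l" if a: "a \<in> H.Gr (-1)" for a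
  proof -
    have l: "br y a \<in> H.Gr 1" using H.Gr_y_m1[OF a] .
    have "a = br x (br y a)" using H.Grm1_D[OF a] by (simp add: c2)
    moreover have "D (br x (br y a)) = br z (br y a)" by (subst Db) (simp add: D1[OF l] z_def)
    ultimately show ?thesis using l by metis
  qed
  have yG: "y \<in> H.Gr 2" by (auto simp: H.Gr_def intro!: image_eqI[of _ _ 1])
  have gy: "g y m = 0" if "m \<in> H.Gr i" "i \<noteq> -2" for m i
  proof -
    have "H.cp (-2) m = 0" using H.Gr_cp[OF that(1), of "-2"] that(2) by simp
    then show ?thesis using H.x_neq_0 by (simp add: H.cp_def)
  qed
  \<comment> \<open>A map of degree 4 lives on the line of \<open>x\<close>. Its value
    \<open>\<tau> *s y\<close> there is dictated by the product rule for \<open>x\<close> and an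
    element of degree -1, which is why the square of \<open>br z\<close> has to be a scalar.\<close>
  define D4 where "D4 m = (\<tau> * g y m) *s y" for m
  have lin4: "linmap D4" by (simp add: linmap_def D4_def g_bilin algebra_simps)
  note l4 = linmapD[OF lin4]
  have D4x: "D4 x = \<tau> *s y" by (simp add: D4_def H.r_x)
  have h4: "H.hom 4 D4"
    unfolding H.hom_def
  proof (intro conjI allI ballI lin4)
    fix i m assume "m \<in> H.Gr i"
    then show "D4 m \<in> H.Gr (i + 4)"
      using gy[of m i] H.gr_scale[OF yG] by (cases "i = -2") (auto simp: D4_def)
  qed
  have D40: "D4 m = 0" if "m \<in> H.Gr i" "i \<noteq> -2" for m i using gy[OF that] by (simp add: D4_def)
  let ?P = "\<lambda>a b. D4 (br a b) = br (D4 a) b + br (D a) (D b) + br a (D4 b)"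
  have sym: "?P a b \<Longrightarrow> ?P b a" for a b
    using br_swap[of b a] br_swap[of "D4 b" a] br_swap[of "D b" "D a"] br_swap[of b "D4 a"]
    by (simp add: l4 c2 add_ac)
  have 22: "?P a b" if a: "a \<in> H.Gr (-2)" and b: "b \<in> H.Gr (-2)" for a b
  proof -
    obtain s t where st: "a = s *s x" "b = t *s x" using H.Grm2_line a b by blast
    show ?thesis unfolding st
      by (simp add: l4 Dl br_linear br_self D4x H.yx c2) (simp add: mult_ac c2)
  qed
  have 21: "?P a b" if a: "a \<in> H.Gr (-2)" and b: "b \<in> H.Gr (-1)" for a b
  proof -
    obtain s where s: "a = s *s x" using H.Grm2_line a by blast
    obtain l where l: "l \<in> H.Gr 1" "b = br x l" "l = br y b" "D b = br z l" using Dm1[OF b] by blast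
    have "br x b = 0" using H.Grm1_facts(5)[OF H.Grm1_D[OF b]] .
    then show ?thesis
      using l(3)[symmetric] zz[OF l(1)] D40[OF b] unfolding s
      by (simp add: l4 Dl br_linear D4x l(4) z_def[symmetric]) (simp add: c2 mult_ac)
  qed
  have 20: "?P a b" if a: "a \<in> H.Gr (-2)" and b: "b \<in> H.Gr 0" for a b
  proof -
    obtain s where s: "a = s *s x" using H.Grm2_line a by blast
    obtain \<kappa> \<nu> where L: "br x b = \<kappa> *s x" "br y b = \<nu> *s y" using b by (auto simp: H.Gr_def)
    have "\<nu> = - \<kappa>" using H.Gr0_facts(3)[OF L] .
    then have yb: "br y b = \<kappa> *s y" using L by (simp add: c2)
    have "D b \<in> H.Gr 2" using H.homD(2)[OF Dh b] by simp
    then obtain t where t: "D b = t *s y" by (auto simp: H.Gr_def)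
    show ?thesis
      using D40[OF b] zy unfolding s
      by (simp add: l4 Dl br_linear L(1) yb D4x t z_def[symmetric] mult_ac)
  qed
  have 11: "?P a b" if a: "a \<in> H.Gr (-1)" and b: "b \<in> H.Gr (-1)" for a b
  proof -
    obtain l where l: "l \<in> H.Gr 1" "a = br x l" "D a = br z l" using Dm1[OF a] by blast
    obtain k where k: "k \<in> H.Gr 1" "b = br x k" "D b = br z k" using Dm1[OF b] by blast
    have g0: "g x l = 0" "g x k = 0"
      using H.Gr1_facts(1)[OF H.Gr1_D[OF l(1)]] H.Gr1_facts(1)[OF H.Gr1_D[OF k(1)]] by auto
    have "br l k \<in> H.Gr (1 + 1)" by (rule H.Gr_br[OF l(1) k(1)])
    then have lk: "br l k = g x (br l k) *s y" by (auto simp: H.Gr_def H.pl H.p_y)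
    have xX: "x \<in> X" using h by (simp add: hp_def)
    have ab: "br a b = g x (br l k) *s x" using X_D(2)[OF xX, of l k] g0 l(2) k(2) by simp
    have zG: "br z w \<in> H.Gr 1" if "w \<in> H.Gr 1" for w
    proof -
      have "D x \<in> H.Gr (-2 + 2)"
        by (rule H.homD(2)[OF Dh]) (auto simp: H.Gr_def intro!: image_eqI[of _ _ 1])
      then show ?thesis using H.Gr_br[of z 0 w 1] that by (simp add: z_def)
    qed
    have "br l (br z k) \<in> H.Gr (1 + 1)" by (rule H.Gr_br[OF l(1) zG[OF k(1)]])
    then obtain t where "br l (br z k) = t *s y" by (auto simp: H.Gr_def)
    then have "br z (br l (br z k)) = 0" using zy by (simp add: br_linear)
    then have "br (br z l) (br z k) + \<tau> *s br l k = 0"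
      using jacobi[of z l "br z k"] zz[OF k(1)] by (simp add: br_linear)
    then have "br (br z l) (br z k) = \<tau> *s br l k" by (metis c2(2) right_minus_eq)
    then have "br (D a) (D b) = (\<tau> * g x (br l k)) *s y" using l(3) k(3) lk by (metis scale_scale)
    then show ?thesis using D40[OF a] D40[OF b] ab by (simp add: l4 D4x mult_ac)
  qed
  have P: "?P a b" for a b
  proof (rule H.bilinear_eqI[of "\<lambda>a b. D4 (br a b)"])
    fix i j a b assume a: "a \<in> H.Gr i" and b: "b \<in> H.Gr j"
    have G: "D4 (br a b) \<in> H.Gr (i + j + 4)" "br (D4 a) b \<in> H.Gr (i + 4 + j)"
      "br (D a) (D b) \<in> H.Gr (i + 2 + (j + 2))" "br a (D4 b) \<in> H.Gr (i + (j + 4))"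
      by (intro H.homD(2)[OF h4] H.homD(2)[OF Dh] H.Gr_br a b)+
    have i0: "a = 0" if "i < -2" using H.gr_outside[OF _ a] that by simp
    have j0: "b = 0" if "j < -2" using H.gr_outside[OF _ b] that by simp
    have z0: "?P a b" if "a = 0 \<or> b = 0" using that by (auto simp: l4 Dl)
    \<comment> \<open>If \<open>i + j > -2\<close>, all four terms have degree above 2 and vanish,
      so only a few low degrees remain.\<close>
    consider "i < -2" | "j < -2" | "i = -2" "j = -2" | "i = -2" "j = -1" | "i = -1" "j = -2" | "i = -2" "j = 0"
      | "i = 0" "j = -2" | "i = -1" "j = -1" | "i + j > -2" by linarith
    then show "?P a b"
    proof cases
      case 9
      then show ?thesis using H.gr_outside[OF _ G(1)] H.gr_outside[OF _ G(2)] H.gr_outside[OF _ G(3)]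
          H.gr_outside[OF _ G(4)] by simp
    qed (use a b i0 j0 z0 22 21 20 11 sym in blast)+
  qed (auto simp: linmap_def l4 Dl br_linear scale_right_distrib algebra_simps)
  show ?thesis by (rule H.der_integrable_2I[OF D h4 P])
qed

lemma der_integrable:
  assumes "hp x y" "j \<ge> 2" "grad5.der sc br (hyp.cp sc br x y (g x) (g y)) j D"
  shows "grad5.integrable sc br (hyp.cp sc br x y (g x) (g y)) j D"
proof -
  interpret H: hyp sc br x y "g x" "g y" using hp_hyp[OF assms(1)] .
  consider "j = 2" "(2::'f) = 0" | "j = 2" "(2::'f) \<noteq> 0" | "j \<ge> 3" using assms(2) by linarith
  then show ?thesis
    using der_integrable_2_even[OF assms(1)] H.der_integrable_2_odd H.der_integrable_ge3 assms(3)
    by cases auto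
qed

text \<open>For extremal \<open>l\<close> the components of \<open>Exp l\<close> will do; in
  general, \<open>L1_spanned\<close> and composition apply, since composing adds the components of
  degree 1.\<close>

lemma HS_exists:
  assumes h: "hp x y" and l: "br y (br x l) = - l"
  shows "\<exists>T. grad5.HS sc br (hyp.cp sc br x y (g x) (g y)) T \<and> (\<forall>m. T 1 m = br l m)"
proof -
  interpret H: hyp sc br x y "g x" "g y" using hp_hyp[OF h] .
  have V: "\<exists>T. H.HS T \<and> (\<forall>m. T 1 m = br l m)" if lV: "l \<in> V x y" for l
  proof -
    note lX = V_D(1)[OF h lV] and lG = V_D(8)[OF h lV]
    define T where "T d m = (if d = 0 then m else if d = 1 then br l m else if d = 2 then g l m *s l else 0)"
      for d :: nat and m
    have "H.hom 2 (\<lambda>m. g l m *s l)"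
      unfolding H.hom_def
    proof (intro conjI allI ballI)
      show "linmap (\<lambda>m. g l m *s l)" by (rule linmap_linfun[OF g_linfun])
      fix i m assume m: "m \<in> H.Gr i"
      have w: "g y (br x l) = 0" using V_D(3)[OF hp_sym[OF h] V_swap[OF h lV]] .
      have "g l m = - g (br y (br x l)) m" using V_D(2)[OF h lV] by (simp add: g_bilin)
      then have glm: "g l m = g (br x l) (br y m)" by (simp add: g_skew)
      have "g l m = 0" if ne: "i \<noteq> -1"
      proof -
        consider "i < -2" | "i = -2" | "i = 0" | "i = 1" | "i = 2" | "i > 2" using ne by linarith
        then show ?thesis
        proof cases
          case 2
          then obtain s where "m = s *s x" using m by (auto simp: H.Gr_def)
          then show ?thesis using V_D(3)[OF h lV] g_sym[of l x] by (simp add: g_bilin)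
        next
          case 3
          then obtain s where "br y m = s *s y" using m by (auto simp: H.Gr_def)
          then show ?thesis using glm w g_sym[of "br x l" y] by (simp add: g_bilin)
        next
          case 4
          then show ?thesis using glm H.Gr1_facts(4)[OF H.Gr1_D] m by (simp add: g_bilin)
        next
          case 5
          then obtain s where "m = s *s y" using m by (auto simp: H.Gr_def)
          then show ?thesis using V_D(4)[OF h lV] g_sym[of l y] by (simp add: g_bilin)
        qed (use H.gr_outside[OF _ m] in \<open>auto simp: g_bilin\<close>)
      qed
      then show "g l m *s l \<in> H.Gr (i + 2)" using H.gr_scale[OF lG] by (cases "i = -1") auto
    qed
    then have hom: "H.hom (int d) (T d)" for d
      using H.hom_br[OF lG] unfolding T_def
      by (cases "d = 0"; cases "d = 1"; cases "d = 2") (auto simp: H.hom_zero, auto simp: H.hom_def linmap_id)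
    have "T d (br a b) = (\<Sum>i\<le>d. br (T i a) (T (d - i) b))" for d a b
    proof (cases "d \<in> {0, 1, 2, 3, 4}")
      case True
      have "br (br l a) l = - (2 * g l a) *s l" using X_D(1)[OF lX, of a] br_swap[of "br l a" l] by simp
      then show ?thesis
        using True jacobi[of l a b] X_D(1)[OF lX, of b] X_D(2)[OF lX, of a b] br_swap[of a l]
        by (auto simp: T_def numeral_eq_Suc br_linear br_self mult.commute algebra_simps)
    next
      case False
      have "br (T i a) (T (d - i) b) = 0" if "i \<le> d" for i
        using False that by (auto simp: T_def)
      then show ?thesis using False by (simp add: T_def)
    qed
    then have "H.HS T" using hom by (auto simp: H.HS_def T_def)
    then show ?thesis by (intro exI[of _ T]) (auto simp: T_def)
  qed
  have "l \<in> span (V x y)" by (rule L1_spanned[OF h l])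
  then show ?thesis
  proof (induction rule: span_induct_alt)
    case base
    show ?case by (rule exI[of _ "\<lambda>d m. if d = 0 then m else 0"]) (auto simp: H.HS_id)
  next
    case (step c v l)
    obtain S where S: "H.HS S" "\<And>m. S 1 m = br (c *s v) m" using V[OF V_scale[OF step(1)]] by blast
    obtain T where T: "H.HS T" "\<And>m. T 1 m = br l m" using step(2) by blast
    have "(\<Sum>i\<le>1. S i (T (1 - i) m)) = br (c *s v + l) m" for m
      using S(2) T(2) H.HS_D(2)[OF S(1)] H.HS_D(2)[OF T(1)] by (simp add: br_linear add.commute)
    then show ?case using H.HS_comp[OF S(1) T(1)] by blast
  qed
qed

end

section \<open>Descent along a field extension\<close>

locale scalar_ext = L: lie_alg sc br + M: lie_alg scK brK
  for sc :: "'k::field \<Rightarrow> 'a::ab_group_add \<Rightarrow> 'a" and br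
    and scK :: "'K::field \<Rightarrow> 'b::ab_group_add \<Rightarrow> 'b" and brK +
  fixes e :: "'k \<Rightarrow> 'K" and \<iota> :: "'a \<Rightarrow> 'b"
  assumes ext: "scalar_extension e sc br scK brK \<iota>"
begin

lemma e_add: "e (a + b) = e a + e b" and e_mult: "e (a * b) = e a * e b" and e_1: "e 1 = 1"
  using ext by (auto simp: scalar_extension_def field_embedding_def)

lemma e_0: "e 0 = 0" using e_add[of 0 0] by (metis add_0 add_cancel_right_right)

lemma e_minus: "e (- a) = - e a"
  using e_add[of a "- a"] e_0 by (simp add: eq_neg_iff_add_eq_0 add.commute)

lemma e_inj: "e a = e b \<Longrightarrow> a = b"
proof (rule ccontr)
  assume ab: "e a = e b" "a \<noteq> b"
  have "e (a - b) = 0" using e_add[of a "- b"] e_minus[of b] ab(1) by simp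
  then have "e ((a - b) * inverse (a - b)) = 0" by (simp add: e_mult)
  then show False using ab(2) e_1 by simp
qed

lemma \<iota>_add: "\<iota> (a + b) = \<iota> a + \<iota> b" and \<iota>_scale: "\<iota> (sc c a) = scK (e c) (\<iota> a)"
  and \<iota>_br: "\<iota> (br a b) = brK (\<iota> a) (\<iota> b)"
  using ext by (auto simp: scalar_extension_def)

lemma \<iota>_0: "\<iota> 0 = 0" using \<iota>_add[of 0 0] by simp

lemma \<iota>_minus: "\<iota> (- a) = - \<iota> a"
  using \<iota>_add[of a "- a"] \<iota>_0 by (simp add: eq_neg_iff_add_eq_0 add.commute)

lemma \<iota>_sum: "\<iota> (sum f A) = (\<Sum>i\<in>A. \<iota> (f i))"
  by (induction A rule: infinite_finite_induct) (auto simp: \<iota>_add \<iota>_0)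

text \<open>One fixed choice of the basis, so that coordinates and the retraction
  \<open>\<pi>\<close> built from them refer to the same basis throughout.\<close>

definition B :: "'a set" where
  "B = (SOME B. \<not> L.dependent B \<and> L.span B = UNIV \<and> inj_on \<iota> B
         \<and> \<not> M.dependent (\<iota> ` B) \<and> M.span (\<iota> ` B) = UNIV)"

lemma B: "\<not> L.dependent B" "L.span B = UNIV" "inj_on \<iota> B" "\<not> M.dependent (\<iota> ` B)" "M.span (\<iota> ` B) = UNIV"
proof -
  have "\<exists>B. \<not> L.dependent B \<and> L.span B = UNIV \<and> inj_on \<iota> B
         \<and> \<not> M.dependent (\<iota> ` B) \<and> M.span (\<iota> ` B) = UNIV"
    using ext by (auto simp: scalar_extension_def)
  from someI_ex[OF this] show "\<not> L.dependent B" "L.span B = UNIV" "inj_on \<iota> B"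
    "\<not> M.dependent (\<iota> ` B)" "M.span (\<iota> ` B) = UNIV" unfolding B_def by auto
qed

lemma M_induct [case_names add zero]:
  assumes "\<And>c a m. P m \<Longrightarrow> P (scK c (\<iota> a) + m)" "P 0"
  shows "P m"
proof -
  have "m \<in> M.span (\<iota> ` B)" by (simp add: B)
  then show ?thesis by (induction rule: M.span_induct_alt) (use assms in auto)
qed

lemma L_induct [case_names add zero]:
  assumes "\<And>c b a. b \<in> B \<Longrightarrow> P a \<Longrightarrow> P (sc c b + a)" "P 0"
  shows "P a"
proof -
  have "a \<in> L.span B" by (simp add: B)
  then show ?thesis by (induction rule: L.span_induct_alt) (use assms in auto)
qed

lemma linmap_eqI:
  assumes "M.linmap S" "M.linmap T" "\<And>a. S (\<iota> a) = T (\<iota> a)"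
  shows "S m = T m"
  by (induction m rule: M_induct) (simp_all add: M.linmapD[OF assms(1)] M.linmapD[OF assms(2)] assms(3))

lemma extend_exists:
  assumes s: "vector_space s" and add: "\<And>a b. \<phi> (a + b) = \<phi> a + \<phi> b"
    and sca: "\<And>c a. \<phi> (sc c a) = s (e c) (\<phi> a)"
  shows "\<exists>\<Phi>. (\<forall>m n. \<Phi> (m + n) = \<Phi> m + \<Phi> n) \<and> (\<forall>c m. \<Phi> (scK c m) = s c (\<Phi> m)) \<and> (\<forall>a. \<Phi> (\<iota> a) = \<phi> a)"
proof -
  interpret P: vector_space_pair scK s
    using s M.vector_space_axioms by (simp add: vector_space_pair_def)
  obtain \<Phi> where \<Phi>: "Vector_Spaces.linear scK s \<Phi>" "\<And>b. b \<in> \<iota> ` B \<Longrightarrow> \<Phi> b = \<phi> (inv_into B \<iota> b)"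
    using P.linear_independent_extend[OF B(4), of "\<lambda>b. \<phi> (inv_into B \<iota> b)"] by blast
  have l: "\<Phi> (m + n) = \<Phi> m + \<Phi> n" "\<Phi> (scK c m) = s c (\<Phi> m)" for m n c
    using P.linear_add[OF \<Phi>(1)] P.linear_scale[OF \<Phi>(1)] by auto
  have "\<Phi> (\<iota> a) = \<phi> a" for a
  proof (induction a rule: L_induct)
    case (add c b a)
    then show ?case using \<Phi>(2)[of "\<iota> b"] inv_into_f_f[OF B(3)] by (simp add: \<iota>_add \<iota>_scale l assms)
  next
    case zero
    have "\<phi> 0 = 0" using assms(2)[of 0 0] by simp
    moreover have "\<Phi> 0 = 0" using l(1)[of 0 0] by simp
    ultimately show ?case by (simp add: \<iota>_0)
  qed
  with l show ?thesis by blast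
qed

text \<open>The large field is a vector space over the small one through \<open>e\<close>, and the
  vector 1 is independent, so a linear functional may be prescribed on it.\<close>

lemma retraction_exists:
  "\<exists>\<theta>. (\<forall>z w. \<theta> (z + w) = \<theta> z + \<theta> w) \<and> (\<forall>c z. \<theta> (e c * z) = c * \<theta> z) \<and> \<theta> 1 = 1"
proof -
  interpret P: vector_space_pair "\<lambda>c z. e c * z" "(*)"
    by unfold_locales (auto simp: algebra_simps e_add e_mult e_1)
  have "\<not> P.vs1.dependent {1}" by (simp add: P.vs1.dependent_single)
  then obtain \<theta> where \<theta>: "Vector_Spaces.linear (\<lambda>c z. e c * z) (*) \<theta>" "\<theta> 1 = 1"
    using P.linear_independent_extend[of "{1}" "\<lambda>_. 1"] by auto
  then show ?thesis using P.linear_add[OF \<theta>(1)] P.linear_scale[OF \<theta>(1)] by blast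
qed

definition \<theta> :: "'K \<Rightarrow> 'k" where
  "\<theta> = (SOME \<theta>. (\<forall>z w. \<theta> (z + w) = \<theta> z + \<theta> w) \<and> (\<forall>c z. \<theta> (e c * z) = c * \<theta> z) \<and> \<theta> 1 = 1)"

lemma \<theta>: "\<theta> (z + w) = \<theta> z + \<theta> w" "\<theta> (e c * z) = c * \<theta> z" "\<theta> 1 = 1"
  using someI_ex[OF retraction_exists] unfolding \<theta>_def by auto

lemma \<theta>_0: "\<theta> 0 = 0" using \<theta>(1)[of 0 0] by (metis add_0 add_cancel_right_right)

text \<open>The map \<open>\<theta> \<otimes> 1\<close>: a retraction of \<open>\<iota>\<close> commuting with \<open>br a\<close> for \<open>a\<close> in the small algebra.
  It preserves systems of linear equations with coefficients in the small algebra.\<close>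

definition \<pi> :: "'b \<Rightarrow> 'a" where
  "\<pi> m = (\<Sum>b | M.representation (\<iota> ` B) m b \<noteq> 0. sc (\<theta> (M.representation (\<iota> ` B) m b)) (inv_into B \<iota> b))"

lemma \<pi>_superset:
  assumes "finite A" "{b. M.representation (\<iota> ` B) m b \<noteq> 0} \<subseteq> A"
  shows "\<pi> m = (\<Sum>b\<in>A. sc (\<theta> (M.representation (\<iota> ` B) m b)) (inv_into B \<iota> b))"
  unfolding \<pi>_def using assms by (intro sum.mono_neutral_left) (auto simp: \<theta>_0)

lemma \<pi>_add: "\<pi> (m + n) = \<pi> m + \<pi> n"
proof -
  let ?r = "M.representation (\<iota> ` B)"
  let ?A = "{b. ?r m b \<noteq> 0} \<union> {b. ?r n b \<noteq> 0} \<union> {b. ?r (m + n) b \<noteq> 0}"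
  have A: "finite ?A" using M.finite_representation by auto
  have r: "?r (m + n) b = ?r m b + ?r n b" for b
    using M.representation_add[OF B(4)] B(5) by auto
  have "\<pi> (m + n) = (\<Sum>b\<in>?A. sc (\<theta> (?r (m + n) b)) (inv_into B \<iota> b))" by (rule \<pi>_superset[OF A]) auto
  also have "\<dots> = (\<Sum>b\<in>?A. sc (\<theta> (?r m b)) (inv_into B \<iota> b)) + (\<Sum>b\<in>?A. sc (\<theta> (?r n b)) (inv_into B \<iota> b))"
    by (simp add: r \<theta> L.scale_left_distrib sum.distrib)
  also have "(\<Sum>b\<in>?A. sc (\<theta> (?r m b)) (inv_into B \<iota> b)) = \<pi> m" by (rule \<pi>_superset[OF A, symmetric]) auto
  also have "(\<Sum>b\<in>?A. sc (\<theta> (?r n b)) (inv_into B \<iota> b)) = \<pi> n" by (rule \<pi>_superset[OF A, symmetric]) auto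
  finally show ?thesis .
qed

lemma \<pi>_0: "\<pi> 0 = 0" using \<pi>_add[of 0 0] by simp

lemma \<pi>_minus: "\<pi> (- m) = - \<pi> m"
  using \<pi>_add[of m "- m"] \<pi>_0 by (simp add: eq_neg_iff_add_eq_0 add.commute)

lemma \<pi>_scale_\<iota>: "\<pi> (scK c (\<iota> a)) = sc (\<theta> c) a"
proof (induction a arbitrary: c rule: L_induct)
  case (add d b a)
  have 1: "\<pi> (scK c (\<iota> b)) = sc (\<theta> c) b" if b: "b \<in> B" for b c
  proof -
    have b': "\<iota> b \<in> \<iota> ` B" using b by simp
    have r: "M.representation (\<iota> ` B) (scK c (\<iota> b)) b' = c * (if b' = \<iota> b then 1 else 0)" for b'
      using M.representation_scale[OF B(4), of "\<iota> b" c] M.representation_basis[OF B(4) b'] B(5) by auto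
    have "\<pi> (scK c (\<iota> b)) = (\<Sum>b'\<in>{\<iota> b}. sc (\<theta> (M.representation (\<iota> ` B) (scK c (\<iota> b)) b')) (inv_into B \<iota> b'))"
      by (rule \<pi>_superset) (auto simp: r)
    then show ?thesis using inv_into_f_f[OF B(3) b] by (simp add: r)
  qed
  have "scK c (\<iota> (sc d b + a)) = scK (e d * c) (\<iota> b) + scK c (\<iota> a)"
    by (simp add: \<iota>_add \<iota>_scale M.scale_right_distrib mult.commute)
  moreover have "sc (\<theta> c) (sc d b) = sc (d * \<theta> c) b" by (simp add: mult.commute)
  ultimately show ?case using add by (simp add: \<pi>_add 1 \<theta> L.scale_right_distrib del: L.scale_scale)
qed (simp add: \<iota>_0 \<pi>_0)

lemma \<pi>_\<iota>: "\<pi> (\<iota> a) = a"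
  using \<pi>_scale_\<iota>[of 1 a] by (simp add: \<theta>)

lemma \<iota>_inj: "\<iota> a = \<iota> b \<Longrightarrow> a = b"
  by (metis \<pi>_\<iota>)

lemma \<pi>_scale: "\<pi> (scK (e c) m) = sc c (\<pi> m)"
  by (induction m rule: M_induct)
    (simp_all add: M.scale_right_distrib \<pi>_add \<pi>_0 L.scale_right_distrib \<pi>_scale_\<iota> \<theta>)

lemma \<pi>_br: "\<pi> (brK (\<iota> a) m) = br a (\<pi> m)"
  by (induction m rule: M_induct)
    (simp_all add: M.br_linear L.br_linear \<pi>_add \<pi>_0 \<pi>_scale_\<iota> \<iota>_br[symmetric])

lemma \<pi>_br_right: "\<pi> (brK m (\<iota> a)) = br (\<pi> m) a"
  using \<pi>_br[of a m] M.br_swap[of m "\<iota> a"] L.br_swap[of "\<pi> m" a] by (simp add: \<pi>_minus)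

text \<open>The identities are linear in \<open>u\<close> and \<open>w\<close>, so it suffices to
  check them on the image of \<open>\<iota>\<close>, where they come from the small algebra.\<close>

lemma extremal_wrt_extend:
  assumes c: "extremal_wrt sc br c p" and p: "L.linfun p"
  shows "\<exists>P. extremal_wrt scK brK (\<iota> c) P \<and> (\<forall>a. P (\<iota> a) = e (p a))"
proof -
  note pl = L.linfunD[OF p]
  have "vector_space ((*) :: 'K \<Rightarrow> _)" by unfold_locales (auto simp: algebra_simps)
  from extend_exists[OF this, of "\<lambda>a. e (p a)"]
  obtain P where P: "\<And>m n. P (m + n) = P m + P n" "\<And>c m. P (scK c m) = c * P m" "\<And>a. P (\<iota> a) = e (p a)"
    by (auto simp: pl e_add e_mult)
  have lin: "M.linfun P" using P by (simp add: M.linfun_def)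
  note Pl = M.linfunD[OF lin]
  have C: "br c (br c u) = sc (2 * p u) c"
    "br (br c u) (br c w) = sc (p (br u w)) c + sc (p w) (br c u) - sc (p u) (br c w)"
    "br c (br u (br c w)) = sc (p (br u w)) c - sc (p w) (br c u) - sc (p u) (br c w)" for u w
    using c by (simp_all add: extremal_wrt_def)
  have \<iota>d: "\<iota> (a - b) = \<iota> a - \<iota> b" for a b using \<iota>_add[of a "- b"] \<iota>_minus[of b] by simp
  have e2: "e 2 = 2" using e_add[of 1 1] e_1 by simp
  note I = C[THEN arg_cong[of _ _ \<iota>]]
  have I1: "brK (\<iota> c) (brK (\<iota> c) (\<iota> u)) = scK (2 * P (\<iota> u)) (\<iota> c)" for u
    using I(1)[of u] by (simp add: \<iota>_br \<iota>_scale e_mult e2 P)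
  have I2: "brK (brK (\<iota> c) (\<iota> u)) (brK (\<iota> c) (\<iota> w))
    = scK (P (brK (\<iota> u) (\<iota> w))) (\<iota> c) + scK (P (\<iota> w)) (brK (\<iota> c) (\<iota> u)) - scK (P (\<iota> u)) (brK (\<iota> c) (\<iota> w))" for u w
    using I(2)[of u w] by (simp add: \<iota>_br[symmetric] P) (simp add: \<iota>_scale \<iota>_add \<iota>d)
  have I3: "brK (\<iota> c) (brK (\<iota> u) (brK (\<iota> c) (\<iota> w)))
    = scK (P (brK (\<iota> u) (\<iota> w))) (\<iota> c) - scK (P (\<iota> w)) (brK (\<iota> c) (\<iota> u)) - scK (P (\<iota> u)) (brK (\<iota> c) (\<iota> w))" for u w
    using I(3)[of u w] by (simp add: \<iota>_br[symmetric] P) (simp add: \<iota>_scale \<iota>d)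
  note lin_simps = M.linmap_def M.br_linear Pl M.scale_left_distrib M.scale_right_distrib distrib_left
    M.scale_left_diff_distrib M.scale_right_diff_distrib mult_ac
  have "brK (\<iota> c) (brK (\<iota> c) u) = scK (2 * P u) (\<iota> c)" for u
    by (rule linmap_eqI[where S = "\<lambda>u. brK (\<iota> c) (brK (\<iota> c) u)"]) (auto simp: lin_simps I1)
  moreover have "brK (brK (\<iota> c) u) (brK (\<iota> c) w)
    = scK (P (brK u w)) (\<iota> c) + scK (P w) (brK (\<iota> c) u) - scK (P u) (brK (\<iota> c) w)" for u w
  proof (rule linmap_eqI[where S = "\<lambda>u. brK (brK (\<iota> c) u) (brK (\<iota> c) w)"])
    fix a
    show "brK (brK (\<iota> c) (\<iota> a)) (brK (\<iota> c) w)
      = scK (P (brK (\<iota> a) w)) (\<iota> c) + scK (P w) (brK (\<iota> c) (\<iota> a)) - scK (P (\<iota> a)) (brK (\<iota> c) w)"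
      by (rule linmap_eqI[where S = "\<lambda>w. brK (brK (\<iota> c) (\<iota> a)) (brK (\<iota> c) w)"]) (auto simp: lin_simps I2)
  qed (auto simp: lin_simps)
  moreover have "brK (\<iota> c) (brK u (brK (\<iota> c) w))
    = scK (P (brK u w)) (\<iota> c) - scK (P w) (brK (\<iota> c) u) - scK (P u) (brK (\<iota> c) w)" for u w
  proof (rule linmap_eqI[where S = "\<lambda>u. brK (\<iota> c) (brK u (brK (\<iota> c) w))"])
    fix a
    show "brK (\<iota> c) (brK (\<iota> a) (brK (\<iota> c) w))
      = scK (P (brK (\<iota> a) w)) (\<iota> c) - scK (P w) (brK (\<iota> c) (\<iota> a)) - scK (P (\<iota> a)) (brK (\<iota> c) w)"
      by (rule linmap_eqI[where S = "\<lambda>w. brK (\<iota> c) (brK (\<iota> a) (brK (\<iota> c) w))"]) (auto simp: lin_simps I3)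
  qed (auto simp: lin_simps)
  ultimately show ?thesis using P(3) by (auto simp: extremal_wrt_def)
qed

end

section \<open>A hyperbolic pair over both fields\<close>

locale extremal_descent = scalar_ext sc br scK brK e \<iota> + S: simple_lie sc br + K: line_lie scK brK g
  for sc :: "'k::field \<Rightarrow> 'a::ab_group_add \<Rightarrow> 'a" and br
    and scK :: "'K::field \<Rightarrow> 'b::ab_group_add \<Rightarrow> 'b" and brK
    and e :: "'k \<Rightarrow> 'K" and \<iota> :: "'a \<Rightarrow> 'b" and g +
  fixes x y :: 'a and gx gy :: "'a \<Rightarrow> 'k"
  assumes x: "extremal_wrt sc br x gx" "x \<noteq> 0" and y: "extremal_wrt sc br y gy" "y \<noteq> 0"
    and gxy: "g (\<iota> x) (\<iota> y) = 1"
begin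

text \<open>The vector \<open>d\<close> shows that \<open>\<iota> c\<close> is not a sandwich. Its
  functional is therefore unique, and the form must agree with the extension of
  \<open>p\<close>.\<close>

lemma extremal_\<iota>:
  assumes c: "extremal_wrt sc br c p" "c \<noteq> 0" and d: "g (\<iota> c) d \<noteq> 0"
  shows "\<iota> c \<in> K.X" "g (\<iota> c) (\<iota> a) = e (p a)"
proof -
  have nz: "\<iota> c \<noteq> 0" using c(2) \<iota>_inj[of c 0] \<iota>_0 by auto
  obtain P where P: "extremal_wrt scK brK (\<iota> c) P" "\<And>a. P (\<iota> a) = e (p a)"
    using extremal_wrt_extend[OF c(1) S.extremal_wrt_linfun[OF c]] by blast
  then have E: "extremal scK brK (\<iota> c)" using nz by (auto simp: extremal_def)
  then show X: "\<iota> c \<in> K.X" using K.X_extremal[OF nz] by simp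
  have "\<not> sandwich brK (\<iota> c)" using d E K.form by (auto simp: extremal_form_def)
  then have "g (\<iota> c) = P" using K.extremal_wrt_unique P(1) X by (simp add: K.X_def)
  then show "g (\<iota> c) (\<iota> a) = e (p a)" using P(2) by simp
qed

lemma gx: "\<iota> x \<in> K.X" "g (\<iota> x) (\<iota> a) = e (gx a)"
  using extremal_\<iota>[OF x, of "\<iota> y"] gxy by auto

lemma gy: "\<iota> y \<in> K.X" "g (\<iota> y) (\<iota> a) = e (gy a)"
  using extremal_\<iota>[OF y, of "\<iota> x"] gxy K.g_sym[of "\<iota> y"] by auto

lemma hpK: "K.hp (\<iota> x) (\<iota> y)"
  using gx(1) gy(1) gxy by (simp add: K.hp_def)

end

sublocale extremal_descent \<subseteq> H: hyp scK brK "\<iota> x" "\<iota> y" "g (\<iota> x)" "g (\<iota> y)"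
  by (rule K.hp_hyp[OF hpK])

text \<open>The relations between \<open>gx\<close> and \<open>gy\<close> are pulled back from the
  large field along the injective map \<open>e\<close>.\<close>

sublocale extremal_descent \<subseteq> h: hyp sc br x y gx gy
proof -
  have "e (gx y) = e 1" "e (gy x) = e 1"
    using gx(2)[of y] gy(2)[of x] gxy K.g_sym[of "\<iota> y" "\<iota> x"] e_1 by simp_all
  then have "gx y = 1" "gy x = 1" by (auto dest: e_inj)
  moreover have "gx (br y m) = - gy (br x m)" for m
  proof (rule e_inj)
    show "e (gx (br y m)) = e (- gy (br x m))"
      using H.p_br_y[of "\<iota> m"] by (simp add: e_minus gx(2)[symmetric] gy(2)[symmetric] \<iota>_br)
  qed
  moreover have "br x y \<noteq> 0" using H.e_neq_0 \<iota>_br[of x y] \<iota>_0 by auto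
  ultimately show "hyp sc br x y gx gy"
    unfolding hyp_def hyp_axioms_def
    using L.lie_alg_axioms S.extremal_wrt_linfun[OF x] S.extremal_wrt_linfun[OF y]
      S.extremal_wrt_self[OF x] S.extremal_wrt_self[OF y] x y by blast
qed

context extremal_descent
begin

lemma \<iota>_Gr: "m \<in> h.Gr i \<Longrightarrow> \<iota> m \<in> H.Gr i"
  unfolding h.Gr_def H.Gr_def
  by (auto simp: \<iota>_scale \<iota>_br[symmetric] \<iota>_minus \<iota>_0 split: if_splits)

lemma \<pi>_Gr: "m \<in> H.Gr i \<Longrightarrow> \<pi> m \<in> h.Gr i"
  unfolding h.Gr_def H.Gr_def
  by (auto simp: \<pi>_scale_\<iota> \<pi>_br[symmetric] \<pi>_minus \<pi>_0 split: if_splits)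

text \<open>Replacing \<open>T j\<close> by its image under \<open>\<pi>\<close> changes it by a derivation of degree \<open>j\<close>,
  which can be integrated and composed with \<open>T\<close>.\<close>

lemma HS_rational_step:
  assumes T: "H.HS T" and j: "j \<ge> 2" and rat: "\<And>d a. d < j \<Longrightarrow> T d (\<iota> a) \<in> range \<iota>"
  obtains T' where "H.HS T'" "\<And>d m. d < j \<Longrightarrow> T' d m = T d m" "\<And>a. T' j (\<iota> a) \<in> range \<iota>"
proof -
  note Tl = H.HS_D(4)[OF T]
  define t where "t a = \<pi> (T j (\<iota> a))" for a
  have t_add: "t (a + b) = t a + t b" for a b by (simp add: t_def \<iota>_add M.linmapD[OF Tl] \<pi>_add)
  have t_sca: "t (sc c a) = sc c (t a)" for c a by (simp add: t_def \<iota>_scale M.linmapD[OF Tl] \<pi>_scale)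
  obtain \<Phi> where \<Phi>: "\<And>m n. \<Phi> (m + n) = \<Phi> m + \<Phi> n" "\<And>c m. \<Phi> (scK c m) = scK c (\<Phi> m)" "\<And>a. \<Phi> (\<iota> a) = \<iota> (t a)"
    using extend_exists[OF M.vector_space_axioms, of "\<lambda>a. \<iota> (t a)"] by (auto simp: t_add t_sca \<iota>_add \<iota>_scale)
  have lin: "M.linmap \<Phi>" using \<Phi> by (simp add: M.linmap_def)
  have \<Phi>_Gr: "\<Phi> (\<iota> a) \<in> H.Gr (i + int j)" if "a \<in> h.Gr i" for a i
    using \<iota>_Gr[OF \<pi>_Gr[OF H.homD(2)[OF H.HS_D(1)[OF T, of j] \<iota>_Gr[OF that]]]] by (simp add: \<Phi> t_def)
  have cmp: "H.cp (i + int j) (\<Phi> m) = \<Phi> (H.cp i m)" for i m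
  proof (rule linmap_eqI[where S = "\<lambda>m. H.cp (i + int j) (\<Phi> m)"])
    fix a
    have a: "\<iota> a = (\<Sum>k\<in>{-2..2}. \<iota> (h.cp k a))" by (subst h.cp_sum) (rule \<iota>_sum)
    show "H.cp (i + int j) (\<Phi> (\<iota> a)) = \<Phi> (H.cp i (\<iota> a))"
      unfolding a M.linmap_sum[OF lin] M.linmap_sum[OF H.cp_linmap]
    proof (rule sum.cong)
      fix k :: int
      show "H.cp (i + int j) (\<Phi> (\<iota> (h.cp k a))) = \<Phi> (H.cp i (\<iota> (h.cp k a)))"
        using H.Gr_cp[OF \<Phi>_Gr[OF h.cp_Gr], of "i + int j" k a] H.Gr_cp[OF \<iota>_Gr[OF h.cp_Gr], of i k a]
        by (simp add: M.linmapD[OF lin])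
    qed simp
  qed (use lin H.cp_linmap in \<open>auto intro: M.linmap_comp\<close>)
  define D where "D m = \<Phi> m - T j m" for m
  have D_lin: "M.linmap D" unfolding D_def by (rule M.linmap_diff[OF lin Tl])
  have "H.hom (int j) \<Phi>"
    unfolding H.hom_def
  proof (intro conjI allI ballI lin)
    fix i m assume "m \<in> H.Gr i"
    then have "\<Phi> m = H.cp (i + int j) (\<Phi> m)" using H.Gr_cp[of m i i] by (simp add: cmp)
    then show "\<Phi> m \<in> H.Gr (i + int j)" using H.cp_Gr by metis
  qed
  then have D_hom: "H.hom (int j) D"
    using H.HS_D(1)[OF T, of j] unfolding D_def H.hom_def by (auto simp: H.gr_diff intro: M.linmap_diff)
  \<comment> \<open>The middle terms of the product rule involve only degrees below
    \<open>j\<close>, so they lie in the image of \<open>\<iota>\<close> and are fixed by the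
    retraction. They cancel in \<open>D\<close>, leaving the derivation rule.\<close>
  have D_\<iota>: "D (brK (\<iota> a) (\<iota> b)) = brK (D (\<iota> a)) (\<iota> b) + brK (\<iota> a) (D (\<iota> b))" for a b
  proof -
    have "\<exists>c. (\<Sum>i\<in>{0<..<j}. brK (T i (\<iota> a)) (T (j - i) (\<iota> b))) = \<iota> c"
    proof -
      have "\<exists>c. brK (T i (\<iota> a)) (T (j - i) (\<iota> b)) = \<iota> c" if "i \<in> {0<..<j}" for i
      proof -
        have "i < j" "j - i < j" using that by auto
        then obtain a' b' where "T i (\<iota> a) = \<iota> a'" "T (j - i) (\<iota> b) = \<iota> b'" using rat by blast
        then show ?thesis using \<iota>_br by metis
      qed
      then obtain c where "\<And>i. i \<in> {0<..<j} \<Longrightarrow> brK (T i (\<iota> a)) (T (j - i) (\<iota> b)) = \<iota> (c i)" by metis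
      then have "(\<Sum>i\<in>{0<..<j}. brK (T i (\<iota> a)) (T (j - i) (\<iota> b))) = \<iota> (\<Sum>i\<in>{0<..<j}. c i)"
        by (simp add: \<iota>_sum)
      then show ?thesis by blast
    qed
    then obtain c where c: "(\<Sum>i\<in>{0<..<j}. brK (T i (\<iota> a)) (T (j - i) (\<iota> b))) = \<iota> c" by blast
    have "{..j} = insert 0 (insert j {0<..<j})" using j by auto
    then have Tj: "T j (brK (\<iota> a) (\<iota> b)) = brK (\<iota> a) (T j (\<iota> b)) + (brK (T j (\<iota> a)) (\<iota> b) + \<iota> c)"
      using H.HS_D(3)[OF T, of j "\<iota> a" "\<iota> b"] j c by (simp add: H.HS_D(2)[OF T])
    then have "t (br a b) = br a (t b) + (br (t a) b + c)"
      by (simp add: t_def \<iota>_br \<pi>_add \<pi>_br \<pi>_br_right \<pi>_\<iota>)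
    then have "\<Phi> (brK (\<iota> a) (\<iota> b)) = brK (\<iota> a) (\<Phi> (\<iota> b)) + (brK (\<Phi> (\<iota> a)) (\<iota> b) + \<iota> c)"
      by (simp add: \<iota>_br[symmetric] \<Phi> \<iota>_add)
    then show ?thesis using Tj by (simp add: D_def M.br_linear)
  qed
  have D_br: "D (brK m n) = brK (D m) n + brK m (D n)" for m n
  proof (rule linmap_eqI[where S = "\<lambda>m. D (brK m n)"])
    note s = M.linmap_def M.linmapD[OF D_lin] M.br_linear M.scale_right_distrib
    show "M.linmap (\<lambda>m. D (brK m n))" "M.linmap (\<lambda>m. brK (D m) n + brK m (D n))" by (auto simp: s)
    fix a
    show "D (brK (\<iota> a) n) = brK (D (\<iota> a)) n + brK (\<iota> a) (D n)"
      by (rule linmap_eqI[where S = "\<lambda>n. D (brK (\<iota> a) n)"]) (auto simp: s D_\<iota>)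
  qed
  have "H.integrable j D"
    by (rule K.der_integrable[OF hpK j]) (simp add: H.der_def D_hom D_br)
  then obtain S where S: "H.HS S" "\<And>i m. 0 < i \<Longrightarrow> i < j \<Longrightarrow> S i m = 0" "S j = D" by (auto simp: H.integrable_def)
  have j1: "1 \<le> j" using j by simp
  note A = H.HS_adjust[OF S(1) T S(2) j1]
  show ?thesis
  proof (rule that[of "\<lambda>d m. \<Sum>i\<le>d. S i (T (d - i) m)"])
    show "H.HS (\<lambda>d m. \<Sum>i\<le>d. S i (T (d - i) m))" by (rule A(1))
    show "(\<Sum>i\<le>d. S i (T (d - i) m)) = T d m" if "d < j" for d m using A(2) that by simp
    show "(\<Sum>i\<le>j. S i (T (j - i) (\<iota> a))) \<in> range \<iota>" for a
      using A(3)[of "\<iota> a"] by (simp add: S(3) D_def \<Phi>)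
  qed
qed

lemma HS_rational_exists:
  assumes l: "br y (br x l) = - l"
  obtains T where "H.HS T" "\<And>m. T 1 m = brK (\<iota> l) m" "\<And>d a. T d (\<iota> a) \<in> range \<iota>"
proof -
  have "brK (\<iota> y) (brK (\<iota> x) (\<iota> l)) = - \<iota> l" using l by (simp add: \<iota>_br[symmetric] \<iota>_minus)
  then obtain T where T: "H.HS T" "\<And>m. T 1 m = brK (\<iota> l) m" using K.HS_exists[OF hpK] by blast
  \<comment> \<open>The induction starts with degrees below 2, where \<open>T 0\<close> and
    \<open>T 1\<close> are already rational, and gains one degree per step; \<open>n = 3\<close>
    covers all degrees up to 4.\<close>
  have "\<exists>T. H.HS T \<and> (\<forall>m. T 1 m = brK (\<iota> l) m) \<and> (\<forall>d a. d < n + 2 \<longrightarrow> T d (\<iota> a) \<in> range \<iota>)" for n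
  proof (induction n)
    case 0
    have "T d (\<iota> a) \<in> range \<iota>" if "d < 2" for d a
    proof -
      have "d = 0 \<or> d = 1" using that by linarith
      moreover have "T 0 (\<iota> a) = \<iota> a" "T 1 (\<iota> a) = \<iota> (br l a)" by (simp_all only: H.HS_D(2)[OF T(1)] T(2) \<iota>_br)
      ultimately show ?thesis by (metis rangeI)
    qed
    then show ?case using T by auto
  next
    case (Suc n)
    then obtain T where T: "H.HS T" "\<And>m. T 1 m = brK (\<iota> l) m" "\<And>d a. d < n + 2 \<Longrightarrow> T d (\<iota> a) \<in> range \<iota>" by blast
    obtain T' where T': "H.HS T'" "\<And>d m. d < n + 2 \<Longrightarrow> T' d m = T d m" "\<And>a. T' (n + 2) (\<iota> a) \<in> range \<iota>"
      using HS_rational_step[OF T(1), of "n + 2"] T(3) by auto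
    have "T' d (\<iota> a) \<in> range \<iota>" if "d < Suc n + 2" for d a
      using that T'(2,3) T(3) by (cases "d < n + 2") (auto simp: less_Suc_eq)
    then show ?case using T' T(2) by (intro exI[of _ T']) auto
  qed
  from this[of 3] obtain T where T: "H.HS T" "\<And>m. T 1 m = brK (\<iota> l) m" "\<And>d a. d < 5 \<Longrightarrow> T d (\<iota> a) \<in> range \<iota>"
    by (auto simp: numeral_eq_Suc)
  have "T d (\<iota> a) \<in> range \<iota>" for d a
    using T(3) H.HS_zero[OF T(1), of d "\<iota> a"] \<iota>_0 by (cases "d < 5") (auto intro: range_eqI[of _ _ 0])
  with T(1,2) show ?thesis by (rule that)
qed

lemma exponential_exists:
  assumes l: "br y (br x l) = - l"
  shows "\<exists>\<alpha>. exponential_automorphism sc br h.Gr l \<alpha>"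
proof -
  obtain T where T: "H.HS T" "\<And>m. T 1 m = brK (\<iota> l) m" "\<And>d a. T d (\<iota> a) \<in> range \<iota>"
    using HS_rational_exists[OF l] by blast
  note Tl = M.linmapD[OF H.HS_D(4)[OF T(1)]]
  define t where "t d a = \<pi> (T d (\<iota> a))" for d a
  have \<iota>t: "\<iota> (t d a) = T d (\<iota> a)" for d a
    using T(3)[of d a] by (auto simp: t_def \<pi>_\<iota>)
  have HS: "h.HS t"
    unfolding h.HS_def
  proof (intro conjI allI)
    fix d a b
    have "L.linmap (t d)" by (simp add: L.linmap_def t_def \<iota>_add \<iota>_scale Tl \<pi>_add \<pi>_scale)
    then show "h.hom (int d) (t d)"
      unfolding h.hom_def using \<pi>_Gr[OF H.homD(2)[OF H.HS_D(1)[OF T(1)] \<iota>_Gr]] by (auto simp: t_def)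
    show "t 0 a = a" by (simp add: t_def H.HS_D(2)[OF T(1)] \<pi>_\<iota>)
    show "t d (br a b) = (\<Sum>i\<le>d. br (t i a) (t (d - i) b))"
      by (rule \<iota>_inj) (simp add: \<iota>t \<iota>_br \<iota>_sum H.HS_D(3)[OF T(1)])
  qed
  have t1: "t 1 a = br l a" for a by (rule \<iota>_inj) (simp only: \<iota>t T(2) \<iota>_br)
  define \<alpha> where "\<alpha> m = (\<Sum>d\<le>4. t d m)" for m
  note A = h.HS_autom[OF HS, folded \<alpha>_def]
  have "lie_automorphism sc br \<alpha>"
    using A L.linmapD[OF A(1)] by (auto simp: lie_automorphism_def)
  moreover have "\<alpha> m = m + br l m + t 2 m + t 3 m + t 4 m" for m
    using t1[of m] h.HS_D(2)[OF HS, of m] by (simp add: \<alpha>_def numeral_eq_Suc)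
  moreover have "t 2 ` h.Gr i \<subseteq> h.Gr (i + 2) \<and> t 3 ` h.Gr i \<subseteq> h.Gr (i + 3) \<and> t 4 ` h.Gr i \<subseteq> h.Gr (i + 4)" for i
    using h.homD(2)[OF h.HS_D(1)[OF HS, of 2]] h.homD(2)[OF h.HS_D(1)[OF HS, of 3]]
      h.homD(2)[OF h.HS_D(1)[OF HS, of 4]] by auto
  ultimately show ?thesis unfolding exponential_automorphism_def by blast
qed

text \<open>For \<open>u\<close> in the space \<open>U\<close>, the identities \<open>xyx\<close>
  and \<open>yxy\<close> turn into the eigenvalue equations. Conversely, an eigenvector
  \<open>m\<close> is the image of \<open>- br x m\<close> or \<open>- br y m\<close>, which lies in
  \<open>U\<close>.\<close>

lemma grading_eq: "grading sc br (\<lambda>u w. g (\<iota> u) (\<iota> w)) x y = h.Gr"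
proof
  fix i
  have U: "{u. g (\<iota> u) (\<iota> x) = 0 \<and> g (\<iota> u) (\<iota> y) = 0 \<and> g (\<iota> u) (\<iota> (br x y)) = 0}
    = {u. gx u = 0 \<and> gy u = 0 \<and> gx (br y u) = 0}"
  proof -
    have 0: "e a = 0 \<longleftrightarrow> a = 0" for a using e_inj[of a 0] e_0 by auto
    have "g (\<iota> u) (\<iota> x) = e (gx u)" "g (\<iota> u) (\<iota> y) = e (gy u)" "g (\<iota> u) (\<iota> (br x y)) = e (gx (br y u))" for u
      using K.g_sym[of "\<iota> u"] gx(2) gy(2) K.g_assoc[of "\<iota> x" "\<iota> y" "\<iota> u"] by (simp_all add: \<iota>_br)
        (metis \<iota>_br gx(2))
    then show ?thesis by (simp add: 0)
  qed
  let ?U = "{u. gx u = 0 \<and> gy u = 0 \<and> gx (br y u) = 0}"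
  have 1: "br y ` ?U = {m. br y (br x m) = - m}"
  proof (intro equalityI subsetI)
    fix m assume "m \<in> br y ` ?U"
    then show "m \<in> {m. br y (br x m) = - m}" using h.yxy by auto
  next
    fix m assume "m \<in> {m. br y (br x m) = - m}"
    then have m: "br y (br x m) = - m" by simp
    note f = h.Gr1_facts[OF m]
    have "m = br y (- br x m)" using m by (simp add: L.br_linear)
    moreover have "- br x m \<in> ?U" using f m by (simp add: L.br_linear h.pl h.rl h.p_br_x h.r_br_x)
    ultimately show "m \<in> br y ` ?U" by (rule image_eqI)
  qed
  have 2: "br x ` ?U = {m. br x (br y m) = - m}"
  proof (intro equalityI subsetI)
    fix m assume "m \<in> br x ` ?U"
    then show "m \<in> {m. br x (br y m) = - m}" using h.xyx by auto
  next
    fix m assume "m \<in> {m. br x (br y m) = - m}"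
    then have m: "br x (br y m) = - m" by simp
    note f = h.Grm1_facts[OF m]
    have "m = br x (- br y m)" using m by (simp add: L.br_linear)
    moreover have "- br y m \<in> ?U" using f by (simp add: L.br_linear h.pl h.rl h.r_br_y h.y1)
    ultimately show "m \<in> br x ` ?U" by (rule image_eqI)
  qed
  have 3: "{l. \<exists>a. br x l = sc a x} \<inter> {l. \<exists>a. br y l = sc a y}
    = {m. (\<exists>a. br x m = sc a x) \<and> (\<exists>a. br y m = sc a y)}" by auto
  show "grading sc br (\<lambda>u w. g (\<iota> u) (\<iota> w)) x y i = h.Gr i"
    unfolding grading_def Let_def U 1 2 3 h.Gr_def by simp
qed

end

theorem theorem3p16:
  fixes e :: "'k::field \<Rightarrow> 'K::field"
    and sc :: "'k \<Rightarrow> 'a::ab_group_add \<Rightarrow> 'a" and br :: "'a \<Rightarrow> 'a \<Rightarrow> 'a"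
    and scK :: "'K \<Rightarrow> 'b::ab_group_add \<Rightarrow> 'b" and brK :: "'b \<Rightarrow> 'b \<Rightarrow> 'b"
    and \<iota> :: "'a \<Rightarrow> 'b" and g :: "'b \<Rightarrow> 'b \<Rightarrow> 'K" and x y :: 'a
  assumes "simple_lie_algebra sc br"
    and "galois_ext e"
    and "card (UNIV :: 'K set) \<noteq> 2"
    and "scalar_extension e sc br scK brK \<iota>"
    and "simple_lie_algebra scK brK"
    and "lie_generated_by scK brK {z. pure_extremal scK brK z}"
    and "geometry_contains_lines scK brK"
    and "extremal_form scK brK g"
    and "extremal sc br x" and "extremal sc br y"
    and "g (\<iota> x) (\<iota> y) = 1"
  shows "\<forall>l \<in> grading sc br (\<lambda>u w. g (\<iota> u) (\<iota> w)) x y 1.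
           \<exists>\<alpha>. exponential_automorphism sc br (grading sc br (\<lambda>u w. g (\<iota> u) (\<iota> w)) x y) l \<alpha>"
proof -
  obtain gx gy where gxy: "extremal_wrt sc br x gx" "x \<noteq> 0" "extremal_wrt sc br y gy" "y \<noteq> 0"
    using assms(9,10) by (auto simp: extremal_def)
  have "lie_alg sc br" "lie_alg scK brK"
    using assms(1,5) by (simp_all add: simple_lie_algebra_def lie_alg_iff)
  then interpret D: extremal_descent sc br scK brK e \<iota> g x y gx gy
    unfolding extremal_descent_def scalar_ext_def scalar_ext_axioms_def simple_lie_def simple_lie_axioms_def
      line_lie_def line_lie_axioms_def ext_lie_def ext_lie_axioms_def extremal_descent_axioms_def
    using assms gxy by blast
  show ?thesis
    unfolding D.grading_eq using D.exponential_exists by (simp add: D.h.Gr_def)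
qed

end
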